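(* Let $\mathbf{X}_1,\mathbf{X}_2,\ldots$ be i.i.d. $k$-variate random vectors with distribution $F$ such that $E_F[\boldsymbol{g}(\mathbf{X},\boldsymbol{\theta}_0)]=\boldsymbol{0}_r$ (that is, the null hypothesis $H_0:\boldsymbol{\theta}=\boldsymbol{\theta}_0$ holds), where $\boldsymbol{g}=(g_1,\ldots,g_r)^T$ is a vector of $r\ge p$ functionally independent estimating functions for the parameter $\boldsymbol{\theta}\in\Theta\subset\mathbb{R}^p$. Assume: (i) $\boldsymbol{S}_{11}(\boldsymbol{\theta}_0)=E_F[\boldsymbol{g}(\mathbf{X},\boldsymbol{\theta}_0)\boldsymbol{g}(\mathbf{X},\boldsymbol{\theta}_0)^T]$ is positive definite and $\boldsymbol{S}_{12}(\boldsymbol{\theta}_0)=E_F[\boldsymbol{G}_{\mathbf{X}}(\boldsymbol{\theta}_0)]$ has rank $p$, where $\boldsymbol{G}_{\boldsymbol{x}}(\boldsymbol{\theta})=\partial\boldsymbol{g}(\boldsymbol{x},\boldsymbol{\theta})/\partial\boldsymbol{\theta}^T$; (ii) there is a neighbourhood of $\boldsymbol{\theta}_0$ in which $\|\boldsymbol{g}(\boldsymbol{x},\boldsymbol{\theta})\|^3$ is bounded by some integrable function of $\boldsymbol{x}$; (iii) there is a neighbourhood of $\boldsymbol{\theta}_0$ in which $\boldsymbol{G}_{\boldsymbol{x}}(\boldsymbol{\theta})$ is continuous and $\|\boldsymbol{G}_{\boldsymbol{x}}(\boldsymbol{\theta})\|$ is bounded by some integrable function of $\boldsymbol{x}$; (iv)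 there is a neighbourhood of $\boldsymbol{\theta}_0$ in which $\partial\boldsymbol{G}_{\boldsymbol{x}}(\boldsymbol{\theta})/\partial\boldsymbol{\theta}$ is continuous and $\|\partial\boldsymbol{G}_{\boldsymbol{x}}(\boldsymbol{\theta})/\partial\boldsymbol{\theta}\|$ is bounded by some integrable function of $\boldsymbol{x}$. Then, for every $\phi\in\Phi$, the empirical $\phi$-divergence test statistic satisfies $$S_n^{\phi}(\widehat{\boldsymbol{\theta}}_{E,n},\boldsymbol{\theta}_0)\ \longrightarrow\ \chi^2_p\quad\text{in law as } n\to\infty .$$
   Context: Empirical likelihood. For $\boldsymbol{\theta}\in\Theta$, let $p_i(\boldsymbol{\theta})=\frac1n\,\frac{1}{1+\boldsymbol{t}(\boldsymbol{\theta})^T\boldsymbol{g}(\mathbf{X}_i,\boldsymbol{\theta})}$, $i=1,\ldots,n$, where the vector $\boldsymbol{t}(\boldsymbol{\theta})\in\mathbb{R}^r$ (depending on the sample) is determined by $$\frac1n\sum_{i=1}^n\frac{\boldsymbol{g}(\mathbf{X}_i,\boldsymbol{\theta})}{1+\boldsymbol{t}(\boldsymbol{\theta})^T\boldsymbol{g}(\mathbf{X}_i,\boldsymbol{\theta})}=\boldsymbol{0}_r,\qquad p_i(\boldsymbol{\theta})\ge 0,\quad \sum_{i=1}^n p_i(\boldsymbol{\theta})=1 .$$ These are the weights maximizing $\sum_i\log p_i$ over probability vectors subject to $\sum_i p_i\,\boldsymbol{g}(\mathbf{X}_i,\boldsymbol{\theta})=\boldsymbol{0}_r$. $F_{n,\boldsymbol{\theta}}$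 is the discrete distribution putting mass $p_i(\boldsymbol{\theta})$ at $\mathbf{X}_i$. The kernel of the empirical log-likelihood is $\ell_{E,n}(\boldsymbol{\theta})=-\sum_{i=1}^n\log[1+\boldsymbol{t}(\boldsymbol{\theta})^T\boldsymbol{g}(\mathbf{X}_i,\boldsymbol{\theta})]$, and the empirical maximum likelihood estimator $\widehat{\boldsymbol{\theta}}_{E,n}$ is obtained by maximizing $\ell_{E,n}$. Class $\Phi$. $\Phi$ is the set of convex functions $\phi:\mathbb{R}^+\to\mathbb{R}$ with $\phi(1)=0$, $\phi'(1)=0$, $\phi''(1)>0$, with the conventions $0\,\phi(0/0)=0$ and $0\,\phi(p/0)=p\lim_{u\to\infty}\phi(u)/u$. Test statistic. $$S_n^{\phi}(\widehat{\boldsymbol{\theta}}_{E,n},\boldsymbol{\theta}_0)=\frac{2n}{\phi''(1)}D_\phi(F_{n,\widehat{\boldsymbol{\theta}}_{E,n}},F_{n,\boldsymbol{\theta}_0}),\qquad D_\phi(F_{n,\boldsymbol{\theta}},F_{n,\boldsymbol{\theta}_0})=\sum_{i=1}^n p_i(\boldsymbol{\theta}_0)\,\phi\!\left(\frac{p_i(\boldsymbol{\theta})}{p_i(\boldsymbol{\theta}_0)}\right).$$ Standing asymptotics of the estimator. With $\boldsymbol{S}_{21}=\boldsymbol{S}_{12}^T$, $\boldsymbol{V}=(\boldsymbol{S}_{12}^T\boldsymbol{S}_{11}^{-1}\boldsymbol{S}_{12})^{-1}$ and $\boldsymbol{R}=\boldsymbol{S}_{11}^{-1}-\boldsymbol{S}_{11}^{-1}\boldsymbol{S}_{12}\boldsymbol{V}\boldsymbol{S}_{21}\boldsymbol{S}_{11}^{-1}$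 (all at $\boldsymbol{\theta}_0$), it is assumed throughout (as in Qin and Lawless, 1994, under regularity conditions) that when $\boldsymbol{\theta}_0$ is the true parameter, $\sqrt n\,(\widehat{\boldsymbol{\theta}}_{E,n}-\boldsymbol{\theta}_0)$ and $\sqrt n\,\boldsymbol{t}(\widehat{\boldsymbol{\theta}}_{E,n})$ converge jointly in law to independent centred normals with covariance matrices $\boldsymbol{V}$ and $\boldsymbol{R}$ respectively. *)

theory Defs
  imports "HOL-Probability.Probability"
begin

section \<open>Limit laws\<close>

text \<open>Measurability of the \<open>Y n\<close> is part of convergence in law.\<close>

definition converges_in_law ::
  "'a measure \<Rightarrow> (nat \<Rightarrow> 'a \<Rightarrow> 'b::metric_space) \<Rightarrow> 'b measure \<Rightarrow> bool" where
  "converges_in_law M Y N \<longleftrightarrow>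
     (\<forall>n. Y n \<in> borel_measurable M) \<and>
     (\<forall>f :: 'b \<Rightarrow> real. continuous_on UNIV f \<longrightarrow> bounded (range f) \<longrightarrow>
        (\<lambda>n. \<integral>\<omega>. f (Y n \<omega>) \<partial>M) \<longlonglongrightarrow> (\<integral>y. f y \<partial>N))"

text \<open>The covariance matrix may be singular, so the normal law is defined by its linear functionals,
  which are univariate normal or degenerate at zero.\<close>

definition centred_normal :: "(real^'n) measure \<Rightarrow> real^'n^'n \<Rightarrow> bool" where
  "centred_normal N C \<longleftrightarrow>
     prob_space N \<and> sets N = sets borel \<and> transpose C = C \<and>
     (\<forall>u. let v = u \<bullet> (C *v u) in
        (v > 0 \<and> distributed N lborel (\<lambda>x. u \<bullet> x) (normal_density 0 (sqrt v))) \<or>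
        (v = 0 \<and> (AE x in N. u \<bullet> x = 0)))"

definition chi_square :: "nat \<Rightarrow> real measure" where
  "chi_square k = distr (Pi\<^sub>M {..<k} (\<lambda>_. std_normal_distribution)) borel (\<lambda>z. \<Sum>i<k. (z i)\<^sup>2)"

section \<open>Estimating functions\<close>

text \<open>No component of \<open>g\<close>, as a function of \<open>(x, \<theta>)\<close>, is a continuously differentiable function
  of the remaining components; \<open>h'\<close> is the gradient of \<open>h\<close>.\<close>

definition functionally_independent ::
  "(real^'p) set \<Rightarrow> (real^'k \<Rightarrow> real^'p \<Rightarrow> real^'r) \<Rightarrow> bool" where
  "functionally_independent \<Theta> g \<longleftrightarrow>
     (\<nexists>j h h'. (\<forall>y z. (\<forall>i. i \<noteq> j \<longrightarrow> y $ i = z $ i) \<longrightarrow> h y = (h z :: real)) \<and>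
        (\<forall>z. (h has_derivative (\<lambda>v. h' z \<bullet> v)) (at z)) \<and> continuous_on UNIV h' \<and>
        (\<forall>x. \<forall>\<theta>\<in>\<Theta>. g x \<theta> $ j = h (g x \<theta>)))"

text \<open>The Jacobian matrix has entry \<open>\<partial>g\<^sub>i/\<partial>\<theta>\<^sub>j\<close> at \<open>$ i $ j\<close>;
  the array of its derivatives has \<open>\<partial>\<^sup>2g\<^sub>i/\<partial>\<theta>\<^sub>l\<partial>\<theta>\<^sub>j\<close> at \<open>$ l $ i $ j\<close>.
  The norm on these array types is the Frobenius norm.\<close>

definition G :: "(real^'k \<Rightarrow> real^'p \<Rightarrow> real^'r) \<Rightarrow> real^'k \<Rightarrow> real^'p \<Rightarrow> real^'p^'r" where
  "G g x \<theta> = jacobian (g x) (at \<theta>)"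

definition dG :: "(real^'k \<Rightarrow> real^'p \<Rightarrow> real^'r) \<Rightarrow> real^'k \<Rightarrow> real^'p \<Rightarrow> real^'p^'r^'p" where
  "dG g x \<theta> = (\<chi> l. frechet_derivative (G g x) (at \<theta>) (axis l 1))"

definition S11 :: "(real^'k) measure \<Rightarrow> (real^'k \<Rightarrow> real^'p \<Rightarrow> real^'r) \<Rightarrow> real^'p \<Rightarrow> real^'r^'r" where
  "S11 F g \<theta> = (\<chi> i j. \<integral>x. g x \<theta> $ i * g x \<theta> $ j \<partial>F)"

definition S12 :: "(real^'k) measure \<Rightarrow> (real^'k \<Rightarrow> real^'p \<Rightarrow> real^'r) \<Rightarrow> real^'p \<Rightarrow> real^'p^'r" where
  "S12 F g \<theta> = (\<chi> i j. \<integral>x. G g x \<theta> $ i $ j \<partial>F)"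

definition V :: "(real^'k) measure \<Rightarrow> (real^'k \<Rightarrow> real^'p \<Rightarrow> real^'r) \<Rightarrow> real^'p \<Rightarrow> real^'p^'p" where
  "V F g \<theta> = matrix_inv (transpose (S12 F g \<theta>) ** matrix_inv (S11 F g \<theta>) ** S12 F g \<theta>)"

definition R :: "(real^'k) measure \<Rightarrow> (real^'k \<Rightarrow> real^'p \<Rightarrow> real^'r) \<Rightarrow> real^'p \<Rightarrow> real^'r^'r" where
  "R F g \<theta> =
     matrix_inv (S11 F g \<theta>) -
     matrix_inv (S11 F g \<theta>) ** S12 F g \<theta> ** V F g \<theta> ** transpose (S12 F g \<theta>) ** matrix_inv (S11 F g \<theta>)"

definition positive_definite :: "real^'n^'n \<Rightarrow> bool" where
  "positive_definite A \<longleftrightarrow> transpose A = A \<and> (\<forall>v. v \<noteq> 0 \<longrightarrow> v \<bullet> (A *v v) > 0)"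

section \<open>Empirical likelihood\<close>

text \<open>Below, \<open>x i\<close> for \<open>i < n\<close> is the observed sample and \<open>\<tau>\<close> the value of the multiplier
  at \<open>\<theta>\<close>.\<close>

definition el_weight ::
  "(real^'k \<Rightarrow> real^'p \<Rightarrow> real^'r) \<Rightarrow> nat \<Rightarrow> (nat \<Rightarrow> real^'k) \<Rightarrow> real^'p \<Rightarrow> real^'r \<Rightarrow> nat \<Rightarrow> real" where
  "el_weight g n x \<theta> \<tau> i = 1 / real n * (1 / (1 + \<tau> \<bullet> g (x i) \<theta>))"

text \<open>The first conjunct says that the quotients are meaningful; with it, nonnegative weights are
  strictly positive.\<close>

definition el_multiplier ::
  "(real^'k \<Rightarrow> real^'p \<Rightarrow> real^'r) \<Rightarrow> nat \<Rightarrow> (nat \<Rightarrow> real^'k) \<Rightarrow> real^'p \<Rightarrow> real^'r \<Rightarrow> bool" where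
  "el_multiplier g n x \<theta> \<tau> \<longleftrightarrow>
     (\<forall>i<n. 1 + \<tau> \<bullet> g (x i) \<theta> \<noteq> 0) \<and>
     (1 / real n) *\<^sub>R (\<Sum>i<n. (1 / (1 + \<tau> \<bullet> g (x i) \<theta>)) *\<^sub>R g (x i) \<theta>) = 0 \<and>
     (\<forall>i<n. el_weight g n x \<theta> \<tau> i \<ge> 0) \<and>
     (\<Sum>i<n. el_weight g n x \<theta> \<tau> i) = 1"

text \<open>A function \<open>t\<close> of \<open>\<theta>\<close> that solves the multiplier equations wherever they are solvable. Where
  they are not (zero lies outside the convex hull of the \<open>g (x i) \<theta>\<close>, say) the
  convention is \<open>t \<theta> = 0\<close>, which gives uniform weights; such \<open>\<theta>\<close> are excluded from the
  maximization of the likelihood below.\<close>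

definition el_multiplier_function ::
  "(real^'p) set \<Rightarrow> (real^'k \<Rightarrow> real^'p \<Rightarrow> real^'r) \<Rightarrow> nat \<Rightarrow> (nat \<Rightarrow> real^'k) \<Rightarrow> (real^'p \<Rightarrow> real^'r) \<Rightarrow> bool" where
  "el_multiplier_function \<Theta> g n x t \<longleftrightarrow>
     (\<forall>\<theta>\<in>\<Theta>. if \<exists>\<tau>. el_multiplier g n x \<theta> \<tau> then el_multiplier g n x \<theta> (t \<theta>) else t \<theta> = 0)"

definition el_loglik ::
  "(real^'k \<Rightarrow> real^'p \<Rightarrow> real^'r) \<Rightarrow> nat \<Rightarrow> (nat \<Rightarrow> real^'k) \<Rightarrow> (real^'p \<Rightarrow> real^'r) \<Rightarrow> real^'p \<Rightarrow> real" where
  "el_loglik g n x t \<theta> = - (\<Sum>i<n. ln (1 + t \<theta> \<bullet> g (x i) \<theta>))"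

definition el_maximizer ::
  "(real^'p) set \<Rightarrow> (real^'k \<Rightarrow> real^'p \<Rightarrow> real^'r) \<Rightarrow> nat \<Rightarrow> (nat \<Rightarrow> real^'k) \<Rightarrow> (real^'p \<Rightarrow> real^'r)
     \<Rightarrow> real^'p \<Rightarrow> bool" where
  "el_maximizer \<Theta> g n x t \<theta>' \<longleftrightarrow>
     is_arg_max (el_loglik g n x t) (\<lambda>\<theta>. \<theta> \<in> \<Theta> \<and> el_multiplier g n x \<theta> (t \<theta>)) \<theta>'"

section \<open>Divergences\<close>

definition \<Phi> :: "(real \<Rightarrow> real) set" where
  "\<Phi> = {\<phi>. convex_on {0<..} \<phi> \<and> \<phi> 1 = 0 \<and>
     (\<forall>\<^sub>F u in nhds 1. \<phi> differentiable (at u)) \<and> deriv \<phi> 1 = 0 \<and>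
     deriv \<phi> differentiable (at 1) \<and> deriv (deriv \<phi>) 1 > 0}"

text \<open>The summand \<open>q \<phi>(p/q)\<close>. The limit in the last branch may be infinite, in which case \<open>Lim\<close> is
  unspecified; empirical likelihood weights are strictly positive and never reach that branch.\<close>

definition phi_term :: "(real \<Rightarrow> real) \<Rightarrow> real \<Rightarrow> real \<Rightarrow> real" where
  "phi_term \<phi> p q =
     (if q \<noteq> 0 then q * \<phi> (p / q) else if p = 0 then 0 else p * Lim at_top (\<lambda>u. \<phi> u / u))"

definition phi_divergence ::
  "(real \<Rightarrow> real) \<Rightarrow> nat \<Rightarrow> (nat \<Rightarrow> real) \<Rightarrow> (nat \<Rightarrow> real) \<Rightarrow> real" where
  "phi_divergence \<phi> n p q = (\<Sum>i<n. phi_term \<phi> (p i) (q i))"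

definition S_stat ::
  "(real^'k \<Rightarrow> real^'p \<Rightarrow> real^'r) \<Rightarrow> (real \<Rightarrow> real) \<Rightarrow> nat \<Rightarrow> (nat \<Rightarrow> real^'k) \<Rightarrow> (real^'p \<Rightarrow> real^'r)
     \<Rightarrow> real^'p \<Rightarrow> real^'p \<Rightarrow> real" where
  "S_stat g \<phi> n x t \<theta> \<theta>\<^sub>0 =
     2 * real n / deriv (deriv \<phi>) 1 *
     phi_divergence \<phi> n (el_weight g n x \<theta> (t \<theta>)) (el_weight g n x \<theta>\<^sub>0 (t \<theta>\<^sub>0))"

end

theory Submission
  imports Defs "HOL-Real_Asymp.Real_Asymp"
begin

text \<open>
  Let \<open>u\<^sub>i = g(X\<^sub>i, \<theta>E)\<close> and \<open>v\<^sub>i = g(X\<^sub>i, \<theta>\<^sub>0)\<close>, and put \<open>a\<^sub>i = t(\<theta>E) \<bullet> u\<^sub>i\<close>, \<open>b\<^sub>i = t(\<theta>\<^sub>0) \<bullet> v\<^sub>i\<close> and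
  \<open>Z = \<surd>n (\<theta>E - \<theta>\<^sub>0)\<close>. The ratio of the two weights of \<open>X\<^sub>i\<close> is \<open>(1 + b\<^sub>i) / (1 + a\<^sub>i)\<close>. All \<open>a\<^sub>i\<close> and \<open>b\<^sub>i\<close> are
  uniformly small: the multipliers are of order \<open>1/\<surd>n\<close>, and by the third moment condition the largest
  estimating function in the sample is \<open>o(\<surd>n)\<close> (\<open>sample_maximum_negligible\<close>). Near 1 the function \<open>\<phi>\<close> is
  \<open>\<phi>''(1)/2\<close> times the squared distance from 1, so the statistic is \<open>\<Sum> (a\<^sub>i - b\<^sub>i)\<^sup>2\<close> up to a
  factor \<open>1 + o(1)\<close>, whatever \<open>\<phi>\<close> is (\<open>\<Phi>_summand_expansion\<close>).

  The empirical second moments of the \<open>u\<^sub>i\<close> and \<open>v\<^sub>i\<close> all tend to \<open>S11\<close>, so this sum is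
  \<open>w \<bullet> S11 w + o(1)\<close> with \<open>w = \<surd>n (t(\<theta>E) - t(\<theta>\<^sub>0))\<close>. The multiplier equations, linearised in the
  multiplier (\<open>multiplier_linearization\<close>), say that \<open>S11 (\<surd>n t(\<theta>E))\<close> is \<open>\<Sum> u\<^sub>i / \<surd>n + o(1)\<close>, and that
  \<open>S11 (\<surd>n t(\<theta>\<^sub>0))\<close> is \<open>\<Sum> v\<^sub>i / \<surd>n + o(1)\<close>. The difference of the two sums is \<open>S12 Z + o(1)\<close> by
  Taylor expansion in \<open>\<theta>\<close> (\<open>estimating_function_taylor\<close>). Hence \<open>S11 w = S12 Z + o(1)\<close>, and the statistic is
  \<open>Z \<bullet> W Z + o(1)\<close> with \<open>W = S12\<^sup>T S11\<^sup>-\<^sup>1 S12\<close>, the inverse of the covariance \<open>V\<close> of the limit of \<open>Z\<close>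
  (\<open>el_statistic_expansion\<close>). The squared length of a \<open>p\<close>-dimensional normal vector, measured by its
  inverse covariance, is chi-square with \<open>p\<close> degrees of freedom.

  Three points need an argument of their own. The assumed limit law concerns the multiplier at the
  estimator, not at \<open>\<theta>\<^sub>0\<close>. That it exists there with probability tending to 1, and is of order
  \<open>1/\<surd>n\<close>, follows by maximizing \<open>\<Sum> ln (1 + \<tau> \<bullet> v\<^sub>i)\<close> over a ball whose radius is of this order
  (\<open>multiplier_equation_solvable\<close>).

  Stochastic orders are expressed by filters. The sequences of events with probability tending to 1 generate a
  filter on pairs of a sample size and an outcome; \<open>o\<^sub>P(1)\<close> means convergence to 0 along it, and \<open>O\<^sub>P(1)\<close>
  means boundedness once the filter is restricted to an event of probability close to 1. So the whole expansion is
  a deterministic statement about an arbitrary filter, and \<open>tendsto_in_probability_of_bounded\<close>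
  turns it into convergence in probability.

  The normal limit is given by the laws of its linear functionals. The law of the quadratic form
  is obtained from them by its Laplace transform (\<open>laplace_transform_quadratic_form\<close>), since the Gaussian function
  \<open>exp (- s |y|\<^sup>2)\<close> is a mixture of the characters \<open>exp (\<i> x \<bullet> y)\<close>.
\<close>

section \<open>Positive definite matrices\<close>

lemma norm_matrix_vector_mult_le:
  fixes A :: "real^'n^'m"
  shows "norm (A *v x) \<le> norm A * norm x"
proof -
  have "norm (A *v x) = L2_set (\<lambda>i. norm (A $ i \<bullet> x)) UNIV"
    unfolding norm_vec_def[of "A *v x"] by (simp add: matrix_vector_mult_def inner_vec_def)
  also have "\<dots> \<le> L2_set (\<lambda>i. norm (A $ i) * norm x) UNIV"
    by (intro L2_set_mono) (auto simp: Cauchy_Schwarz_ineq2)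
  also have "\<dots> = norm A * norm x"
    by (simp add: norm_vec_def[of A] L2_set_left_distrib)
  finally show ?thesis .
qed

lemma bounded_bilinear_matrix_vector_mult:
  "bounded_bilinear ((*v) :: real^'n^'m \<Rightarrow> real^'n \<Rightarrow> real^'m)"
  by (rule bounded_bilinear.intro)
     (auto simp: algebra_simps scaleR_matrix_vector_assoc
       intro!: exI[of _ 1] norm_matrix_vector_mult_le[THEN order_trans])

lemma positive_definite_invertible:
  fixes S :: "real^'n^'n"
  assumes "positive_definite S"
  shows "invertible S"
proof -
  have "S *v x = 0 \<Longrightarrow> x = 0" for x
    using assms unfolding positive_definite_def by (metis inner_zero_right less_irrefl)
  then show ?thesis
    by (simp add: invertible_left_inverse matrix_left_invertible_ker)
qed

lemma matrix_inv_mult_vector: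
  fixes S :: "real^'n^'n"
  assumes "invertible S"
  shows "S *v (matrix_inv S *v x) = x" "matrix_inv S *v (S *v x) = x"
proof -
  have "S ** matrix_inv S = mat 1 \<and> matrix_inv S ** S = mat 1"
    using assms unfolding invertible_def matrix_inv_def by (rule someI_ex)
  then show "S *v (matrix_inv S *v x) = x" "matrix_inv S *v (S *v x) = x"
    by (auto simp: matrix_vector_mul_assoc)
qed

lemma inner_matrix_vector_symmetric:
  fixes S :: "real^'n^'n"
  assumes "transpose S = S"
  shows "x \<bullet> (S *v y) = (S *v x) \<bullet> y"
  using assms by (metis dot_lmul_matrix vector_transpose_matrix inner_commute)

lemma transpose_matrix_inv_symmetric:
  fixes S :: "real^'n^'n"
  assumes "positive_definite S"
  shows "transpose (matrix_inv S) = matrix_inv S"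
proof -
  have inv: "invertible S" by (rule positive_definite_invertible[OF assms])
  have sym: "transpose S = S" using assms by (simp add: positive_definite_def)
  have "S ** matrix_inv S = mat 1 \<and> matrix_inv S ** S = mat 1"
    using inv unfolding invertible_def matrix_inv_def by (rule someI_ex)
  then have 1: "S ** matrix_inv S = mat 1" "matrix_inv S ** S = mat 1" by auto
  have "transpose (matrix_inv S) ** S = mat 1"
    using arg_cong[OF 1(1), of transpose] sym by (simp add: matrix_transpose_mul)
  then have "transpose (matrix_inv S) ** S ** matrix_inv S = matrix_inv S" by simp
  then show ?thesis by (simp add: 1 flip: matrix_mul_assoc)
qed

text \<open>With \<open>S = S11\<close> and \<open>B = S12\<close> this matrix is the inverse of the limit covariance of the estimator, and its
  quadratic form is the limit of the test statistic.\<close>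

lemma positive_definite_congruence:
  fixes S :: "real^'r^'r" and B :: "real^'p^'r"
  assumes S: "positive_definite S" and B: "rank B = CARD('p)"
  shows "positive_definite (transpose B ** matrix_inv S ** B)"
    and "z \<bullet> ((transpose B ** matrix_inv S ** B) *v z) = (matrix_inv S *v (B *v z)) \<bullet> (B *v z)"
proof -
  have form: "z \<bullet> ((transpose B ** matrix_inv S ** B) *v z) = (matrix_inv S *v (B *v z)) \<bullet> (B *v z)" for z
    by (simp add: dot_lmul_matrix inner_commute flip: matrix_vector_mul_assoc)
       (metis dot_lmul_matrix inner_commute vector_transpose_matrix)
  then show "z \<bullet> ((transpose B ** matrix_inv S ** B) *v z) = (matrix_inv S *v (B *v z)) \<bullet> (B *v z)" .
  have "(matrix_inv S *v (B *v z)) \<bullet> (B *v z) > 0" if "z \<noteq> 0" for z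
  proof -
    have "inj ((*v) B)" using B by (simp add: full_rank_injective)
    then have "B *v z \<noteq> 0" using that by (metis injD matrix_vector_mult_0_right)
    then have ne: "matrix_inv S *v (B *v z) \<noteq> 0"
      using matrix_inv_mult_vector(1)[OF positive_definite_invertible[OF S]] 
      by (metis matrix_vector_mult_0_right)
    have "B *v z = S *v (matrix_inv S *v (B *v z))"
      using matrix_inv_mult_vector(1)[OF positive_definite_invertible[OF S]] by simp
    then show ?thesis using S ne unfolding positive_definite_def by metis
  qed
  then show "positive_definite (transpose B ** matrix_inv S ** B)"
    by (simp add: positive_definite_def form matrix_transpose_mul transpose_matrix_inv_symmetric[OF S]
        matrix_mul_assoc)
qed

lemma positive_definite_coercive:
  fixes S :: "real^'n^'n"
  assumes "positive_definite S"
  obtains c where "c > 0" "\<And>v. c * (norm v)\<^sup>2 \<le> v \<bullet> (S *v v)"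
proof -
  have cont: "continuous_on (sphere 0 1) (\<lambda>v. v \<bullet> (S *v v))"
    by (intro continuous_intros linear_continuous_on) (auto intro: matrix_vector_mul_bounded_linear)
  obtain b :: "real^'n" where "b \<in> Basis" by (meson nonempty_Basis ex_in_conv)
  then have "sphere 0 1 \<noteq> ({} :: (real^'n) set)"
    by (metis norm_Basis dist_0_norm mem_sphere empty_iff)
  then obtain v0 where v0: "v0 \<in> sphere 0 1" "\<And>v. v \<in> sphere 0 1 \<Longrightarrow> v0 \<bullet> (S *v v0) \<le> v \<bullet> (S *v v)"
    using continuous_attains_inf[OF compact_sphere _ cont] by (metis (no_types, lifting))
  show thesis
  proof
    show "v0 \<bullet> (S *v v0) > 0" using v0(1) assms unfolding positive_definite_def
      by (metis dist_0_norm mem_sphere norm_zero zero_neq_one)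
    fix v
    show "v0 \<bullet> (S *v v0) * (norm v)\<^sup>2 \<le> v \<bullet> (S *v v)"
    proof (cases "v = 0")
      case False
      have "v0 \<bullet> (S *v v0) \<le> (v /\<^sub>R norm v) \<bullet> (S *v (v /\<^sub>R norm v))"
        using False by (intro v0) auto
      also have "\<dots> = (v \<bullet> (S *v v)) / (norm v)\<^sup>2"
        by (simp add: matrix_vector_mult_scaleR power2_eq_square field_simps)
      finally show ?thesis using False by (simp add: field_simps)
    qed auto
  qed
qed

text \<open>Gram-Schmidt with respect to the inner product given by \<open>W\<close>: an orthonormal family of maximal length
  expands every vector, since otherwise the normalised remainder of the expansion would extend it.\<close>

lemma positive_definite_orthonormal_basis:
  fixes W :: "real^'n^'n"
  assumes W: "positive_definite W"
  obtains e :: "nat \<Rightarrow> real^'n"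
  where "\<And>i j. i < CARD('n) \<Longrightarrow> j < CARD('n) \<Longrightarrow> e i \<bullet> (W *v e j) = (if i = j then 1 else 0)"
    and "\<And>z. (\<Sum>i<CARD('n). (z \<bullet> (W *v e i)) *\<^sub>R e i) = z"
proof -
  define ortho where "ortho = (\<lambda>k (e :: nat \<Rightarrow> real^'n).
     \<forall>i<k. \<forall>j<k. e i \<bullet> (W *v e j) = (if i = j then 1 else 0))"
  have sym: "x \<bullet> (W *v y) = y \<bullet> (W *v x)" for x y
    using inner_matrix_vector_symmetric W by (metis positive_definite_def inner_commute)
  have coeff: "(\<Sum>i<k. a i *\<^sub>R e i) \<bullet> (W *v e j) = a j" if "ortho k e" "j < k" for k e a j
  proof -
    have "(\<Sum>i<k. a i *\<^sub>R e i) \<bullet> (W *v e j) = (\<Sum>i<k. if i = j then a i else 0)"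
      unfolding inner_sum_left using that by (intro sum.cong) (auto simp: ortho_def)
    also have "\<dots> = a j" using that by simp
    finally show ?thesis .
  qed
  have bound: "k \<le> CARD('n)" if "ortho k e" for k e
  proof -
    have inj: "inj_on e {..<k}"
    proof (rule inj_onI, rule ccontr)
      fix i j assume ij: "i \<in> {..<k}" "j \<in> {..<k}" "e i = e j" "i \<noteq> j"
      then have "e i \<bullet> (W *v e j) = 0" "e i \<bullet> (W *v e i) = 1"
        using that[unfolded ortho_def, rule_format, of i j] that[unfolded ortho_def, rule_format, of i i]
        by simp_all
      then show False using ij(3) by simp
    qed
    have "independent (e ` {..<k})"
    proof (rule independent_if_scalars_zero)
      fix f x assume *: "(\<Sum>x\<in>e ` {..<k}. f x *\<^sub>R x) = 0" "x \<in> e ` {..<k}"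
      then obtain j where j: "j < k" "x = e j" by auto
      have "(\<Sum>i<k. f (e i) *\<^sub>R e i) = 0" using * by (simp add: sum.reindex[OF inj])
      then show "f x = 0" using coeff[OF that j(1), of "\<lambda>i. f (e i)"] j by simp
    qed simp
    then have "card (e ` {..<k}) \<le> DIM(real^'n)" by (rule independent_card_le)
    then show ?thesis by (simp add: card_image[OF inj])
  qed
  define k where "k = (GREATEST k. \<exists>e. ortho k e)"
  have ex: "\<exists>e. ortho k e"
    unfolding k_def
  proof (rule GreatestI_nat[where b="CARD('n)"])
    show "\<exists>e. ortho 0 e" by (simp add: ortho_def)
  qed (use bound in blast)
  have maximal: "\<not> ortho (Suc k) e" for e
  proof
    assume "ortho (Suc k) e"
    then have "Suc k \<le> k" unfolding k_def
      by (intro Greatest_le_nat[where b="CARD('n)"]) (use bound in blast)+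
    then show False by simp
  qed
  from ex obtain e where e: "ortho k e" by auto
  have expand: "(\<Sum>i<k. (z \<bullet> (W *v e i)) *\<^sub>R e i) = z" for z
  proof (rule ccontr)
    define y where "y = z - (\<Sum>i<k. (z \<bullet> (W *v e i)) *\<^sub>R e i)"
    assume "(\<Sum>i<k. (z \<bullet> (W *v e i)) *\<^sub>R e i) \<noteq> z"
    then have "y \<noteq> 0" by (simp add: y_def)
    then have pos: "y \<bullet> (W *v y) > 0" using W by (simp add: positive_definite_def)
    have orth: "y \<bullet> (W *v e j) = 0" if "j < k" for j
      unfolding y_def by (simp add: inner_diff_left coeff[OF e that])
    define c where "c = 1 / sqrt (y \<bullet> (W *v y))"
    have c: "c * c * (y \<bullet> (W *v y)) = 1" using pos by (simp add: c_def)
    have "ortho (Suc k) (e(k := c *\<^sub>R y))"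
    proof -
      have "(c *\<^sub>R y) \<bullet> (W *v e j) = 0" "e j \<bullet> (W *v (c *\<^sub>R y)) = 0" if "j < k" for j
        using orth[OF that] sym[of "e j" y] by (simp_all add: matrix_vector_mult_scaleR)
      moreover have "(c *\<^sub>R y) \<bullet> (W *v (c *\<^sub>R y)) = 1"
        using c by (simp add: matrix_vector_mult_scaleR mult.assoc)
      moreover have "e i \<bullet> (W *v e j) = (if i = j then 1 else 0)" if "i < k" "j < k" for i j
        using e that unfolding ortho_def by blast
      ultimately show ?thesis
        unfolding ortho_def less_Suc_eq by (intro allI impI, elim disjE) simp_all
    qed
    then show False using maximal by blast
  qed
  have "k = CARD('n)"
  proof (rule antisym[OF bound[OF e]])
    have "z \<in> span (e ` {..<k})" for z
      by (subst expand[of z, symmetric]) (intro span_sum span_scale span_base, auto)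
    then have "span (e ` {..<k}) = UNIV" by auto
    then have "DIM(real^'n) \<le> card (e ` {..<k})"
      using dim_le_card[of UNIV "e ` {..<k}"] by auto
    then show "CARD('n) \<le> k" using card_image_le[of "{..<k}" e] by simp
  qed
  show thesis
  proof (rule that)
    show "e i \<bullet> (W *v e j) = (if i = j then 1 else 0)" if "i < CARD('n)" "j < CARD('n)" for i j
      using e that unfolding ortho_def \<open>k = CARD('n)\<close> by blast
    show "(\<Sum>i<CARD('n). (z \<bullet> (W *v e i)) *\<^sub>R e i) = z" for z
      using expand[of z] unfolding \<open>k = CARD('n)\<close> .
  qed
qed

section \<open>Quadratic forms of normal vectors\<close>

text \<open>A centred normal law is known through its linear functionals only, and this is all that its
  characteristic function sees.\<close>

lemma char_centred_normal:
  fixes N :: "(real^'n) measure"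
  assumes N: "centred_normal N C"
  shows "(CLINT z|N. iexp (u \<bullet> z)) = complex_of_real (exp (- (u \<bullet> (C *v u)) / 2))"
proof -
  interpret prob_space N using N by (simp add: centred_normal_def)
  have sets[measurable_cong]: "sets N = sets borel" using N by (simp add: centred_normal_def)
  define v where "v = u \<bullet> (C *v u)"
  consider "v > 0" "distributed N lborel (\<lambda>x. u \<bullet> x) (normal_density 0 (sqrt v))"
    | "v = 0" "AE x in N. u \<bullet> x = 0"
    using N unfolding centred_normal_def v_def Let_def by blast
  then show ?thesis
  proof cases
    case 1
    then have "distributed N lborel (\<lambda>x. (u \<bullet> x - 0) / sqrt v) std_normal_density"
      using normal_standard_normal_convert[of "sqrt v" "\<lambda>x. u \<bullet> x" 0] by simp
    then have D: "distr N lborel (\<lambda>x. (u \<bullet> x) / sqrt v) = std_normal_distribution"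
      by (simp add: distributed_distr_eq_density)
    have "(CLINT z|N. iexp (u \<bullet> z)) = (CLINT z|N. iexp (sqrt v * ((u \<bullet> z) / sqrt v)))"
      using 1 by simp
    also have "\<dots> = (CLINT y|distr N lborel (\<lambda>x. (u \<bullet> x) / sqrt v). iexp (sqrt v * y))"
      by (subst integral_distr) (auto simp: measurable_lborel1)
    also have "\<dots> = char std_normal_distribution (sqrt v)"
      by (simp add: D char_def)
    also have "\<dots> = exp (- v / 2)" using 1 by (simp add: char_std_normal_distribution)
    finally show ?thesis by (simp add: v_def)
  next
    case 2
    have "(CLINT z|N. iexp (u \<bullet> z)) = (CLINT z|N. 1)"
      by (rule integral_cong_AE) (use 2 in auto)
    also have "\<dots> = 1" using prob_space by simp
    finally show ?thesis using 2 by (simp add: v_def)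
  qed
qed

lemma chi_square_prob_space: "prob_space (chi_square k)" "sets (chi_square k) = sets borel"
  "real_distribution (chi_square k)"
proof -
  interpret N: real_distribution std_normal_distribution by (rule real_dist_normal_dist)
  interpret P: product_prob_space "\<lambda>_. std_normal_distribution" "{..<k}"
    by unfold_locales
  show s: "sets (chi_square k) = sets borel" by (simp add: chi_square_def)
  show p: "prob_space (chi_square k)"
    unfolding chi_square_def by (rule P.prob_space_distr) measurable
  show "real_distribution (chi_square k)"
    using p s by (simp add: real_distribution_def real_distribution_axioms_def)
qed

text \<open>In coordinates \<open>y\<^sub>i = b\<^sub>i \<bullet> z\<close> that make the covariance the identity, the quadratic form is
  \<open>\<Sum> y\<^sub>i\<^sup>2\<close>. Its Laplace transform can be found without knowing the joint law of the \<open>y\<^sub>i\<close>: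
  \<open>exp (- s \<Sum> y\<^sub>i\<^sup>2)\<close> is the expectation of \<open>exp (\<i> \<surd>(2 s) \<Sum> x\<^sub>i y\<^sub>i)\<close> over independent standard normal \<open>x\<^sub>i\<close>.
  After exchanging the two integrals, the inner one is the characteristic function of the linear
  functional \<open>\<Sum> x\<^sub>i y\<^sub>i\<close>, and what remains is the Laplace transform of \<open>\<Sum> x\<^sub>i\<^sup>2\<close>.\<close>

lemma laplace_transform_quadratic_form:
  fixes N :: "(real^'n) measure"
  assumes N: "centred_normal N (matrix_inv W)" and W: "positive_definite W" and s: "s \<ge> 0"
  shows "(\<integral>z. exp (- s * (z \<bullet> (W *v z))) \<partial>N) = (\<integral>y. exp (- s * y) \<partial>chi_square CARD('n))"
proof -
  let ?p = "CARD('n)"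
  interpret N: prob_space N using N by (simp add: centred_normal_def)
  have sets[measurable_cong]: "sets N = sets borel" using N by (simp add: centred_normal_def)
  interpret G: real_distribution std_normal_distribution by (rule real_dist_normal_dist)
  define P where "P = Pi\<^sub>M {..<?p} (\<lambda>_. std_normal_distribution)"
  interpret P: product_prob_space "\<lambda>_. std_normal_distribution" "{..<?p}" by unfold_locales
  interpret PP: prob_space P unfolding P_def by (rule P.prob_space_axioms)
  interpret pair: pair_prob_space N P ..
  obtain e :: "nat \<Rightarrow> real^'n"
    where ortho: "\<And>i j. i < ?p \<Longrightarrow> j < ?p \<Longrightarrow> e i \<bullet> (W *v e j) = (if i = j then 1 else 0)"
      and expand: "\<And>z. (\<Sum>i<?p. (z \<bullet> (W *v e i)) *\<^sub>R e i) = z"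
    by (rule positive_definite_orthonormal_basis[OF W]) blast
  define b where "b i = W *v e i" for i
  have inv: "invertible W" by (rule positive_definite_invertible[OF W])
  have form: "z \<bullet> (W *v z) = (\<Sum>i<?p. (b i \<bullet> z)\<^sup>2)" for z
  proof -
    have "z \<bullet> (W *v z) = (\<Sum>i<?p. (z \<bullet> (W *v e i)) *\<^sub>R e i) \<bullet> (W *v z)"
      by (subst (1) expand[of z, symmetric]) simp
    also have "\<dots> = (\<Sum>i<?p. (z \<bullet> (W *v e i)) * (e i \<bullet> (W *v z)))"
      by (simp add: inner_sum_left)
    also have "\<dots> = (\<Sum>i<?p. (b i \<bullet> z)\<^sup>2)"
      using W inner_matrix_vector_symmetric[of W]
      by (intro sum.cong) (auto simp: power2_eq_square b_def inner_commute positive_definite_def)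
    finally show ?thesis .
  qed
  have var: "(\<Sum>i<?p. x i *\<^sub>R b i) \<bullet> (matrix_inv W *v (\<Sum>i<?p. x i *\<^sub>R b i)) = (\<Sum>i<?p. (x i)\<^sup>2)" for x
  proof -
    have "matrix_inv W *v (\<Sum>i<?p. x i *\<^sub>R b i) = matrix_inv W *v (W *v (\<Sum>i<?p. x i *\<^sub>R e i))"
      by (simp add: b_def matrix_vector_mult_scaleR Real_Vector_Spaces.linear_sum[OF matrix_vector_mul_linear])
    also have "\<dots> = (\<Sum>i<?p. x i *\<^sub>R e i)" by (rule matrix_inv_mult_vector[OF inv])
    finally have "(\<Sum>i<?p. x i *\<^sub>R b i) \<bullet> (matrix_inv W *v (\<Sum>i<?p. x i *\<^sub>R b i))
       = (\<Sum>i<?p. x i *\<^sub>R b i) \<bullet> (\<Sum>j<?p. x j *\<^sub>R e j)" by simp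
    also have "\<dots> = (\<Sum>i<?p. \<Sum>j<?p. x i * (x j * (e j \<bullet> b i)))"
      by (subst inner_sum_left, intro sum.cong refl, subst inner_sum_right, intro sum.cong refl)
         (simp add: inner_commute)
    also have "\<dots> = (\<Sum>i<?p. \<Sum>j<?p. if j = i then x i * x j else 0)"
      unfolding b_def by (intro sum.cong refl) (auto simp: ortho)
    also have "\<dots> = (\<Sum>i<?p. (x i)\<^sup>2)" by (simp add: power2_eq_square)
    finally show ?thesis .
  qed
  define r where "r = sqrt (2 * s)"
  have r2: "r\<^sup>2 = 2 * s" using s by (simp add: r_def)
  define f where "f z x = iexp (r * (\<Sum>i<?p. x i * (b i \<bullet> z)))" for z x
  have x_meas[measurable]: "(\<lambda>x. x i) \<in> borel_measurable P" if "i < ?p" for i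
    using measurable_component_singleton[of i "{..<?p}" "\<lambda>_. std_normal_distribution"] that
    unfolding P_def by simp
  have f_meas[measurable]: "(\<lambda>(z, x). f z x) \<in> borel_measurable (N \<Otimes>\<^sub>M P)"
    unfolding f_def by measurable
  have int: "integrable (N \<Otimes>\<^sub>M P) (\<lambda>(z, x). f z x)"
    by (rule pair.integrable_const_bound[where B=1]) (auto simp: f_def norm_exp_i_times)
  have inner1: "(CLINT x|P. f z x) = complex_of_real (exp (- s * (z \<bullet> (W *v z))))" for z
  proof -
    have "f z x = (\<Prod>i<?p. iexp ((r * (b i \<bullet> z)) * x i))" for x
      by (simp add: f_def exp_sum[symmetric] sum_distrib_left mult_ac)
    then have "(CLINT x|P. f z x) = (\<Prod>i<?p. (CLINT y|std_normal_distribution. iexp ((r * (b i \<bullet> z)) * y)))"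
      unfolding P_def by (simp, subst P.product_integral_prod) (auto intro!: G.integrable_iexp)
    also have "\<dots> = (\<Prod>i<?p. complex_of_real (exp (- (r * (b i \<bullet> z))\<^sup>2 / 2)))"
      using char_std_normal_distribution unfolding char_def by (metis (no_types))
    also have "\<dots> = complex_of_real (exp (\<Sum>i<?p. - (r * (b i \<bullet> z))\<^sup>2 / 2))"
      by (simp add: exp_sum)
    also have "(\<Sum>i<?p. - (r * (b i \<bullet> z))\<^sup>2 / 2) = - s * (z \<bullet> (W *v z))"
      by (simp add: form sum_distrib_left power_mult_distrib r2 sum_negf)
    finally show ?thesis .
  qed
  have inner2: "(CLINT z|N. f z x) = complex_of_real (exp (- s * (\<Sum>i<?p. (x i)\<^sup>2)))" for x
  proof -
    have "f z x = iexp ((\<Sum>i<?p. (r * x i) *\<^sub>R b i) \<bullet> z)" for z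
      by (simp add: f_def inner_sum_left sum_distrib_left mult_ac)
    then have "(CLINT z|N. f z x) = complex_of_real (exp (- (\<Sum>i<?p. (r * x i)\<^sup>2) / 2))"
      by (simp only: char_centred_normal[OF N] var)
    also have "- (\<Sum>i<?p. (r * x i)\<^sup>2) / 2 = - s * (\<Sum>i<?p. (x i)\<^sup>2)"
      by (simp add: power_mult_distrib r2 sum_distrib_left[symmetric])
    finally show ?thesis .
  qed
  have "(CLINT x|P. (CLINT z|N. f z x)) = (CLINT z|N. (CLINT x|P. f z x))"
    by (rule pair.Fubini_integral[OF int])
  then have "(\<integral>x. exp (- s * (\<Sum>i<?p. (x i)\<^sup>2)) \<partial>P) = (\<integral>z. exp (- s * (z \<bullet> (W *v z))) \<partial>N)"
    unfolding inner1 inner2 by (simp only: integral_complex_of_real of_real_eq_iff)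
  moreover have "(\<integral>y. exp (- s * y) \<partial>chi_square ?p) = (\<integral>x. exp (- s * (\<Sum>i<?p. (x i)\<^sup>2)) \<partial>P)"
    unfolding chi_square_def P_def[symmetric]
    by (intro integral_distr borel_measurable_sum borel_measurable_power x_meas) auto
  ultimately show ?thesis by simp
qed

text \<open>The values at integers are the moments of the \<open>[0, 1]\<close>-valued variable \<open>exp (- Y)\<close>, so by Weierstrass
  approximation they determine the expectation of every continuous function of it.\<close>

lemma laplace_transform_determines_law:
  fixes Y :: "'a \<Rightarrow> real" and Y' :: "'b \<Rightarrow> real" and h :: "real \<Rightarrow> real"
  assumes M: "prob_space M" "Y \<in> borel_measurable M" "AE x in M. Y x \<ge> 0"
    and M': "prob_space M'" "Y' \<in> borel_measurable M'" "AE x in M'. Y' x \<ge> 0"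
    and eq: "\<And>k :: nat. (\<integral>x. exp (- real k * Y x) \<partial>M) = (\<integral>x. exp (- real k * Y' x) \<partial>M')"
    and h: "continuous_on UNIV h" "\<And>y. y \<ge> B \<Longrightarrow> h y = 0"
  shows "(\<integral>x. h (Y x) \<partial>M) = (\<integral>x. h (Y' x) \<partial>M')"
proof -
  \<comment> \<open>Since \<open>h\<close> is constant beyond \<open>B\<close>, it is a continuous function of \<open>exp (- y)\<close>, up to \<open>y = \<infinity>\<close>.\<close>
  define f where "f = (\<lambda>x. h (- ln (max x (exp (- B)))))"
  have f_exp: "f (exp (- y)) = h y" for y
  proof (cases "y \<le> B")
    case True
    then show ?thesis by (simp add: f_def max_absorb1)
  next
    case False
    then show ?thesis using h(2)[of y] h(2)[of B] by (simp add: f_def max_absorb2)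
  qed
  have f_cont: "continuous_on {0..1} f"
    unfolding f_def
  proof (rule continuous_on_compose2[OF h(1)])
    have "max x (exp (- B)) \<noteq> 0" for x :: real using exp_gt_zero[of "- B"] by linarith
    then show "continuous_on {0..1} (\<lambda>x. - ln (max x (exp (- B))))"
      by (intro continuous_intros) auto
  qed auto
  have hm[measurable]: "h \<in> borel_measurable borel" by (rule borel_measurable_continuous_onI[OF h(1)])
  have approx: "\<bar>(\<integral>x. h (Y x) \<partial>M) - (\<Sum>i\<le>n. a i * (\<integral>x. exp (- real i * Y x) \<partial>M))\<bar> \<le> \<epsilon>"
    if "prob_space M" "Y \<in> borel_measurable M" "AE x in M. Y x \<ge> 0"
      and a: "\<And>x. x \<in> {0..1} \<Longrightarrow> \<bar>f x - (\<Sum>i\<le>n. a i * x ^ i)\<bar> < \<epsilon>" and "\<epsilon> > 0"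
    for M :: "'c measure" and Y a n \<epsilon>
  proof -
    interpret prob_space M by fact
    note [measurable] = that(2)
    have pw: "\<bar>h y - (\<Sum>i\<le>n. a i * exp (- real i * y))\<bar> < \<epsilon>" if "y \<ge> 0" for y
    proof -
      have "exp (- y) ^ i = exp (- real i * y)" for i
        using exp_of_nat_mult[of i "- y"] by simp
      then show ?thesis using a[of "exp (- y)"] that by (simp add: f_exp)
    qed
    have int1: "integrable M (\<lambda>x. exp (- real i * Y x))" for i
    proof (rule integrable_const_bound[where B=1])
      show "AE x in M. norm (exp (- real i * Y x)) \<le> 1"
        using that(3) by (rule eventually_mono) simp
    qed measurable
    then have int2: "integrable M (\<lambda>x. \<Sum>i\<le>n. a i * exp (- real i * Y x))" by simp
    have ae: "AE x in M. norm (h (Y x) - (\<Sum>i\<le>n. a i * exp (- real i * Y x))) \<le> \<epsilon>"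
      using that(3)
    proof (rule eventually_mono)
      show "norm (h (Y x) - (\<Sum>i\<le>n. a i * exp (- real i * Y x))) \<le> \<epsilon>" if "0 \<le> Y x" for x
        using pw[OF that] unfolding real_norm_def by (rule less_imp_le)
    qed
    have int3: "integrable M (\<lambda>x. h (Y x) - (\<Sum>i\<le>n. a i * exp (- real i * Y x)))"
      by (rule integrable_const_bound[OF ae]) measurable
    have "integrable M (\<lambda>x. h (Y x))"
      using Bochner_Integration.integrable_add[OF int2 int3] by simp
    then have "(\<integral>x. h (Y x) \<partial>M) - (\<Sum>i\<le>n. a i * (\<integral>x. exp (- real i * Y x) \<partial>M))
       = (\<integral>x. h (Y x) - (\<Sum>i\<le>n. a i * exp (- real i * Y x)) \<partial>M)"
      using int1 int2 by simp
    also have "\<bar>\<dots>\<bar> \<le> (\<integral>x. \<bar>h (Y x) - (\<Sum>i\<le>n. a i * exp (- real i * Y x))\<bar> \<partial>M)"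
      by (rule integral_abs_bound)
    also have "\<dots> \<le> (\<integral>x. \<epsilon> \<partial>M)"
      using ae int3 by (intro integral_mono_AE) simp_all
    also have "\<dots> = \<epsilon>" by (simp add: prob_space)
    finally show ?thesis .
  qed
  have "\<bar>(\<integral>x. h (Y x) \<partial>M) - (\<integral>x. h (Y' x) \<partial>M')\<bar> \<le> \<epsilon>" if "\<epsilon> > 0" for \<epsilon> :: real
  proof -
    obtain q where q: "real_polynomial_function q" "\<And>x. x \<in> {0..1} \<Longrightarrow> \<bar>f x - q x\<bar> < \<epsilon> / 2"
      using Stone_Weierstrass_real_polynomial_function[OF _ f_cont, of "\<epsilon> / 2"] \<open>\<epsilon> > 0\<close> by auto
    obtain a n where "q = (\<lambda>x. \<Sum>i\<le>n. a i * x ^ i)"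
      using real_polynomial_function_imp_sum[OF q(1)] by blast
    then have a: "\<bar>f x - (\<Sum>i\<le>n. a i * x ^ i)\<bar> < \<epsilon> / 2" if "x \<in> {0..1}" for x
      using q(2)[OF that] by simp
    have "\<bar>(\<integral>x. h (Y x) \<partial>M) - (\<Sum>i\<le>n. a i * (\<integral>x. exp (- real i * Y x) \<partial>M))\<bar> \<le> \<epsilon> / 2"
      by (rule approx[OF M a]) (use \<open>\<epsilon> > 0\<close> in simp_all)
    moreover have "\<bar>(\<integral>x. h (Y' x) \<partial>M') - (\<Sum>i\<le>n. a i * (\<integral>x. exp (- real i * Y x) \<partial>M))\<bar> \<le> \<epsilon> / 2"
      unfolding eq by (rule approx[OF M' a]) (use \<open>\<epsilon> > 0\<close> in simp_all)
    ultimately show ?thesis by linarith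
  qed
  then have "\<bar>(\<integral>x. h (Y x) \<partial>M) - (\<integral>x. h (Y' x) \<partial>M')\<bar> \<le> 0"
    by (rule field_le_epsilon[where y=0, unfolded add_0_left])
  then show ?thesis by simp
qed

lemma quadratic_form_chi_square:
  fixes N :: "(real^'n) measure"
  assumes N: "centred_normal N (matrix_inv W)" and W: "positive_definite W" and "a < b"
  shows "(\<integral>z. cts_step a b (z \<bullet> (W *v z)) \<partial>N) = (\<integral>y. cts_step a b y \<partial>chi_square CARD('n))"
proof (rule laplace_transform_determines_law[where B=b and h="cts_step a b"
      and Y="\<lambda>z. z \<bullet> (W *v z)" and Y'="\<lambda>y. y"])
  have sets[measurable_cong]: "sets N = sets borel" using N by (simp add: centred_normal_def)
  show "prob_space N" using N by (simp add: centred_normal_def)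
  have "continuous_on UNIV (\<lambda>z. z \<bullet> (W *v z))"
    by (intro continuous_intros linear_continuous_on) (auto intro: matrix_vector_mul_bounded_linear)
  then show "(\<lambda>z. z \<bullet> (W *v z)) \<in> borel_measurable N"
    using borel_measurable_continuous_onI measurable_cong_sets[OF sets refl] by blast
  show "AE z in N. 0 \<le> z \<bullet> (W *v z)"
    using W by (intro AE_I2) (metis inner_zero_left less_imp_le order_refl positive_definite_def)
  show "prob_space (chi_square CARD('n))" by (rule chi_square_prob_space)
  show "(\<lambda>y. y) \<in> borel_measurable (chi_square CARD('n))"
    using chi_square_prob_space(2) by (simp add: measurable_def)
  show "AE y in chi_square CARD('n). 0 \<le> y"
    unfolding chi_square_def by (subst AE_distr_iff) (auto intro!: AE_I2 sum_nonneg)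
  show "(\<integral>z. exp (- real k * (z \<bullet> (W *v z))) \<partial>N) = (\<integral>y. exp (- real k * y) \<partial>chi_square CARD('n))" for k :: nat
    by (rule laplace_transform_quadratic_form[OF N W]) simp
  show "continuous_on UNIV (cts_step a b)"
    using cts_step_uniformly_continuous[OF \<open>a < b\<close>] by (rule uniformly_continuous_imp_continuous)
  show "cts_step a b y = 0" if "b \<le> y" for y using that \<open>a < b\<close> by (simp add: cts_step_def)
qed

section \<open>Convergence in probability as convergence along a filter\<close>

text \<open>Generated by the sequences of events with probability tending to 1. Convergence in probability
  to a constant is then convergence along this filter, and the usual rules for limits apply. Only
  the events \<open>A n\<close> have to be measurable, so \<open>P\<close> may be any property.\<close>

definition high_probability :: "'a measure \<Rightarrow> (nat \<times> 'a) filter" where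
  "high_probability M = Abs_filter (\<lambda>P. \<exists>A. (\<forall>n. A n \<in> sets M) \<and>
     (\<lambda>n. measure M (A n)) \<longlonglongrightarrow> 1 \<and> (\<forall>n. \<forall>\<omega>\<in>A n. P (n, \<omega>)))"

definition bounded_in_probability :: "'a measure \<Rightarrow> (nat \<Rightarrow> 'a \<Rightarrow> 'b::real_normed_vector) \<Rightarrow> bool" where
  "bounded_in_probability M Y \<longleftrightarrow> (\<forall>\<eta>>0. \<exists>K A. (\<forall>n. A n \<in> sets M) \<and>
     (\<forall>\<^sub>F n in sequentially. measure M (A n) \<ge> 1 - \<eta>) \<and> (\<forall>n. \<forall>\<omega>\<in>A n. norm (Y n \<omega>) \<le> K))"

context prob_space
begin

lemma prob_Int_lower_bound:
  assumes "A \<in> events" "B \<in> events"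
  shows "prob (A \<inter> B) \<ge> prob A + prob B - 1"
proof -
  have "prob (A \<union> B) = prob A + prob B - prob (A \<inter> B)"
    using measure_Un3[of A M B] assms by (simp add: fmeasurable_eq_sets)
  then show ?thesis using prob_le_1[of "A \<union> B"] by linarith
qed

lemma eventually_high_probability:
  "eventually P (high_probability M) \<longleftrightarrow> (\<exists>A. (\<forall>n. A n \<in> events) \<and>
     (\<lambda>n. prob (A n)) \<longlonglongrightarrow> 1 \<and> (\<forall>n. \<forall>\<omega>\<in>A n. P (n, \<omega>)))"
  unfolding high_probability_def
proof (rule eventually_Abs_filter, rule is_filter.intro)
  show "\<exists>A. (\<forall>n. A n \<in> events) \<and> (\<lambda>n. prob (A n)) \<longlonglongrightarrow> 1 \<and> (\<forall>n. \<forall>\<omega>\<in>A n. True)"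
    by (intro exI[of _ "\<lambda>_. space M"]) (simp add: prob_space)
next
  fix P Q
  assume "\<exists>A. (\<forall>n. A n \<in> events) \<and> (\<lambda>n. prob (A n)) \<longlonglongrightarrow> 1 \<and> (\<forall>n. \<forall>\<omega>\<in>A n. P (n, \<omega>))"
  then obtain A where A: "\<And>n. A n \<in> events" "(\<lambda>n. prob (A n)) \<longlonglongrightarrow> 1" "\<forall>n. \<forall>\<omega>\<in>A n. P (n, \<omega>)"
    by blast
  assume "\<exists>A. (\<forall>n. A n \<in> events) \<and> (\<lambda>n. prob (A n)) \<longlonglongrightarrow> 1 \<and> (\<forall>n. \<forall>\<omega>\<in>A n. Q (n, \<omega>))"
  then obtain B where B: "\<And>n. B n \<in> events" "(\<lambda>n. prob (B n)) \<longlonglongrightarrow> 1" "\<forall>n. \<forall>\<omega>\<in>B n. Q (n, \<omega>)"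
    by blast
  have "(\<lambda>n. prob (A n \<inter> B n)) \<longlonglongrightarrow> 1"
  proof (rule tendsto_sandwich)
    show "(\<lambda>n. prob (A n) + prob (B n) - 1) \<longlonglongrightarrow> 1"
      using tendsto_diff[OF tendsto_add[OF A(2) B(2)] tendsto_const[of "1::real"]] by simp
    show "(\<lambda>_. 1) \<longlonglongrightarrow> (1::real)" by simp
  qed (auto intro!: always_eventually prob_Int_lower_bound A B)
  then show "\<exists>A. (\<forall>n. A n \<in> events) \<and> (\<lambda>n. prob (A n)) \<longlonglongrightarrow> 1 \<and> (\<forall>n. \<forall>\<omega>\<in>A n. P (n, \<omega>) \<and> Q (n, \<omega>))"
    using A B by (intro exI[of _ "\<lambda>n. A n \<inter> B n"]) auto
qed blast

lemma eventually_high_probabilityI: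
  assumes "\<And>n. B n \<in> events" "(\<lambda>n. prob (B n)) \<longlonglongrightarrow> 0"
    and "\<And>n \<omega>. \<omega> \<in> space M \<Longrightarrow> \<omega> \<notin> B n \<Longrightarrow> P (n, \<omega>)"
  shows "eventually P (high_probability M)"
  unfolding eventually_high_probability
proof (intro exI[of _ "\<lambda>n. space M - B n"] conjI)
  show "(\<lambda>n. prob (space M - B n)) \<longlonglongrightarrow> 1"
    using tendsto_diff[OF tendsto_const[of "1::real"] assms(2)] by (simp add: prob_compl assms(1))
qed (use assms in auto)

lemma high_probability_space: "\<forall>\<^sub>F (n, \<omega>) in high_probability M. \<omega> \<in> space M"
  unfolding eventually_high_probability by (auto intro!: exI[of _ "\<lambda>_. space M"] simp: prob_space)

lemma filterlim_fst_high_probability: "filterlim fst sequentially (high_probability M)"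
  unfolding filterlim_at_top
proof
  fix k :: nat
  show "\<forall>\<^sub>F x in high_probability M. k \<le> fst x"
  proof (rule eventually_high_probabilityI)
    have "\<forall>\<^sub>F n in sequentially. prob (if k \<le> n then {} else space M) = 0"
      using eventually_ge_at_top[of k] by eventually_elim simp
    then show "(\<lambda>n. prob (if k \<le> n then {} else space M)) \<longlonglongrightarrow> 0"
      by (rule tendsto_eventually)
  qed (auto split: if_splits)
qed

lemma tendsto_high_probabilityI:
  fixes f :: "nat \<Rightarrow> 'a \<Rightarrow> real"
  assumes [measurable]: "\<And>n. f n \<in> borel_measurable M"
    and lim: "\<And>\<epsilon>. \<epsilon> > 0 \<Longrightarrow> (\<lambda>n. prob {\<omega>\<in>space M. \<bar>f n \<omega> - l\<bar> \<ge> \<epsilon>}) \<longlonglongrightarrow> 0"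
  shows "((\<lambda>(n, \<omega>). f n \<omega>) \<longlongrightarrow> l) (high_probability M)"
proof (rule tendstoI)
  fix \<epsilon> :: real assume "\<epsilon> > 0"
  show "\<forall>\<^sub>F x in high_probability M. dist (case x of (n, \<omega>) \<Rightarrow> f n \<omega>) l < \<epsilon>"
    by (rule eventually_high_probabilityI[OF _ lim[OF \<open>\<epsilon> > 0\<close>]]) (auto simp: dist_real_def)
qed

lemma bounded_in_probabilityI:
  fixes Y :: "nat \<Rightarrow> 'a \<Rightarrow> 'b::{real_normed_vector, second_countable_topology}"
  assumes [measurable]: "\<And>n. Y n \<in> borel_measurable M"
    and le: "\<And>\<eta>. \<eta> > 0 \<Longrightarrow> \<exists>K. \<forall>\<^sub>F n in sequentially. prob {\<omega>\<in>space M. norm (Y n \<omega>) \<ge> K} \<le> \<eta>"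
  shows "bounded_in_probability M Y"
  unfolding bounded_in_probability_def
proof (intro allI impI)
  fix \<eta> :: real assume "\<eta> > 0"
  then obtain K where K: "\<forall>\<^sub>F n in sequentially. prob {\<omega>\<in>space M. norm (Y n \<omega>) \<ge> K} \<le> \<eta>"
    using le by blast
  define A where "A n = space M - {\<omega>\<in>space M. norm (Y n \<omega>) \<ge> K}" for n
  have "prob (A n) = 1 - prob {\<omega>\<in>space M. norm (Y n \<omega>) \<ge> K}" for n
    unfolding A_def by (rule prob_compl) measurable
  with K have "\<forall>\<^sub>F n in sequentially. prob (A n) \<ge> 1 - \<eta>" by (auto elim: eventually_mono)
  moreover have "\<forall>n. A n \<in> events" unfolding A_def by measurable
  moreover have "\<forall>n. \<forall>\<omega>\<in>A n. norm (Y n \<omega>) \<le> K" by (auto simp: A_def)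
  ultimately show "\<exists>K A. (\<forall>n. A n \<in> events) \<and> (\<forall>\<^sub>F n in sequentially. 1 - \<eta> \<le> prob (A n)) \<and>
      (\<forall>n. \<forall>\<omega>\<in>A n. norm (Y n \<omega>) \<le> K)" by blast
qed

lemma bounded_in_probabilityE:
  assumes "bounded_in_probability M Y" "\<eta> > 0"
  obtains A K where "\<And>n. A n \<in> events" "\<forall>\<^sub>F n in sequentially. prob (A n) \<ge> 1 - \<eta>"
    "\<And>n \<omega>. \<omega> \<in> A n \<Longrightarrow> norm (Y n \<omega>) \<le> K"
proof -
  from assms have "\<exists>K A. (\<forall>n. A n \<in> events) \<and> (\<forall>\<^sub>F n in sequentially. prob (A n) \<ge> 1 - \<eta>) \<and>
     (\<forall>n. \<forall>\<omega>\<in>A n. norm (Y n \<omega>) \<le> K)"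
    by (simp add: bounded_in_probability_def)
  then obtain K A where A: "(\<forall>n. A n \<in> events) \<and> (\<forall>\<^sub>F n in sequentially. prob (A n) \<ge> 1 - \<eta>) \<and>
     (\<forall>n. \<forall>\<omega>\<in>A n. norm (Y n \<omega>) \<le> K)"
    by (elim exE)
  show thesis
    by (rule that[of A K]) (use A in simp_all)
qed

lemma bounded_in_probability_Pair:
  assumes "bounded_in_probability M Y" "bounded_in_probability M Z"
  shows "bounded_in_probability M (\<lambda>n \<omega>. (Y n \<omega>, Z n \<omega>))"
  unfolding bounded_in_probability_def
proof (intro allI impI)
  fix \<eta> :: real assume "\<eta> > 0"
  then have "\<eta> / 2 > 0" by simp
  obtain A K where A: "\<And>n. A n \<in> events" "\<forall>\<^sub>F n in sequentially. prob (A n) \<ge> 1 - \<eta> / 2"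
      "\<And>n \<omega>. \<omega> \<in> A n \<Longrightarrow> norm (Y n \<omega>) \<le> K"
    using bounded_in_probabilityE[OF assms(1) \<open>\<eta> / 2 > 0\<close>] by metis
  obtain B L where B: "\<And>n. B n \<in> events" "\<forall>\<^sub>F n in sequentially. prob (B n) \<ge> 1 - \<eta> / 2"
      "\<And>n \<omega>. \<omega> \<in> B n \<Longrightarrow> norm (Z n \<omega>) \<le> L"
    using bounded_in_probabilityE[OF assms(2) \<open>\<eta> / 2 > 0\<close>] by metis
  have "\<forall>\<^sub>F n in sequentially. prob (A n \<inter> B n) \<ge> 1 - \<eta>"
    using A(2) B(2)
  proof eventually_elim
    case (elim n)
    then show ?case using prob_Int_lower_bound[OF A(1)[of n] B(1)[of n]] by linarith
  qed
  moreover have "norm (Y n \<omega>, Z n \<omega>) \<le> K + L" if "\<omega> \<in> A n \<inter> B n" for n \<omega>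
    using norm_Pair_le[of "Y n \<omega>" "Z n \<omega>"] A(3)[of \<omega> n] B(3)[of \<omega> n] that by auto
  ultimately show "\<exists>K C. (\<forall>n. C n \<in> events) \<and> (\<forall>\<^sub>F n in sequentially. 1 - \<eta> \<le> prob (C n)) \<and>
      (\<forall>n. \<forall>\<omega>\<in>C n. norm (Y n \<omega>, Z n \<omega>) \<le> K)"
    using A(1) B(1) by (intro exI[of _ "K + L"] exI[of _ "\<lambda>n. A n \<inter> B n"]) auto
qed

text \<open>The tail probability beyond \<open>m + 1\<close> is at most the expectation of a continuous function that vanishes up to
  \<open>m\<close>; under the limit law this expectation is small for large \<open>m\<close>.\<close>

lemma converges_in_law_bounded_in_probability:
  fixes Y :: "nat \<Rightarrow> 'a \<Rightarrow> 'b::{real_normed_vector, second_countable_topology}"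
  assumes conv: "converges_in_law M Y N" and N: "prob_space N" "sets N = sets borel"
  shows "bounded_in_probability M Y"
proof (rule bounded_in_probabilityI)
  interpret N: prob_space N by fact
  note [measurable_cong] = N(2)
  show [measurable]: "Y n \<in> borel_measurable M" for n
    using conv by (simp add: converges_in_law_def)
  fix \<eta> :: real assume "\<eta> > 0"
  define f where "f = (\<lambda>K (y::'b). min 1 (max 0 (norm y - K)))"
  have f_range: "0 \<le> f K y" "f K y \<le> 1" for K y by (auto simp: f_def)
  have f_cont: "continuous_on UNIV (f K)" for K unfolding f_def by (intro continuous_intros)
  have [measurable]: "f K \<in> borel_measurable borel" for K
    by (rule borel_measurable_continuous_onI[OF f_cont])
  have "(\<lambda>m. \<integral>y. f (real m) y \<partial>N) \<longlonglongrightarrow> (\<integral>y. 0 \<partial>N)"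
  proof (rule integral_dominated_convergence[where w="\<lambda>_. 1"])
    show "AE y in N. (\<lambda>m. f (real m) y) \<longlonglongrightarrow> 0"
    proof (rule AE_I2, rule tendsto_eventually)
      fix y
      show "\<forall>\<^sub>F m in sequentially. f (real m) y = 0"
        using eventually_ge_at_top[of "nat \<lceil>norm y\<rceil>"]
        by eventually_elim (auto simp: f_def nat_le_iff ceiling_le_iff)
    qed
  qed (auto simp: f_range)
  then have "\<forall>\<^sub>F m in sequentially. (\<integral>y. f (real m) y \<partial>N) < \<eta>"
    using \<open>\<eta> > 0\<close> by (intro order_tendstoD(2)) auto
  then obtain m where m: "(\<integral>y. f (real m) y \<partial>N) < \<eta>"
    unfolding eventually_sequentially by blast
  have "bounded (range (f (real m)))"
    using f_range by (intro boundedI[where B=1]) auto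
  then have "(\<lambda>n. \<integral>\<omega>. f (real m) (Y n \<omega>) \<partial>M) \<longlonglongrightarrow> (\<integral>y. f (real m) y \<partial>N)"
    using conv f_cont by (simp add: converges_in_law_def)
  then have ev: "\<forall>\<^sub>F n in sequentially. (\<integral>\<omega>. f (real m) (Y n \<omega>) \<partial>M) < \<eta>"
    using m by (rule order_tendstoD(2))
  have "prob {\<omega>\<in>space M. norm (Y n \<omega>) \<ge> real m + 1} \<le> (\<integral>\<omega>. f (real m) (Y n \<omega>) \<partial>M)" for n
  proof -
    have "prob {\<omega>\<in>space M. norm (Y n \<omega>) \<ge> real m + 1} \<le> prob {\<omega>\<in>space M. f (real m) (Y n \<omega>) \<ge> 1}"
      by (rule finite_measure_mono) (auto simp: f_def)
    also have "\<dots> \<le> (\<integral>\<omega>. f (real m) (Y n \<omega>) \<partial>M) / 1"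
      by (rule integral_Markov_inequality_measure[where A="{}"])
         (auto simp: f_range intro!: integrable_const_bound[where B=1])
    finally show ?thesis by simp
  qed
  then have "\<forall>\<^sub>F n in sequentially. prob {\<omega>\<in>space M. norm (Y n \<omega>) \<ge> real m + 1} \<le> \<eta>"
    using ev by (auto elim!: eventually_mono intro: order_trans less_imp_le)
  then show "\<exists>K. \<forall>\<^sub>F n in sequentially. prob {\<omega>\<in>space M. norm (Y n \<omega>) \<ge> K} \<le> \<eta>" by blast
qed

text \<open>A sequence that is bounded in probability is bounded along the filter of high probability only after
  restricting the filter to events whose probability is close to 1. A claim about all filters below
  the filter of high probability can be applied to each of these restrictions, and letting the
  probability of the events tend to 1 gives convergence in probability.\<close>

lemma tendsto_in_probability_of_bounded:
  fixes D :: "nat \<Rightarrow> 'a \<Rightarrow> real" and Y :: "nat \<Rightarrow> 'a \<Rightarrow> 'b::real_normed_vector"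
  assumes [measurable]: "\<And>n. D n \<in> borel_measurable M"
    and Y: "bounded_in_probability M Y"
    and lim: "\<And>H. H \<le> high_probability M \<Longrightarrow> Bfun (\<lambda>(n, \<omega>). Y n \<omega>) H \<Longrightarrow>
       ((\<lambda>(n, \<omega>). D n \<omega>) \<longlongrightarrow> 0) H"
    and "\<epsilon> > 0"
  shows "(\<lambda>n. prob {\<omega>\<in>space M. \<bar>D n \<omega>\<bar> \<ge> \<epsilon>}) \<longlonglongrightarrow> 0"
proof (rule tendstoI)
  fix \<eta> :: real assume "\<eta> > 0"
  then have "\<eta> / 2 > 0" by simp
  obtain A K where A: "\<And>n. A n \<in> events" "\<forall>\<^sub>F n in sequentially. prob (A n) \<ge> 1 - \<eta> / 2"
      "\<And>n \<omega>. \<omega> \<in> A n \<Longrightarrow> norm (Y n \<omega>) \<le> K"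
    using bounded_in_probabilityE[OF Y \<open>\<eta> / 2 > 0\<close>] by metis
  define H where "H = inf (high_probability M) (principal {(n, \<omega>). \<omega> \<in> A n})"
  have "Bfun (\<lambda>(n, \<omega>). Y n \<omega>) H"
    by (rule BfunI[where K=K]) (auto simp: H_def eventually_inf_principal A(3) intro!: always_eventually)
  then have "((\<lambda>(n, \<omega>). D n \<omega>) \<longlongrightarrow> 0) H" by (intro lim) (auto simp: H_def)
  then have "\<forall>\<^sub>F x in H. dist (case x of (n, \<omega>) \<Rightarrow> D n \<omega>) 0 < \<epsilon>" using \<open>\<epsilon> > 0\<close> by (rule tendstoD)
  then have "\<forall>\<^sub>F (n, \<omega>) in high_probability M. \<omega> \<in> A n \<longrightarrow> \<bar>D n \<omega>\<bar> < \<epsilon>"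
    by (simp add: H_def eventually_inf_principal case_prod_beta')
  then obtain C where C: "\<And>n. C n \<in> events" "(\<lambda>n. prob (C n)) \<longlonglongrightarrow> 1"
      "\<And>n \<omega>. \<omega> \<in> C n \<Longrightarrow> \<omega> \<in> A n \<Longrightarrow> \<bar>D n \<omega>\<bar> < \<epsilon>"
    unfolding eventually_high_probability by auto
  have "\<forall>\<^sub>F n in sequentially. prob (C n) > 1 - \<eta> / 2"
    using C(2) \<open>\<eta> > 0\<close> by (intro order_tendstoD(1)) auto
  then show "\<forall>\<^sub>F n in sequentially. dist (prob {\<omega>\<in>space M. \<bar>D n \<omega>\<bar> \<ge> \<epsilon>}) 0 < \<eta>"
    using A(2)
  proof eventually_elim
    case (elim n)
    have "prob {\<omega>\<in>space M. \<bar>D n \<omega>\<bar> \<ge> \<epsilon>} \<le> prob (space M - (A n \<inter> C n))"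
      using C(3)[of _ n] A(1) C(1) by (intro finite_measure_mono) force+
    also have "\<dots> = 1 - prob (A n \<inter> C n)" using A(1) C(1) by (intro prob_compl) auto
    also have "\<dots> < \<eta>" using prob_Int_lower_bound[OF A(1)[of n] C(1)[of n]] elim by linarith
    finally show ?case by simp
  qed
qed

lemma second_moment_sum:
  fixes Y :: "'i \<Rightarrow> 'a \<Rightarrow> real"
  assumes "finite I" and indep: "indep_vars (\<lambda>_. borel) Y I"
    and sq: "\<And>i. i \<in> I \<Longrightarrow> integrable M (\<lambda>\<omega>. (Y i \<omega>)\<^sup>2)"
    and mean: "\<And>i. i \<in> I \<Longrightarrow> expectation (Y i) = 0"
  shows "integrable M (\<lambda>\<omega>. (\<Sum>i\<in>I. Y i \<omega>)\<^sup>2) \<and>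
    expectation (\<lambda>\<omega>. (\<Sum>i\<in>I. Y i \<omega>)\<^sup>2) = (\<Sum>i\<in>I. expectation (\<lambda>\<omega>. (Y i \<omega>)\<^sup>2))"
  using assms
proof (induction I)
  case (insert i I)
  have meas[measurable]: "Y j \<in> borel_measurable M" if "j \<in> insert i I" for j
    using insert.prems(1) that unfolding indep_vars_def by blast
  let ?S = "\<lambda>\<omega>. \<Sum>j\<in>I. Y j \<omega>"
  have IH: "integrable M (\<lambda>\<omega>. (?S \<omega>)\<^sup>2)"
      "expectation (\<lambda>\<omega>. (?S \<omega>)\<^sup>2) = (\<Sum>i\<in>I. expectation (\<lambda>\<omega>. (Y i \<omega>)\<^sup>2))"
    using insert.IH[OF indep_vars_subset[OF insert.prems(1)]] insert.prems by auto
  have intY: "integrable M (Y j)" if "j \<in> insert i I" for j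
    using square_integrable_imp_integrable[OF meas[OF that]] insert.prems(2)[OF that] by simp
  have intS: "integrable M ?S" by (intro Bochner_Integration.integrable_sum intY) auto
  have iv: "indep_var borel (Y i) borel ?S"
    using indep_vars_sum[OF insert.hyps insert.prems(1)] .
  have prod: "integrable M (\<lambda>\<omega>. Y i \<omega> * ?S \<omega>)" "expectation (\<lambda>\<omega>. Y i \<omega> * ?S \<omega>) = 0"
    using indep_var_integrable[OF iv intY intS] indep_var_lebesgue_integral[OF iv intY intS]
      insert.prems(3)[of i] by auto
  have eq: "(\<Sum>j\<in>insert i I. Y j \<omega>)\<^sup>2 = (Y i \<omega>)\<^sup>2 + 2 * (Y i \<omega> * ?S \<omega>) + (?S \<omega>)\<^sup>2" for \<omega>
    using insert.hyps by (simp add: power2_eq_square algebra_simps)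
  show ?case
    unfolding eq using prod IH insert.prems(2)[of i] insert.hyps by simp
qed simp

end

section \<open>Laws of large numbers\<close>

locale iid_sample = prob_space M for M :: "'a measure" +
  fixes X :: "nat \<Rightarrow> 'a \<Rightarrow> 'b::topological_space" and F :: "'b measure"
  assumes indep: "indep_vars (\<lambda>_. borel) X UNIV" and ident: "\<And>i. distr M borel (X i) = F"
begin

lemma sample_measurable[measurable]: "X i \<in> measurable M borel"
  using indep by (simp add: indep_vars_def)

lemma sets_F[measurable_cong]: "sets F = sets borel"
  using ident[of 0] by (metis sets_distr)

lemma prob_space_F: "prob_space F"
  using prob_space_distr[OF sample_measurable[of 0]] unfolding ident .

lemma integrable_sample_iff:
  fixes h :: "'b \<Rightarrow> 'c::{banach, second_countable_topology}"
  assumes "h \<in> borel_measurable F"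
  shows "integrable M (\<lambda>\<omega>. h (X i \<omega>)) \<longleftrightarrow> integrable F h"
  using assms integrable_distr_eq[OF sample_measurable, of h i]
  by (simp add: ident cong: measurable_cong_sets[OF sets_F refl])

lemma expectation_sample:
  fixes h :: "'b \<Rightarrow> 'c::{banach, second_countable_topology}"
  assumes "h \<in> borel_measurable F"
  shows "expectation (\<lambda>\<omega>. h (X i \<omega>)) = (\<integral>x. h x \<partial>F)"
  using assms integral_distr[OF sample_measurable, of h i]
  by (simp add: ident cong: measurable_cong_sets[OF sets_F refl])

lemma second_moment_sample_sum:
  fixes h :: "'b \<Rightarrow> real"
  assumes [measurable]: "h \<in> borel_measurable F"
    and sq: "integrable F (\<lambda>x. (h x)\<^sup>2)" and mean: "(\<integral>x. h x \<partial>F) = 0"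
  shows "integrable M (\<lambda>\<omega>. (\<Sum>i<n. h (X i \<omega>))\<^sup>2)"
    and "expectation (\<lambda>\<omega>. (\<Sum>i<n. h (X i \<omega>))\<^sup>2) = real n * (\<integral>x. (h x)\<^sup>2 \<partial>F)"
proof -
  have "indep_vars (\<lambda>_. borel) (\<lambda>i \<omega>. h (X i \<omega>)) {..<n}"
    by (rule indep_vars_compose2[OF indep_vars_subset[OF indep]]) auto
  then have "integrable M (\<lambda>\<omega>. (\<Sum>i<n. h (X i \<omega>))\<^sup>2) \<and>
     expectation (\<lambda>\<omega>. (\<Sum>i<n. h (X i \<omega>))\<^sup>2) = (\<Sum>i<n. expectation (\<lambda>\<omega>. (h (X i \<omega>))\<^sup>2))"
    by (rule second_moment_sum[OF finite_lessThan])
       (use sq mean in \<open>simp_all add: integrable_sample_iff[of "\<lambda>x. (h x)\<^sup>2"] expectation_sample\<close>)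
  then show "integrable M (\<lambda>\<omega>. (\<Sum>i<n. h (X i \<omega>))\<^sup>2)"
    and "expectation (\<lambda>\<omega>. (\<Sum>i<n. h (X i \<omega>))\<^sup>2) = real n * (\<integral>x. (h x)\<^sup>2 \<partial>F)"
    by (simp_all add: expectation_sample[of "\<lambda>x. (h x)\<^sup>2"])
qed

lemma chebyshev_sample_mean:
  fixes h :: "'b \<Rightarrow> real"
  assumes [measurable]: "h \<in> borel_measurable F" and bounded: "\<And>x. \<bar>h x\<bar> \<le> c" and "\<epsilon> > 0" "n > 0"
  shows "prob {\<omega>\<in>space M. \<bar>(\<Sum>i<n. h (X i \<omega>)) / real n - (\<integral>x. h x \<partial>F)\<bar> \<ge> \<epsilon>}
    \<le> (2 * c)\<^sup>2 / (real n * \<epsilon>\<^sup>2)"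
proof -
  interpret F: prob_space F by (rule prob_space_F)
  define \<mu> where "\<mu> = (\<integral>x. h x \<partial>F)"
  define h0 where "h0 = (\<lambda>x. h x - \<mu>)"
  have [measurable]: "h0 \<in> borel_measurable F" by (simp add: h0_def)
  have "c \<ge> 0" using bounded[of undefined] by linarith
  have int: "integrable F h"
    by (rule F.integrable_const_bound[where B=c]) (auto simp: bounded)
  have "\<bar>\<mu>\<bar> \<le> (\<integral>x. \<bar>h x\<bar> \<partial>F)" unfolding \<mu>_def by (rule integral_abs_bound)
  also have "\<dots> \<le> (\<integral>x. c \<partial>F)" using int bounded by (intro integral_mono) auto
  finally have "\<bar>\<mu>\<bar> \<le> c" by (simp add: F.prob_space)
  then have "\<bar>h0 x\<bar> \<le> 2 * c" for x using bounded[of x] by (simp add: h0_def)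
  then have h0sq: "(h0 x)\<^sup>2 \<le> (2 * c)\<^sup>2" for x using \<open>c \<ge> 0\<close> by (metis abs_ge_zero abs_le_square_iff abs_of_nonneg order_trans)
  have sq: "integrable F (\<lambda>x. (h0 x)\<^sup>2)"
  proof (rule F.integrable_const_bound)
    show "AE x in F. norm ((h0 x)\<^sup>2) \<le> (2 * c)\<^sup>2"
      by (rule AE_I2) (simp only: real_norm_def abs_power2 h0sq)
  qed measurable
  have mean: "(\<integral>x. h0 x \<partial>F) = 0"
    using int by (simp add: h0_def \<mu>_def[symmetric] F.prob_space)
  note S = second_moment_sample_sum[OF _ sq mean, of n]
  have "(\<integral>x. (h0 x)\<^sup>2 \<partial>F) \<le> (\<integral>x. (2 * c)\<^sup>2 \<partial>F)" using sq h0sq by (intro integral_mono) auto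
  then have var: "(\<integral>x. (h0 x)\<^sup>2 \<partial>F) \<le> (2 * c)\<^sup>2" by (simp add: F.prob_space)
  have "prob {\<omega>\<in>space M. \<bar>(\<Sum>i<n. h (X i \<omega>)) / real n - \<mu>\<bar> \<ge> \<epsilon>}
     \<le> prob {\<omega>\<in>space M. (\<Sum>i<n. h0 (X i \<omega>))\<^sup>2 \<ge> (real n * \<epsilon>)\<^sup>2}"
  proof (rule finite_measure_mono)
    show "{\<omega>\<in>space M. \<bar>(\<Sum>i<n. h (X i \<omega>)) / real n - \<mu>\<bar> \<ge> \<epsilon>}
      \<subseteq> {\<omega>\<in>space M. (\<Sum>i<n. h0 (X i \<omega>))\<^sup>2 \<ge> (real n * \<epsilon>)\<^sup>2}"
    proof clarify
      fix \<omega> assume *: "\<epsilon> \<le> \<bar>(\<Sum>i<n. h (X i \<omega>)) / real n - \<mu>\<bar>"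
      have "(\<Sum>i<n. h0 (X i \<omega>)) = real n * ((\<Sum>i<n. h (X i \<omega>)) / real n - \<mu>)"
        using \<open>n > 0\<close> by (simp add: h0_def sum_subtractf field_simps)
      then have "real n * \<epsilon> \<le> \<bar>\<Sum>i<n. h0 (X i \<omega>)\<bar>"
        using * by (simp add: abs_mult mult_left_mono)
      then show "(real n * \<epsilon>)\<^sup>2 \<le> (\<Sum>i<n. h0 (X i \<omega>))\<^sup>2"
        using \<open>\<epsilon> > 0\<close> by (intro abs_le_square_iff[THEN iffD1]) simp
    qed
  qed measurable
  also have "\<dots> \<le> expectation (\<lambda>\<omega>. (\<Sum>i<n. h0 (X i \<omega>))\<^sup>2) / (real n * \<epsilon>)\<^sup>2"
    using S \<open>\<epsilon> > 0\<close> \<open>n > 0\<close> by (intro integral_Markov_inequality_measure[where A="{}"]) auto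
  also have "\<dots> = (\<integral>x. (h0 x)\<^sup>2 \<partial>F) / (real n * \<epsilon>\<^sup>2)"
    using S(2) \<open>n > 0\<close> by (simp add: power_mult_distrib power2_eq_square)
  also have "\<dots> \<le> (2 * c)\<^sup>2 / (real n * \<epsilon>\<^sup>2)" using var by (intro divide_right_mono) auto
  finally show ?thesis unfolding \<mu>_def .
qed

text \<open>Without a second moment, the summands are split at a level \<open>m\<close>: Chebyshev's inequality handles the
  bounded part, Markov's inequality the tail, whose first moment is small for large \<open>m\<close>.\<close>

theorem weak_law_of_large_numbers:
  fixes h :: "'b \<Rightarrow> real"
  assumes int: "integrable F h"
  shows "((\<lambda>(n, \<omega>). (\<Sum>i<n. h (X i \<omega>)) / real n) \<longlongrightarrow> (\<integral>x. h x \<partial>F)) (high_probability M)"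
proof (rule tendsto_high_probabilityI)
  interpret F: prob_space F by (rule prob_space_F)
  have [measurable]: "h \<in> borel_measurable F" using int by simp
  show "(\<lambda>\<omega>. (\<Sum>i<n. h (X i \<omega>)) / real n) \<in> borel_measurable M" for n by measurable
  let ?dev = "\<lambda>n \<omega>. (\<Sum>i<n. h (X i \<omega>)) / real n - (\<integral>x. h x \<partial>F)"
  fix \<epsilon> :: real assume \<epsilon>: "\<epsilon> > 0"
  show "(\<lambda>n. prob {\<omega>\<in>space M. \<bar>?dev n \<omega>\<bar> \<ge> \<epsilon>}) \<longlonglongrightarrow> 0"
  proof (rule tendstoI)
    fix \<eta> :: real assume \<eta>: "\<eta> > 0"
    define lo where "lo = (\<lambda>c x. if \<bar>h x\<bar> \<le> c then h x else 0)"
    define hi where "hi = (\<lambda>c x. if \<bar>h x\<bar> \<le> c then 0 else h x)"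
    have [measurable]: "lo c \<in> borel_measurable F" "hi c \<in> borel_measurable F" for c
      unfolding lo_def hi_def by measurable
    have split: "h x = lo c x + hi c x" for c x by (simp add: lo_def hi_def)
    have int_hi: "integrable F (hi c)" and int_lo: "integrable F (lo c)" for c
      by (rule Bochner_Integration.integrable_bound[OF int]; simp add: hi_def lo_def)+
    have "(\<lambda>m. \<integral>x. \<bar>hi (real m) x\<bar> \<partial>F) \<longlonglongrightarrow> (\<integral>x. 0 \<partial>F)"
    proof (rule integral_dominated_convergence[where w="\<lambda>x. \<bar>h x\<bar>"])
      show "AE x in F. (\<lambda>m. \<bar>hi (real m) x\<bar>) \<longlonglongrightarrow> 0"
      proof (rule AE_I2, rule tendsto_eventually)
        fix x
        show "\<forall>\<^sub>F m in sequentially. \<bar>hi (real m) x\<bar> = 0"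
          using eventually_ge_at_top[of "nat \<lceil>\<bar>h x\<bar>\<rceil>"]
          by eventually_elim (auto simp: hi_def nat_le_iff ceiling_le_iff)
      qed
      show "AE x in F. norm \<bar>hi (real m) x\<bar> \<le> \<bar>h x\<bar>" for m by (auto simp: hi_def)
    qed (use int in auto)
    then have "\<forall>\<^sub>F m in sequentially. (\<integral>x. \<bar>hi (real m) x\<bar> \<partial>F) < min (\<epsilon> / 3) (\<epsilon> * \<eta> / 6)"
      using \<epsilon> \<eta> by (intro order_tendstoD(2)) auto
    \<comment> \<open>The first bound controls the mean of the tail, the second one its sample mean, up to an event
      of probability \<open>\<eta> / 2\<close>.\<close>
    then obtain m where m: "(\<integral>x. \<bar>hi (real m) x\<bar> \<partial>F) < min (\<epsilon> / 3) (\<epsilon> * \<eta> / 6)"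
      unfolding eventually_sequentially by blast
    let ?lo = "lo (real m)" and ?hi = "hi (real m)"
    have mean_hi: "\<bar>\<integral>x. ?hi x \<partial>F\<bar> < \<epsilon> / 3"
      using m integral_abs_bound[of F ?hi] by linarith
    have mean: "(\<integral>x. h x \<partial>F) = (\<integral>x. ?lo x \<partial>F) + (\<integral>x. ?hi x \<partial>F)"
      using Bochner_Integration.integral_add[OF int_lo[of "real m"] int_hi[of "real m"]]
      unfolding split[symmetric] .
    have "(\<lambda>n. (2 * real m)\<^sup>2 / (real n * (\<epsilon> / 3)\<^sup>2)) \<longlonglongrightarrow> 0"
      using \<epsilon> by real_asymp
    then have "\<forall>\<^sub>F n in sequentially. (2 * real m)\<^sup>2 / (real n * (\<epsilon> / 3)\<^sup>2) < \<eta> / 2"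
      using \<eta> by (intro order_tendstoD(2)) auto
    then show "\<forall>\<^sub>F n in sequentially. dist (prob {\<omega>\<in>space M.
        \<bar>?dev n \<omega>\<bar> \<ge> \<epsilon>}) 0 < \<eta>"
      using eventually_gt_at_top[of 0]
    proof eventually_elim
      case (elim n)
      let ?A = "{\<omega>\<in>space M. \<bar>(\<Sum>i<n. ?lo (X i \<omega>)) / real n - (\<integral>x. ?lo x \<partial>F)\<bar> \<ge> \<epsilon> / 3}"
      let ?B = "{\<omega>\<in>space M. (\<Sum>i<n. \<bar>?hi (X i \<omega>)\<bar>) / real n \<ge> \<epsilon> / 3}"
      have "prob {\<omega>\<in>space M. \<bar>?dev n \<omega>\<bar> \<ge> \<epsilon>} \<le> prob (?A \<union> ?B)"
      proof (rule finite_measure_mono)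
        show "{\<omega>\<in>space M. \<bar>?dev n \<omega>\<bar> \<ge> \<epsilon>} \<subseteq> ?A \<union> ?B"
        proof (rule subsetI, rule ccontr)
          fix \<omega> assume a: "\<omega> \<in> {\<omega>\<in>space M. \<bar>?dev n \<omega>\<bar> \<ge> \<epsilon>}"
            and n: "\<omega> \<notin> ?A \<union> ?B"
          have 1: "(\<Sum>i<n. h (X i \<omega>)) / real n
             = (\<Sum>i<n. ?lo (X i \<omega>)) / real n + (\<Sum>i<n. ?hi (X i \<omega>)) / real n"
            by (subst split[of _ "real m"]) (simp add: sum.distrib add_divide_distrib)
          have 2: "\<bar>(\<Sum>i<n. ?hi (X i \<omega>)) / real n\<bar> \<le> (\<Sum>i<n. \<bar>?hi (X i \<omega>)\<bar>) / real n"
            by (simp add: divide_right_mono)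
          have 3: "\<bar>(\<Sum>i<n. ?lo (X i \<omega>)) / real n - (\<integral>x. ?lo x \<partial>F)\<bar> < \<epsilon> / 3"
            and 4: "(\<Sum>i<n. \<bar>?hi (X i \<omega>)\<bar>) / real n < \<epsilon> / 3"
            using a n unfolding not_le[symmetric] by blast+
          have 5: "\<epsilon> \<le> \<bar>(\<Sum>i<n. ?lo (X i \<omega>)) / real n + (\<Sum>i<n. ?hi (X i \<omega>)) / real n
             - ((\<integral>x. ?lo x \<partial>F) + (\<integral>x. ?hi x \<partial>F))\<bar>"
          proof -
            have "\<epsilon> \<le> \<bar>?dev n \<omega>\<bar>" using a by blast
            then show ?thesis unfolding 1 mean .
          qed
          have "False" if "\<epsilon> \<le> \<bar>u + v - (p + q)\<bar>" "\<bar>u - p\<bar> < \<epsilon> / 3" "\<bar>v\<bar> \<le> w" "w < \<epsilon> / 3" "\<bar>q\<bar> < \<epsilon> / 3"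
            for u v w p q :: real using that by linarith
          from this[OF 5 3 2 4 mean_hi] show False .
        qed
      qed measurable
      also have "\<dots> \<le> prob ?A + prob ?B" by (rule measure_Un_le) measurable
      also have "prob ?A \<le> (2 * real m)\<^sup>2 / (real n * (\<epsilon> / 3)\<^sup>2)"
        using \<epsilon> elim by (intro chebyshev_sample_mean) (auto simp: lo_def)
      also have "\<dots> < \<eta> / 2" using elim by simp
      also have "prob ?B \<le> expectation (\<lambda>\<omega>. (\<Sum>i<n. \<bar>?hi (X i \<omega>)\<bar>) / real n) / (\<epsilon> / 3)"
        using \<epsilon> int_hi by (intro integral_Markov_inequality_measure[where A="{}"])
          (auto simp: integrable_sample_iff intro!: sum_nonneg divide_nonneg_nonneg)
      also have "\<dots> = (\<integral>x. \<bar>?hi x\<bar> \<partial>F) / (\<epsilon> / 3)"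
        using int_hi elim(2) expectation_sample[of "\<lambda>x. \<bar>?hi x\<bar>"] by (simp add: integrable_sample_iff)
      also have "\<dots> < \<eta> / 2" using m \<epsilon> by (simp add: field_simps)
      finally show ?case by simp
    qed
  qed
qed

lemma sample_sum_bounded_in_probability:
  fixes h :: "'b \<Rightarrow> real^'n"
  assumes [measurable]: "h \<in> borel_measurable F"
    and sq: "\<And>j. integrable F (\<lambda>x. (h x $ j)\<^sup>2)" and mean: "\<And>j. (\<integral>x. h x $ j \<partial>F) = 0"
  shows "bounded_in_probability M (\<lambda>n \<omega>. (\<Sum>i<n. h (X i \<omega>)) /\<^sub>R sqrt (real n))"
proof (rule bounded_in_probabilityI)
  show [measurable]: "(\<lambda>\<omega>. (\<Sum>i<n. h (X i \<omega>)) /\<^sub>R sqrt (real n)) \<in> borel_measurable M" for n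
    by measurable
  fix \<eta> :: real assume \<eta>: "\<eta> > 0"
  define v where "v = (\<Sum>j\<in>UNIV. \<integral>x. (h x $ j)\<^sup>2 \<partial>F)"
  have v: "v \<ge> 0" unfolding v_def by (intro sum_nonneg integral_nonneg_AE) auto
  define K where "K = sqrt ((v + 1) / \<eta>)"
  have K: "K > 0" "K\<^sup>2 = (v + 1) / \<eta>" using v \<eta> by (auto simp: K_def)
  have hm: "(\<lambda>x. h x $ j) \<in> borel_measurable F" for j
    unfolding cart_eq_inner_axis by measurable
  have normsq: "(norm (\<Sum>i<n. h (X i \<omega>)))\<^sup>2 = (\<Sum>j\<in>UNIV. (\<Sum>i<n. h (X i \<omega>) $ j)\<^sup>2)" for n \<omega>
    unfolding power2_norm_eq_inner inner_vec_def by (simp add: power2_eq_square)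
  note S = second_moment_sample_sum[OF hm sq mean]
  have "prob {\<omega>\<in>space M. K \<le> norm ((\<Sum>i<n. h (X i \<omega>)) /\<^sub>R sqrt (real n))} \<le> \<eta>" if "n > 0" for n
  proof -
    have "{\<omega>\<in>space M. K \<le> norm ((\<Sum>i<n. h (X i \<omega>)) /\<^sub>R sqrt (real n))}
       = {\<omega>\<in>space M. K\<^sup>2 * real n \<le> (norm (\<Sum>i<n. h (X i \<omega>)))\<^sup>2}"
    proof -
      have "K \<le> norm (y /\<^sub>R sqrt (real n)) \<longleftrightarrow> K\<^sup>2 * real n \<le> (norm y)\<^sup>2" for y :: "real^'n"
      proof -
        have "K \<le> norm (y /\<^sub>R sqrt (real n)) \<longleftrightarrow> K * sqrt (real n) \<le> norm y"
          using that by (simp add: field_simps)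
        also have "\<dots> \<longleftrightarrow> (K * sqrt (real n))\<^sup>2 \<le> (norm y)\<^sup>2"
          using K(1) by (simp add: power_mono_iff)
        finally show ?thesis by (simp add: power_mult_distrib)
      qed
      then show ?thesis by simp
    qed
    also have "prob \<dots> \<le> expectation (\<lambda>\<omega>. (norm (\<Sum>i<n. h (X i \<omega>)))\<^sup>2) / (K\<^sup>2 * real n)"
      using K(1) that S(1) unfolding normsq
      by (intro integral_Markov_inequality_measure[where A="{}"]) (auto intro!: AE_I2 sum_nonneg)
    also have "expectation (\<lambda>\<omega>. (norm (\<Sum>i<n. h (X i \<omega>)))\<^sup>2) = real n * v"
      unfolding normsq v_def using S by (simp add: sum_distrib_left)
    also have "real n * v / (K\<^sup>2 * real n) = v / K\<^sup>2" using that by simp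
    also have "\<dots> \<le> \<eta>" unfolding K(2) using v \<eta> by (simp add: field_simps)
    finally show ?thesis .
  qed
  then show "\<exists>K. \<forall>\<^sub>F n in sequentially.
      prob {\<omega>\<in>space M. K \<le> norm ((\<Sum>i<n. h (X i \<omega>)) /\<^sub>R sqrt (real n))} \<le> \<eta>"
    using eventually_gt_at_top[of 0] by (blast intro: eventually_mono)
qed

text \<open>A union bound: each of the \<open>n\<close> events has probability of order \<open>n\<^sup>-\<^sup>3\<^sup>/\<^sup>2\<close> by Markov's inequality. For a
  bound \<open>h\<close> of \<open>(norm g)\<^sup>3\<close>, this makes the largest \<open>norm g\<close> in the sample \<open>o(\<surd>n)\<close>.\<close>

lemma sample_maximum_negligible:
  fixes h :: "'b \<Rightarrow> real"
  assumes int: "integrable F h" and nonneg: "\<And>x. h x \<ge> 0" and \<epsilon>: "\<epsilon> > 0"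
  shows "\<forall>\<^sub>F (n, \<omega>) in high_probability M. \<forall>i<n. h (X i \<omega>) < \<epsilon> * sqrt (real n) ^ 3"
proof (rule eventually_high_probabilityI)
  have [measurable]: "h \<in> borel_measurable F" using int by simp
  define B where "B n = (\<Union>i<n. {\<omega>\<in>space M. h (X i \<omega>) \<ge> \<epsilon> * sqrt (real n) ^ 3})" for n
  show "B n \<in> events" for n unfolding B_def by measurable
  show "case (n, \<omega>) of (n, \<omega>) \<Rightarrow> \<forall>i<n. h (X i \<omega>) < \<epsilon> * sqrt (real n) ^ 3"
    if "\<omega> \<in> space M" "\<omega> \<notin> B n" for n \<omega> using that by (auto simp: B_def not_le)
  have le: "prob (B n) \<le> (\<integral>x. h x \<partial>F) / (\<epsilon> * sqrt (real n))" if "n > 0" for n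
  proof -
    have "prob (B n) \<le> (\<Sum>i<n. prob {\<omega>\<in>space M. h (X i \<omega>) \<ge> \<epsilon> * sqrt (real n) ^ 3})"
      unfolding B_def by (rule finite_measure_subadditive_finite) auto
    also have "\<dots> \<le> (\<Sum>i<n. expectation (\<lambda>\<omega>. h (X i \<omega>)) / (\<epsilon> * sqrt (real n) ^ 3))"
      using int nonneg \<epsilon> that
      by (intro sum_mono integral_Markov_inequality_measure[where A="{}"]) (auto simp: integrable_sample_iff)
    also have "\<dots> = real n * (\<integral>x. h x \<partial>F) / (\<epsilon> * sqrt (real n) ^ 3)" by (simp add: expectation_sample)
    also have "sqrt (real n) ^ 3 = real n * sqrt (real n)" by (simp add: power3_eq_cube)
    also have "real n * (\<integral>x. h x \<partial>F) / (\<epsilon> * (real n * sqrt (real n))) = (\<integral>x. h x \<partial>F) / (\<epsilon> * sqrt (real n))"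
      using that \<epsilon> by (simp add: field_simps)
    finally show ?thesis .
  qed
  show "(\<lambda>n. prob (B n)) \<longlonglongrightarrow> 0"
  proof (rule tendsto_sandwich[where f="\<lambda>_. 0"])
    show "\<forall>\<^sub>F n in sequentially. prob (B n) \<le> (\<integral>x. h x \<partial>F) / (\<epsilon> * sqrt (real n))"
      using eventually_gt_at_top[of 0] by eventually_elim (rule le)
    show "(\<lambda>n. (\<integral>x. h x \<partial>F) / (\<epsilon> * sqrt (real n))) \<longlonglongrightarrow> 0"
      using tendsto_mult[OF tendsto_const[of "(\<integral>x. h x \<partial>F) / \<epsilon>"]
          tendsto_inverse_0_at_top[OF filterlim_compose[OF sqrt_at_top filterlim_real_sequentially]]]
      by (simp add: divide_inverse mult_ac)
  qed auto
qed

end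

section \<open>Products of bounded and vanishing functions\<close>

lemma (in bounded_bilinear) tendsto_zero_Bfun:
  "(f \<longlongrightarrow> 0) F \<Longrightarrow> Bfun g F \<Longrightarrow> ((\<lambda>x. prod (f x) (g x)) \<longlongrightarrow> 0) F"
  using Zfun_prod_Bfun by (simp add: tendsto_Zfun_iff)

lemma (in bounded_bilinear) Bfun_tendsto_zero:
  "Bfun f F \<Longrightarrow> (g \<longlongrightarrow> 0) F \<Longrightarrow> ((\<lambda>x. prod (f x) (g x)) \<longlongrightarrow> 0) F"
  using Bfun_prod_Zfun by (simp add: tendsto_Zfun_iff)

lemma (in bounded_bilinear) Bfun_prod:
  assumes "Bfun f F" "Bfun g F"
  shows "Bfun (\<lambda>x. prod (f x) (g x)) F"
proof -
  obtain A where A: "A > 0" "\<forall>\<^sub>F x in F. norm (f x) \<le> A" using assms(1) by (rule BfunE)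
  obtain B where B: "B > 0" "\<forall>\<^sub>F x in F. norm (g x) \<le> B" using assms(2) by (rule BfunE)
  obtain K where K: "K > 0" "\<And>a b. norm (prod a b) \<le> norm a * norm b * K" using pos_bounded by blast
  show ?thesis
  proof (rule BfunI)
    show "\<forall>\<^sub>F x in F. norm (prod (f x) (g x)) \<le> A * B * K"
      using A(2) B(2)
    proof eventually_elim
      case (elim x)
      then have "norm (f x) * norm (g x) * K \<le> A * B * K"
        using A(1) K(1) by (intro mult_right_mono mult_mono) auto
      then show ?case using K(2)[of "f x" "g x"] by linarith
    qed
  qed
qed

lemma Bfun_add:
  fixes f g :: "'a \<Rightarrow> 'b::real_normed_vector"
  assumes "Bfun f F" "Bfun g F"
  shows "Bfun (\<lambda>x. f x + g x) F"
proof -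
  obtain A where A: "\<forall>\<^sub>F x in F. norm (f x) \<le> A" using assms(1) by (rule BfunE)
  obtain B where B: "\<forall>\<^sub>F x in F. norm (g x) \<le> B" using assms(2) by (rule BfunE)
  show ?thesis
    by (rule BfunI[where K="A + B"])
       (use A B in eventually_elim, metis norm_triangle_mono)
qed

lemma Bfun_norm: "Bfun f F \<Longrightarrow> Bfun (\<lambda>x. norm (f x)) F"
  for f :: "'a \<Rightarrow> 'b::real_normed_vector"
  by (simp add: Bfun_def)

lemma tendsto_imp_Bfun:
  fixes f :: "'a \<Rightarrow> 'b::real_normed_vector"
  assumes "(f \<longlongrightarrow> l) F"
  shows "Bfun f F"
proof -
  have "Bfun (\<lambda>x. (f x - l) + l) F"
  proof (rule Bfun_add)
    have "\<forall>\<^sub>F x in F. dist (f x) l < 1" using assms by (rule tendstoD) simp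
    then show "Bfun (\<lambda>x. f x - l) F"
      by (intro BfunI[where K=1]) (auto simp: dist_norm elim: eventually_mono)
  qed simp
  then show ?thesis by simp
qed

section \<open>Second-order expansion of a divergence\<close>

text \<open>The derivative of \<open>\<phi>\<close> is differentiable at 1, but perhaps nowhere else. So the mean value theorem
  is applied once, to \<open>\<phi>\<close> minus its quadratic part.\<close>

lemma \<Phi>_quadratic_at_1:
  assumes phi: "\<phi> \<in> \<Phi>" and "\<kappa> > 0"
  obtains \<delta> where "\<delta> > 0" "\<And>u. \<bar>u\<bar> < \<delta> \<Longrightarrow> \<bar>\<phi> (1 + u) - deriv (deriv \<phi>) 1 / 2 * u\<^sup>2\<bar> \<le> \<kappa> * u\<^sup>2"
proof -
  define c where "c = deriv (deriv \<phi>) 1"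
  have phi1: "\<phi> 1 = 0" "deriv \<phi> 1 = 0" using phi by (auto simp: \<Phi>_def)
  obtain d1 where d1: "d1 > 0" "\<And>y. dist y 1 < d1 \<Longrightarrow> \<phi> differentiable (at y)"
    using phi unfolding \<Phi>_def eventually_nhds_metric by auto
  have "deriv \<phi> field_differentiable (at 1)"
    using phi by (simp add: \<Phi>_def field_differentiable_def real_differentiable_def)
  then have "(deriv \<phi> has_field_derivative c) (at 1)"
    unfolding c_def by (simp add: field_differentiable_derivI)
  then obtain d2 where d2: "d2 > 0"
     "\<And>y. norm (y - 1) < d2 \<Longrightarrow> norm (deriv \<phi> y - deriv \<phi> 1 - c * (y - 1)) \<le> \<kappa> * norm (y - 1)"
    using \<open>\<kappa> > 0\<close> unfolding has_field_derivative_def has_derivative_at_alt by blast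
  show thesis
  proof (rule that[of "min d1 d2"], goal_cases)
    case 1 then show ?case using d1 d2 by simp
  next
    case (2 u)
    let ?\<psi> = "\<lambda>v. \<phi> (1 + v) - c / 2 * v\<^sup>2"
    have "norm (?\<psi> u - ?\<psi> 0) \<le> (\<kappa> * \<bar>u\<bar>) * norm (u - 0)"
    proof (rule field_differentiable_bound[of "cball (0::real) \<bar>u\<bar>"])
      fix v :: real assume v: "v \<in> cball 0 \<bar>u\<bar>"
      then have "\<phi> differentiable (at (1 + v))" using 2 by (intro d1) (auto simp: dist_real_def)
      then have "(\<phi> has_field_derivative deriv \<phi> (1 + v)) (at (1 + v))"
        by (simp add: real_differentiable_def) (metis DERIV_imp_deriv)
      then have "(?\<psi> has_field_derivative (deriv \<phi> (1 + v) - c * v)) (at v)"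
        by (auto intro!: derivative_eq_intros DERIV_chain2[where f=\<phi>])
      then show "(?\<psi> has_field_derivative (deriv \<phi> (1 + v) - c * v)) (at v within cball 0 \<bar>u\<bar>)"
        by (rule has_field_derivative_at_within)
      have "norm (deriv \<phi> (1 + v) - c * v) \<le> \<kappa> * \<bar>v\<bar>"
        using d2(2)[of "1 + v"] v 2 phi1 by auto
      also have "\<dots> \<le> \<kappa> * \<bar>u\<bar>" using v \<open>\<kappa> > 0\<close> by auto
      finally show "norm (deriv \<phi> (1 + v) - c * v) \<le> \<kappa> * \<bar>u\<bar>" .
    qed auto
    then show ?case using phi1 by (simp add: c_def power2_eq_square mult.assoc)
  qed
qed

text \<open>For \<open>a\<close> and \<open>b\<close> the inner products of multiplier and estimating function at the estimator and at the
  null value, the first term is a summand of the test statistic. Only \<open>\<phi>''(1)\<close> matters, and it cancels.\<close>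

lemma \<Phi>_summand_expansion:
  assumes phi: "\<phi> \<in> \<Phi>" and "\<kappa> > 0"
  obtains \<delta> where "\<delta> > 0" "\<And>a b. \<bar>a\<bar> < \<delta> \<Longrightarrow> \<bar>b\<bar> < \<delta> \<Longrightarrow>
    \<bar>2 / deriv (deriv \<phi>) 1 * (1 / (1 + b) * \<phi> ((1 + b) / (1 + a))) - (a - b)\<^sup>2\<bar> \<le> \<kappa> * (a - b)\<^sup>2"
proof -
  define c where "c = deriv (deriv \<phi>) 1"
  have c: "c > 0" using phi by (simp add: \<Phi>_def c_def)
  \<comment> \<open>Chosen such that the error of the quadratic approximation, multiplied by \<open>2 / c\<close> and by a factor at most
    \<open>1 + \<kappa>\<close>, uses up one half of \<open>\<kappa>\<close>.\<close>
  define \<kappa>' where "\<kappa>' = c * \<kappa> / (4 * (1 + \<kappa>))"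
  have \<kappa>': "\<kappa>' > 0" "2 / c * \<kappa>' * (1 + \<kappa>) = \<kappa> / 2" using c \<open>\<kappa> > 0\<close> by (auto simp: \<kappa>'_def field_simps)
  obtain \<delta>0 where \<delta>0: "\<delta>0 > 0" "\<And>u. \<bar>u\<bar> < \<delta>0 \<Longrightarrow> \<bar>\<phi> (1 + u) - c / 2 * u\<^sup>2\<bar> \<le> \<kappa>' * u\<^sup>2"
    using \<Phi>_quadratic_at_1[OF phi \<kappa>'(1)] unfolding c_def by metis
  define q where "q = (\<lambda>p :: real \<times> real. 1 / ((1 + snd p) * (1 + fst p)\<^sup>2))"
  define w where "w = (\<lambda>p :: real \<times> real. (snd p - fst p) / (1 + fst p))"
  have "isCont q (0, 0)" unfolding q_def by (intro continuous_intros) auto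
  then have "(q \<longlongrightarrow> q (0, 0)) (nhds (0, 0))" unfolding isCont_def tendsto_at_iff_tendsto_nhds .
  moreover have "q (0, 0) = 1" by (simp add: q_def)
  ultimately have "(q \<longlongrightarrow> 1) (nhds (0, 0))" by simp
  then have 1: "\<forall>\<^sub>F p in nhds (0, 0). dist (q p) 1 < \<kappa> / 2" using \<open>\<kappa> > 0\<close> by (intro tendstoD) auto
  have "isCont w (0, 0)" unfolding w_def by (intro continuous_intros) auto
  then have "(w \<longlongrightarrow> w (0, 0)) (nhds (0, 0))" unfolding isCont_def tendsto_at_iff_tendsto_nhds .
  moreover have "w (0, 0) = 0" by (simp add: w_def)
  ultimately have "(w \<longlongrightarrow> 0) (nhds (0, 0))" by simp
  then have 2: "\<forall>\<^sub>F p in nhds (0, 0). dist (w p) 0 < \<delta>0" using \<delta>0 by (intro tendstoD) auto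
  obtain d where d: "d > 0" "\<And>p. dist p (0, 0) < d \<Longrightarrow> dist (q p) 1 < \<kappa> / 2 \<and> dist (w p) 0 < \<delta>0"
    using eventually_conj[OF 1 2] unfolding eventually_nhds_metric by blast
  show thesis
  proof (rule that[of "min (d / 2) 1"], goal_cases)
    case 1 then show ?case using d by simp
  next
    case (2 a b)
    have "dist (a, b) (0, 0) \<le> \<bar>a\<bar> + \<bar>b\<bar>" using norm_Pair_le[of a b] by (simp add: dist_norm flip: zero_prod_def)
    also have "\<dots> < d" using 2 by simp
    finally have d': "\<bar>q (a, b) - 1\<bar> < \<kappa> / 2" "\<bar>w (a, b)\<bar> < \<delta>0"
      using d(2)[of "(a, b)"] by (auto simp: dist_real_def)
    have pos: "1 + a > 0" "1 + b > 0" using 2 by auto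
    define u where "u = w (a, b)"
    define \<rho> where "\<rho> = \<phi> (1 + u) - c / 2 * u\<^sup>2"
    have \<rho>: "\<bar>\<rho>\<bar> \<le> \<kappa>' * u\<^sup>2" unfolding \<rho>_def u_def using \<delta>0(2) d'(2) by blast
    have ratio: "(1 + b) / (1 + a) = 1 + u" using pos by (simp add: u_def w_def field_simps)
    have u2: "1 / (1 + b) * u\<^sup>2 = q (a, b) * (a - b)\<^sup>2"
      using pos by (simp add: u_def w_def q_def power_divide power2_commute)
    have q1: "q (a, b) \<le> 1 + \<kappa>" using d'(1) \<open>\<kappa> > 0\<close> by linarith
    have "2 / c * (1 / (1 + b) * \<phi> ((1 + b) / (1 + a))) = 1 / (1 + b) * u\<^sup>2 + 2 / c * (1 / (1 + b) * \<rho>)"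
    proof -
      have "\<phi> (1 + u) = c / 2 * u\<^sup>2 + \<rho>" by (simp add: \<rho>_def)
      moreover have "2 / c * (k * (c / 2 * u\<^sup>2 + \<rho>)) = k * u\<^sup>2 + 2 / c * (k * \<rho>)" for k
        using c by (simp add: field_simps)
      ultimately show ?thesis unfolding ratio by (simp only:)
    qed
    then have "\<bar>2 / c * (1 / (1 + b) * \<phi> ((1 + b) / (1 + a))) - (a - b)\<^sup>2\<bar>
      = \<bar>(q (a, b) - 1) * (a - b)\<^sup>2 + 2 / c * (1 / (1 + b) * \<rho>)\<bar>"
      unfolding u2 by (simp add: algebra_simps)
    also have "\<dots> \<le> \<bar>q (a, b) - 1\<bar> * (a - b)\<^sup>2 + 2 / c * (1 / (1 + b) * \<bar>\<rho>\<bar>)"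
      using c pos by (intro order_trans[OF abs_triangle_ineq]) (simp add: abs_mult)
    also have "2 / c * (1 / (1 + b) * \<bar>\<rho>\<bar>) \<le> 2 / c * (1 / (1 + b) * (\<kappa>' * u\<^sup>2))"
      using c pos \<rho> by (intro mult_left_mono) auto
    also have "\<dots> = 2 / c * \<kappa>' * (1 / (1 + b) * u\<^sup>2)" by simp
    also have "\<dots> = 2 / c * \<kappa>' * q (a, b) * (a - b)\<^sup>2" unfolding u2 by simp
    also have "\<dots> \<le> 2 / c * \<kappa>' * (1 + \<kappa>) * (a - b)\<^sup>2"
      using q1 \<kappa>'(1) c by (intro mult_right_mono mult_left_mono) auto
    also have "\<bar>q (a, b) - 1\<bar> * (a - b)\<^sup>2 \<le> \<kappa> / 2 * (a - b)\<^sup>2"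
      using d'(1) by (intro mult_right_mono) auto
    also have "\<kappa> / 2 * (a - b)\<^sup>2 + 2 / c * \<kappa>' * (1 + \<kappa>) * (a - b)\<^sup>2 = \<kappa> * (a - b)\<^sup>2"
      unfolding \<kappa>'(2) by simp
    finally show ?case unfolding c_def by simp
  qed
qed

section \<open>Empirical second moments\<close>

definition outer :: "real^'m \<Rightarrow> real^'n \<Rightarrow> real^'n^'m" where
  "outer x y = (\<chi> i j. x $ i * y $ j)"

text \<open>All sample averages that are quadratic in the estimating functions are quadratic forms of this
  matrix, which makes their limits a matter of matrix convergence.\<close>

definition cross_moment :: "nat \<Rightarrow> (nat \<Rightarrow> real^'m) \<Rightarrow> (nat \<Rightarrow> real^'n) \<Rightarrow> real^'n^'m" where
  "cross_moment n u v = (1 / real n) *\<^sub>R (\<Sum>i<n. outer (u i) (v i))"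

lemma outer_mult_vector: "outer x y *v z = (y \<bullet> z) *\<^sub>R x"
  by (simp add: outer_def matrix_vector_mult_def vec_eq_iff inner_vec_def sum_distrib_left mult_ac)

lemma norm_outer: "norm (outer x y) = norm x * norm y"
proof -
  have "norm (outer x y) = L2_set (\<lambda>i. norm (x $ i) * norm y) UNIV"
    unfolding norm_vec_def[of "outer x y"]
  proof (rule arg_cong[where f="\<lambda>f. L2_set f UNIV"], rule ext)
    fix i
    have "outer x y $ i = x $ i *\<^sub>R y" by (simp add: outer_def vec_eq_iff)
    then show "norm (outer x y $ i) = norm (x $ i) * norm y" by simp
  qed
  also have "\<dots> = norm x * norm y" by (simp add: norm_vec_def[of x] L2_set_left_distrib)
  finally show ?thesis .
qed

lemma cross_moment_mult_vector:
  "cross_moment n u v *v z = (1 / real n) *\<^sub>R (\<Sum>i<n. (v i \<bullet> z) *\<^sub>R u i)"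
proof -
  have "(\<Sum>i<n. outer (u i) (v i)) *v z = (\<Sum>i<n. outer (u i) (v i) *v z)" for n
    by (induction n) (simp_all add: matrix_vector_mult_add_rdistrib)
  then show ?thesis
    by (simp add: cross_moment_def outer_mult_vector flip: scaleR_matrix_vector_assoc)
qed

lemma inner_cross_moment:
  "y \<bullet> (cross_moment n u v *v z) = (\<Sum>i<n. (u i \<bullet> y) * (v i \<bullet> z)) / real n"
  by (simp add: cross_moment_mult_vector inner_sum_right inner_commute[of y] mult.commute)

lemma mean_square_le_moment:
  fixes u :: "nat \<Rightarrow> real^'m"
  shows "(\<Sum>i<n. (norm (u i))\<^sup>2) / real n \<le> real CARD('m) * norm (cross_moment n u u)"
proof -
  have diag: "cross_moment n u u $ k $ k = (\<Sum>i<n. (u i $ k)\<^sup>2) / real n" for k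
    by (simp add: cross_moment_def outer_def power2_eq_square)
  have "(\<Sum>i<n. (norm (u i))\<^sup>2) = (\<Sum>i<n. \<Sum>k\<in>UNIV. (u i $ k)\<^sup>2)"
    unfolding power2_norm_eq_inner inner_vec_def by (simp add: power2_eq_square)
  also have "\<dots> = (\<Sum>k\<in>UNIV. \<Sum>i<n. (u i $ k)\<^sup>2)" by (rule sum.swap)
  finally have "(\<Sum>i<n. (norm (u i))\<^sup>2) / real n = (\<Sum>k\<in>UNIV. cross_moment n u u $ k $ k)"
    unfolding diag sum_divide_distrib[symmetric] by (rule arg_cong)
  also have "\<dots> \<le> (\<Sum>k\<in>(UNIV :: 'm set). norm (cross_moment n u u))"
  proof (rule sum_mono)
    fix k :: 'm
    have "cross_moment n u u $ k $ k \<le> norm (cross_moment n u u $ k $ k)" by simp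
    also have "\<dots> \<le> norm (cross_moment n u u $ k)" by (rule Finite_Cartesian_Product.norm_nth_le)
    also have "\<dots> \<le> norm (cross_moment n u u)" by (rule Finite_Cartesian_Product.norm_nth_le)
    finally show "cross_moment n u u $ k $ k \<le> norm (cross_moment n u u)" .
  qed
  finally show ?thesis by simp
qed

lemma cross_moment_perturbation:
  fixes a c :: "nat \<Rightarrow> real^'m" and b d :: "nat \<Rightarrow> real^'n"
  assumes "\<And>i. i < n \<Longrightarrow> norm (a i - c i) \<le> k i" "\<And>i. i < n \<Longrightarrow> norm (b i - d i) \<le> k i"
    and "\<And>i. i < n \<Longrightarrow> norm (c i) \<le> m" "\<And>i. i < n \<Longrightarrow> norm (b i) \<le> m"
  shows "norm (cross_moment n a b - cross_moment n c d) \<le> 2 * m * ((\<Sum>i<n. k i) / real n)"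
proof -
  have split: "outer (a i) (b i) - outer (c i) (d i) = outer (a i - c i) (b i) + outer (c i) (b i - d i)" for i
    by (simp add: outer_def vec_eq_iff algebra_simps)
  have "cross_moment n a b - cross_moment n c d
      = (1 / real n) *\<^sub>R (\<Sum>i<n. outer (a i - c i) (b i) + outer (c i) (b i - d i))"
    unfolding split[symmetric] by (simp add: cross_moment_def sum_subtractf scaleR_diff_right)
  also have "norm \<dots> \<le> (1 / real n) * (\<Sum>i<n. 2 * m * k i)"
    unfolding norm_scaleR
  proof (intro mult_mono sum_norm_le)
    fix i assume "i \<in> {..<n}"
    then have i: "i < n" by simp
    have "norm (outer (a i - c i) (b i) + outer (c i) (b i - d i))
       \<le> norm (a i - c i) * norm (b i) + norm (c i) * norm (b i - d i)"
      by (metis norm_triangle_ineq norm_outer)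
    also have "\<dots> \<le> k i * m + m * k i"
      using assms[OF i] by (intro add_mono mult_mono) (auto intro: order_trans[OF norm_ge_zero])
    finally show "norm (outer (a i - c i) (b i) + outer (c i) (b i - d i)) \<le> 2 * m * k i" by simp
  qed auto
  also have "\<dots> = 2 * m * ((\<Sum>i<n. k i) / real n)" by (simp flip: sum_distrib_left)
  finally show ?thesis .
qed

section \<open>The multiplier equation\<close>

text \<open>The constant 1/4, smaller than the Taylor coefficient 1/2, absorbs the cubic term.\<close>

lemma ln_one_plus_le_quadratic:
  fixes x :: real
  assumes "\<bar>x\<bar> \<le> 1 / 2"
  shows "ln (1 + x) \<le> x - x\<^sup>2 / 4"
proof -
  define f where "f = (\<lambda>x::real. x - x\<^sup>2 / 4 - ln (1 + x))"
  have deriv: "(f has_real_derivative (y * (1 - y) / (2 * (1 + y)))) (at y)" if "\<bar>y\<bar> \<le> 1 / 2" for y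
    unfolding f_def using that
    by (auto intro!: derivative_eq_intros simp: field_simps power2_eq_square)
  have "f 0 \<le> f x"
  proof (cases "x \<ge> 0")
    case True
    show ?thesis
    proof (rule DERIV_nonneg_imp_nondecreasing[OF True])
      fix y assume "0 \<le> y" "y \<le> x"
      then show "\<exists>z. (f has_real_derivative z) (at y) \<and> 0 \<le> z"
        using assms by (intro exI[of _ "y * (1 - y) / (2 * (1 + y))"] conjI deriv) auto
    qed
  next
    case False
    show ?thesis
    proof (rule DERIV_nonpos_imp_nonincreasing[of x 0])
      fix y assume y: "x \<le> y" "y \<le> 0"
      then show "\<exists>z. (f has_real_derivative z) (at y) \<and> z \<le> 0"
        using assms by (intro exI[of _ "y * (1 - y) / (2 * (1 + y))"] conjI deriv)
          (auto intro!: divide_nonpos_pos mult_nonpos_nonneg)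
    qed (use False in simp)
  qed
  then show ?thesis by (simp add: f_def)
qed

text \<open>The equation is the vanishing of the gradient of the concave function \<open>\<Sum> ln (1 + t \<bullet> v i)\<close>. On the ball
  of radius \<open>\<delta>\<close> all arguments of \<open>ln\<close> stay away from 0; on its boundary the function is negative,
  because the quadratic term dominates the linear one when the mean of the \<open>v i\<close> is small compared with
  \<open>\<delta>\<close>. As the function is 0 at the origin, its maximum over the ball is attained in the interior.\<close>

lemma multiplier_equation_solvable:
  fixes v :: "nat \<Rightarrow> real^'r"
  assumes "n > 0" and \<delta>: "\<delta> > 0" and small: "\<And>i. i < n \<Longrightarrow> \<delta> * norm (v i) \<le> 1 / 2"
    and coercive: "\<And>t. c * (norm t)\<^sup>2 \<le> (\<Sum>i<n. (t \<bullet> v i)\<^sup>2) / real n"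
    and mean: "norm (\<Sum>i<n. v i) / real n < c * \<delta> / 4"
  obtains \<tau> where "norm \<tau> < \<delta>" "(\<Sum>i<n. (1 / (1 + \<tau> \<bullet> v i)) *\<^sub>R v i) = 0"
    "\<And>i. i < n \<Longrightarrow> 1 + \<tau> \<bullet> v i \<ge> 1 / 2"
proof -
  define f where "f = (\<lambda>t. \<Sum>i<n. ln (1 + t \<bullet> v i))"
  have bound: "\<bar>t \<bullet> v i\<bar> \<le> 1 / 2" if "norm t \<le> \<delta>" "i < n" for t i
  proof -
    have "\<bar>t \<bullet> v i\<bar> \<le> norm t * norm (v i)" by (rule Cauchy_Schwarz_ineq2)
    also have "\<dots> \<le> \<delta> * norm (v i)" using that by (intro mult_right_mono) auto
    finally show ?thesis using small[OF that(2)] by simp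
  qed
  then have pos: "1 + t \<bullet> v i \<ge> 1 / 2" if "norm t \<le> \<delta>" "i < n" for t i
    using that by (smt (verit) field_sum_of_halves)
  have f_le: "f t \<le> real n * (norm t * (norm (\<Sum>i<n. v i) / real n) - c / 4 * (norm t)\<^sup>2)"
    if "norm t \<le> \<delta>" for t
  proof -
    have "f t \<le> (\<Sum>i<n. t \<bullet> v i - (t \<bullet> v i)\<^sup>2 / 4)"
      unfolding f_def using bound[OF that] by (intro sum_mono ln_one_plus_le_quadratic) auto
    also have "\<dots> = t \<bullet> (\<Sum>i<n. v i) - real n / 4 * ((\<Sum>i<n. (t \<bullet> v i)\<^sup>2) / real n)"
      using \<open>n > 0\<close> by (simp add: sum_subtractf inner_sum_right flip: sum_divide_distrib)
    also have "\<dots> \<le> norm t * norm (\<Sum>i<n. v i) - real n / 4 * (c * (norm t)\<^sup>2)"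
      using coercive by (intro diff_mono norm_cauchy_schwarz mult_left_mono) auto
    also have "\<dots> = real n * (norm t * (norm (\<Sum>i<n. v i) / real n) - c / 4 * (norm t)\<^sup>2)"
      using \<open>n > 0\<close> by (simp add: field_simps)
    finally show ?thesis .
  qed
  have "continuous_on (cball 0 \<delta>) f"
    unfolding f_def
  proof (intro continuous_intros)
    show "\<forall>t\<in>cball 0 \<delta>. 1 + t \<bullet> v i \<noteq> 0" if "i \<in> {..<n}" for i
      using pos that by (force simp: dist_norm)
  qed
  then obtain \<tau> where \<tau>: "\<tau> \<in> cball 0 \<delta>" "\<And>t. t \<in> cball 0 \<delta> \<Longrightarrow> f t \<le> f \<tau>"
    using continuous_attains_sup[of "cball 0 \<delta>" f] \<delta> by (metis compact_cball cball_eq_empty less_imp_le not_le)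
  have "f \<tau> \<ge> 0" using \<tau>(2)[of 0] \<delta> by (simp add: f_def)
  have "norm \<tau> \<noteq> \<delta>"
  proof
    assume eq: "norm \<tau> = \<delta>"
    have "norm \<tau> * (norm (\<Sum>i<n. v i) / real n) < \<delta> * (c * \<delta> / 4)"
      unfolding eq using mean \<delta> by (rule mult_strict_left_mono)
    then have "norm \<tau> * (norm (\<Sum>i<n. v i) / real n) - c / 4 * (norm \<tau>)\<^sup>2 < 0"
      by (simp add: eq power2_eq_square mult.left_commute)
    then have "f \<tau> < 0" using f_le[of \<tau>] eq \<open>n > 0\<close> by (smt (verit) mult_pos_neg of_nat_0_less_iff)
    then show False using \<open>f \<tau> \<ge> 0\<close> by simp
  qed
  then have less: "norm \<tau> < \<delta>" using \<tau>(1) by auto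
  have deriv: "(f has_derivative (\<lambda>h. \<Sum>i<n. (h \<bullet> v i) / (1 + \<tau> \<bullet> v i))) (at \<tau>)"
    unfolding f_def
  proof (rule has_derivative_sum)
    fix i assume "i \<in> {..<n}"
    then have "1 + \<tau> \<bullet> v i > 0" using pos[of \<tau> i] less by simp
    then show "((\<lambda>t. ln (1 + t \<bullet> v i)) has_derivative (\<lambda>h. (h \<bullet> v i) / (1 + \<tau> \<bullet> v i))) (at \<tau>)"
      by (auto intro!: derivative_eq_intros simp: divide_inverse)
  qed
  have "(\<lambda>h. \<Sum>i<n. (h \<bullet> v i) / (1 + \<tau> \<bullet> v i)) = (\<lambda>h. 0)"
    by (rule differential_zero_maxmin[OF _ open_ball deriv, of 0 \<delta>])
       (use less \<tau> in \<open>auto simp: less_imp_le\<close>)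
  then have "(\<Sum>i<n. (h \<bullet> v i) / (1 + \<tau> \<bullet> v i)) = 0" for h by metis
  then have "h \<bullet> (\<Sum>i<n. (1 / (1 + \<tau> \<bullet> v i)) *\<^sub>R v i) = 0" for h
    by (simp add: inner_sum_right)
  then have "(\<Sum>i<n. (1 / (1 + \<tau> \<bullet> v i)) *\<^sub>R v i) = 0" by (metis inner_eq_zero_iff)
  then show thesis using less pos[of \<tau>] that by simp
qed

lemma el_multiplier_positive:
  assumes "el_multiplier g n x \<theta> \<tau>" "i < n"
  shows "1 + \<tau> \<bullet> g (x i) \<theta> > 0"
proof -
  have "1 + \<tau> \<bullet> g (x i) \<theta> \<noteq> 0" "el_weight g n x \<theta> \<tau> i \<ge> 0"
    using assms by (auto simp: el_multiplier_def)
  then show ?thesis using assms(2) by (simp add: el_weight_def zero_le_mult_iff zero_le_divide_iff)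
qed

text \<open>Taking the inner product of the equation with \<open>\<tau>\<close> shows that the weights add up to 1.\<close>

lemma el_multiplierI:
  assumes "n > 0" and eq: "(\<Sum>i<n. (1 / (1 + \<tau> \<bullet> g (x i) \<theta>)) *\<^sub>R g (x i) \<theta>) = 0"
    and pos: "\<And>i. i < n \<Longrightarrow> 1 + \<tau> \<bullet> g (x i) \<theta> > 0"
  shows "el_multiplier g n x \<theta> \<tau>"
  unfolding el_multiplier_def
proof (intro conjI allI impI)
  have "(\<Sum>i<n. (\<tau> \<bullet> g (x i) \<theta>) / (1 + \<tau> \<bullet> g (x i) \<theta>)) = \<tau> \<bullet> (\<Sum>i<n. (1 / (1 + \<tau> \<bullet> g (x i) \<theta>)) *\<^sub>R g (x i) \<theta>)"
    by (simp add: inner_sum_right)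
  also have "\<dots> = 0" unfolding eq by simp
  finally have 0: "(\<Sum>i<n. (\<tau> \<bullet> g (x i) \<theta>) / (1 + \<tau> \<bullet> g (x i) \<theta>)) = 0" .
  have "(\<Sum>i<n. 1 / (1 + \<tau> \<bullet> g (x i) \<theta>)) = (\<Sum>i<n. 1 - (\<tau> \<bullet> g (x i) \<theta>) / (1 + \<tau> \<bullet> g (x i) \<theta>))"
  proof (rule sum.cong)
    fix i assume "i \<in> {..<n}"
    then show "1 / (1 + \<tau> \<bullet> g (x i) \<theta>) = 1 - (\<tau> \<bullet> g (x i) \<theta>) / (1 + \<tau> \<bullet> g (x i) \<theta>)"
      using pos[of i] by (simp add: field_simps)
  qed simp
  also have "\<dots> = real n" using 0 by (simp add: sum_subtractf)
  finally show "(\<Sum>i<n. el_weight g n x \<theta> \<tau> i) = 1"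
    using \<open>n > 0\<close> unfolding el_weight_def sum_distrib_left[symmetric] by simp
  show "el_weight g n x \<theta> \<tau> i \<ge> 0" if "i < n" for i
    using pos[OF that] by (simp add: el_weight_def)
qed (use eq pos in fastforce)+

text \<open>The difference of the two equations, multiplied by \<open>\<tau> - \<sigma>\<close>, is a sum of squares with positive weights.\<close>

lemma el_multiplier_unique:
  assumes \<tau>: "el_multiplier g n x \<theta> \<tau>" and \<sigma>: "el_multiplier g n x \<theta> \<sigma>" and "n > 0"
    and nondeg: "\<And>t. (\<Sum>i<n. (t \<bullet> g (x i) \<theta>)\<^sup>2) = 0 \<Longrightarrow> t = 0"
  shows "\<tau> = \<sigma>"
proof -
  let ?a = "\<lambda>i. 1 + \<tau> \<bullet> g (x i) \<theta>" and ?b = "\<lambda>i. 1 + \<sigma> \<bullet> g (x i) \<theta>"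
  let ?d = "\<lambda>i. (\<tau> - \<sigma>) \<bullet> g (x i) \<theta>"
  have eqs: "(\<Sum>i<n. (1 / ?a i) *\<^sub>R g (x i) \<theta>) = 0" "(\<Sum>i<n. (1 / ?b i) *\<^sub>R g (x i) \<theta>) = 0"
    using \<tau> \<sigma> \<open>n > 0\<close> by (auto simp: el_multiplier_def)
  have pos: "?a i > 0" "?b i > 0" if "i < n" for i
    using el_multiplier_positive[OF \<tau> that] el_multiplier_positive[OF \<sigma> that] .
  have "(\<Sum>i<n. (?d i)\<^sup>2 / (?a i * ?b i)) = (\<Sum>i<n. ?d i * (1 / ?b i) - ?d i * (1 / ?a i))"
  proof (rule sum.cong)
    fix i assume "i \<in> {..<n}"
    then have "i < n" by simp
    have "?d i * (1 / ?b i) - ?d i * (1 / ?a i) = ?d i * (?a i - ?b i) / (?a i * ?b i)"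
      using pos[OF \<open>i < n\<close>] by (simp add: field_simps)
    also have "?a i - ?b i = ?d i" by (simp add: inner_diff_left)
    finally show "(?d i)\<^sup>2 / (?a i * ?b i) = ?d i * (1 / ?b i) - ?d i * (1 / ?a i)"
      by (simp add: power2_eq_square)
  qed simp
  also have "\<dots> = (\<tau> - \<sigma>) \<bullet> (\<Sum>i<n. (1 / ?b i) *\<^sub>R g (x i) \<theta>) - (\<tau> - \<sigma>) \<bullet> (\<Sum>i<n. (1 / ?a i) *\<^sub>R g (x i) \<theta>)"
    unfolding inner_sum_right sum_subtractf[symmetric] by (intro sum.cong) (simp_all add: mult.commute)
  also have "\<dots> = 0" unfolding eqs by simp
  finally have sum0: "(\<Sum>i<n. (?d i)\<^sup>2 / (?a i * ?b i)) = 0" .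
  have "(?d i)\<^sup>2 / (?a i * ?b i) = 0" if "i < n" for i
  proof -
    have "\<forall>i\<in>{..<n}. (?d i)\<^sup>2 / (?a i * ?b i) = 0"
      using sum0 pos by (subst (asm) sum_nonneg_eq_0_iff) (auto simp: less_imp_le)
    then show ?thesis using that by simp
  qed
  then have "?d i = 0" if "i < n" for i using pos[OF that] that by fastforce
  then have "\<tau> - \<sigma> = 0" by (intro nondeg) simp
  then show ?thesis by simp
qed

text \<open>Uses \<open>1 / (1 + a) = 1 - a + a\<^sup>2 / (1 + a)\<close> with \<open>a = \<tau> \<bullet> u i\<close>: the first two terms give the linear equation for
  \<open>\<alpha>\<close>, the last one the error.\<close>

lemma multiplier_remainder:
  fixes u :: "nat \<Rightarrow> real^'r"
  assumes "n > 0" and small: "\<And>i. i < n \<Longrightarrow> norm (u i) \<le> m * sqrt (real n)"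
    and \<alpha>: "\<alpha> = sqrt (real n) *\<^sub>R \<tau>" and half: "norm \<alpha> * m \<le> 1 / 2"
    and eq: "(\<Sum>i<n. (1 / (1 + \<tau> \<bullet> u i)) *\<^sub>R u i) = 0"
  shows "norm ((\<Sum>i<n. u i) /\<^sub>R sqrt (real n) - cross_moment n u u *v \<alpha>)
    \<le> 2 * m * (norm \<alpha>)\<^sup>2 * (real CARD('r) * norm (cross_moment n u u))"
proof -
  have sq: "sqrt (real n) > 0" "sqrt (real n) * sqrt (real n) = real n" using \<open>n > 0\<close> by auto
  have \<tau>: "norm \<tau> = norm \<alpha> / sqrt (real n)" using sq by (simp add: \<alpha>)
  have a: "\<bar>\<tau> \<bullet> u i\<bar> \<le> norm \<alpha> * m" if "i < n" for i
  proof -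
    have "\<bar>\<tau> \<bullet> u i\<bar> \<le> norm \<tau> * norm (u i)" by (rule Cauchy_Schwarz_ineq2)
    also have "\<dots> \<le> norm \<tau> * (m * sqrt (real n))" using small[OF that] by (intro mult_left_mono) auto
    also have "\<dots> = norm \<alpha> * m" using sq by (simp add: \<tau>)
    finally show ?thesis .
  qed
  have m: "m \<ge> 0" using small[OF \<open>n > 0\<close>] norm_ge_zero[of "u 0"] sq(1)
    by (meson order_trans zero_le_mult_iff not_less)
  let ?r = "\<lambda>i. ((\<tau> \<bullet> u i)\<^sup>2 / (1 + \<tau> \<bullet> u i)) *\<^sub>R u i"
  have split: "u i = (\<tau> \<bullet> u i) *\<^sub>R u i - ?r i + (1 / (1 + \<tau> \<bullet> u i)) *\<^sub>R u i" if "i < n" for i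
  proof -
    have "1 + \<tau> \<bullet> u i \<noteq> 0" using a[OF that] half by linarith
    then have "1 = (\<tau> \<bullet> u i) - (\<tau> \<bullet> u i)\<^sup>2 / (1 + \<tau> \<bullet> u i) + 1 / (1 + \<tau> \<bullet> u i)"
      by (simp add: field_simps power2_eq_square)
    then have "1 *\<^sub>R u i = ((\<tau> \<bullet> u i) - (\<tau> \<bullet> u i)\<^sup>2 / (1 + \<tau> \<bullet> u i) + 1 / (1 + \<tau> \<bullet> u i)) *\<^sub>R u i"
      by (rule arg_cong)
    then show ?thesis by (simp add: scaleR_add_left scaleR_diff_left)
  qed
  have "(\<Sum>i<n. u i) = (\<Sum>i<n. (\<tau> \<bullet> u i) *\<^sub>R u i - ?r i + (1 / (1 + \<tau> \<bullet> u i)) *\<^sub>R u i)"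
    by (rule sum.cong) (use split in auto)
  also have "\<dots> = (\<Sum>i<n. (\<tau> \<bullet> u i) *\<^sub>R u i) - (\<Sum>i<n. ?r i)"
    by (simp add: sum.distrib sum_subtractf eq)
  finally have "(\<Sum>i<n. u i) /\<^sub>R sqrt (real n) - cross_moment n u u *v \<alpha> = - ((\<Sum>i<n. ?r i) /\<^sub>R sqrt (real n))"
  proof -
    have "cross_moment n u u *v \<alpha> = (\<Sum>i<n. (\<tau> \<bullet> u i) *\<^sub>R u i) /\<^sub>R sqrt (real n)"
      unfolding cross_moment_mult_vector \<alpha>
      using sq by (simp add: inner_commute[of _ \<tau>] divide_inverse real_sqrt_mult_self
        flip: scaleR_scaleR) (simp add: scaleR_right.sum[symmetric] flip: scaleR_scaleR, simp add: divide_simps)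
    then show "(\<Sum>i<n. u i) = (\<Sum>i<n. (\<tau> \<bullet> u i) *\<^sub>R u i) - (\<Sum>i<n. ?r i) \<Longrightarrow> ?thesis"
      by (simp add: scaleR_diff_right)
  qed
  also have "norm \<dots> = norm (\<Sum>i<n. ?r i) / sqrt (real n)" by (simp add: divide_inverse_commute)
  also have "\<dots> \<le> (\<Sum>i<n. 2 * (norm \<alpha> * m) * norm \<tau> * (norm (u i))\<^sup>2) / sqrt (real n)"
  proof (intro divide_right_mono sum_norm_le)
    fix i assume "i \<in> {..<n}"
    then have i: "i < n" by simp
    have pos: "1 + \<tau> \<bullet> u i \<ge> 1 / 2" using a[OF i] half by linarith
    have "norm (?r i) = \<bar>\<tau> \<bullet> u i\<bar> * \<bar>\<tau> \<bullet> u i\<bar> * norm (u i) / (1 + \<tau> \<bullet> u i)"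
      using pos by (simp add: power2_eq_square abs_mult)
    also have "\<dots> \<le> (norm \<alpha> * m) * (norm \<tau> * norm (u i)) * norm (u i) / (1 / 2)"
      using pos a[OF i] m
      by (intro frac_le mult_mono Cauchy_Schwarz_ineq2) auto
    finally show "norm (?r i) \<le> 2 * (norm \<alpha> * m) * norm \<tau> * (norm (u i))\<^sup>2"
      by (simp add: power2_eq_square mult_ac)
  qed simp
  also have "\<dots> = 2 * m * (norm \<alpha>)\<^sup>2 * ((\<Sum>i<n. (norm (u i))\<^sup>2) / real n)"
    unfolding sum_distrib_left[symmetric] \<tau> using sq by (simp add: power2_eq_square field_simps)
  also have "\<dots> \<le> 2 * m * (norm \<alpha>)\<^sup>2 * (real CARD('r) * norm (cross_moment n u u))"
    using m by (intro mult_left_mono mean_square_le_moment) auto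
  finally show ?thesis .
qed

section \<open>Taylor expansion of the estimating functions\<close>

lemma G_has_derivative:
  assumes "g x differentiable (at \<theta>)"
  shows "(g x has_derivative (\<lambda>h. G g x \<theta> *v h)) (at \<theta>)"
  using assms unfolding G_def jacobian_works .

lemma estimating_function_lipschitz:
  assumes "\<theta> \<in> ball \<theta>0 r"
    and diff: "\<And>\<theta>. \<theta> \<in> ball \<theta>0 r \<Longrightarrow> g x differentiable (at \<theta>)"
    and bound: "\<And>\<theta>. \<theta> \<in> ball \<theta>0 r \<Longrightarrow> norm (G g x \<theta>) \<le> K"
  shows "norm (g x \<theta> - g x \<theta>0) \<le> K * norm (\<theta> - \<theta>0)"
proof (rule differentiable_bound[of "ball \<theta>0 r"])
  show "(g x has_derivative (\<lambda>h. G g x \<theta> *v h)) (at \<theta> within ball \<theta>0 r)" if "\<theta> \<in> ball \<theta>0 r" for \<theta>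
    using G_has_derivative[where g=g and x=x, OF diff[OF that]] by (rule has_derivative_at_withinI)
  show "onorm (\<lambda>h. G g x \<theta> *v h) \<le> K" if "\<theta> \<in> ball \<theta>0 r" for \<theta>
  proof (rule onorm_bound)
    show "0 \<le> K" using bound[OF that] norm_ge_zero order_trans by blast
    show "norm (G g x \<theta> *v h) \<le> K * norm h" for h
      using norm_matrix_vector_mult_le[of "G g x \<theta>" h] bound[OF that]
      by (meson mult_right_mono norm_ge_zero order_trans)
  qed
  have "0 \<le> dist \<theta>0 \<theta>" by simp
  also have "\<dots> < r" using assms(1) by simp
  finally show "\<theta>0 \<in> ball \<theta>0 r" by simp
qed (use assms(1) in auto)

lemma frechet_derivative_G_bound:
  fixes g :: "real^'k \<Rightarrow> real^'p \<Rightarrow> real^'r"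
  assumes "G g x differentiable (at \<theta>)"
  shows "norm (frechet_derivative (G g x) (at \<theta>) h) \<le> real CARD('p) * norm (dG g x \<theta>) * norm h"
proof -
  let ?D = "frechet_derivative (G g x) (at \<theta>)"
  have lin: "linear ?D"
    using assms frechet_derivative_works has_derivative_linear by blast
  have "?D h = ?D (\<Sum>l\<in>UNIV. (h $ l) *\<^sub>R axis l 1)"
    using basis_expansion[of h] by (simp add: scalar_mult_eq_scaleR)
  also have "\<dots> = (\<Sum>l\<in>UNIV. (h $ l) *\<^sub>R dG g x \<theta> $ l)"
    by (simp add: linear_sum[OF lin] linear_scale[OF lin] dG_def)
  also have "norm \<dots> \<le> (\<Sum>l\<in>(UNIV :: 'p set). norm h * norm (dG g x \<theta>))"
  proof (rule sum_norm_le)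
    fix l :: 'p
    have "norm ((h $ l) *\<^sub>R dG g x \<theta> $ l) = norm (h $ l) * norm (dG g x \<theta> $ l)" by simp
    also have "\<dots> \<le> norm h * norm (dG g x \<theta>)"
      by (intro mult_mono Finite_Cartesian_Product.norm_nth_le) auto
    finally show "norm ((h $ l) *\<^sub>R dG g x \<theta> $ l) \<le> norm h * norm (dG g x \<theta>)" .
  qed
  finally show ?thesis by (simp add: mult_ac)
qed

text \<open>The factor \<open>CARD('p)\<close> comes from bounding the operator norm of the derivative by its partial derivatives.\<close>

lemma jacobian_lipschitz:
  fixes g :: "real^'k \<Rightarrow> real^'p \<Rightarrow> real^'r"
  assumes "\<theta> \<in> ball \<theta>0 r"
    and diff: "\<And>\<theta>. \<theta> \<in> ball \<theta>0 r \<Longrightarrow> G g x differentiable (at \<theta>)"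
    and bound: "\<And>\<theta>. \<theta> \<in> ball \<theta>0 r \<Longrightarrow> norm (dG g x \<theta>) \<le> K"
  shows "norm (G g x \<theta> - G g x \<theta>0) \<le> real CARD('p) * K * norm (\<theta> - \<theta>0)"
proof (rule differentiable_bound[of "ball \<theta>0 r"])
  show "(G g x has_derivative frechet_derivative (G g x) (at \<theta>)) (at \<theta> within ball \<theta>0 r)"
    if "\<theta> \<in> ball \<theta>0 r" for \<theta>
    using diff[OF that] frechet_derivative_works has_derivative_at_withinI by blast
  show "onorm (frechet_derivative (G g x) (at \<theta>)) \<le> real CARD('p) * K" if "\<theta> \<in> ball \<theta>0 r" for \<theta>
  proof (rule onorm_bound)
    have "0 \<le> K" using bound[OF that] norm_ge_zero order_trans by blast
    then show "0 \<le> real CARD('p) * K" by simp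
    fix h :: "real^'p"
    have "real CARD('p) * norm (dG g x \<theta>) * norm h \<le> real CARD('p) * K * norm h"
      using bound[OF that] by (intro mult_right_mono mult_left_mono) auto
    then show "norm (frechet_derivative (G g x) (at \<theta>) h) \<le> real CARD('p) * K * norm h"
      using frechet_derivative_G_bound[OF diff[OF that], of h] by linarith
  qed
  have "0 \<le> dist \<theta>0 \<theta>" by simp
  also have "\<dots> < r" using assms(1) by simp
  finally show "\<theta>0 \<in> ball \<theta>0 r" by simp
qed (use assms(1) in auto)

lemma estimating_function_taylor:
  fixes g :: "real^'k \<Rightarrow> real^'p \<Rightarrow> real^'r"
  assumes \<theta>: "\<theta> \<in> ball \<theta>0 r"
    and diff: "\<And>\<theta>. \<theta> \<in> ball \<theta>0 r \<Longrightarrow> g x differentiable (at \<theta>)"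
    and diff2: "\<And>\<theta>. \<theta> \<in> ball \<theta>0 r \<Longrightarrow> G g x differentiable (at \<theta>)"
    and bound: "\<And>\<theta>. \<theta> \<in> ball \<theta>0 r \<Longrightarrow> norm (dG g x \<theta>) \<le> K"
  shows "norm (g x \<theta> - g x \<theta>0 - G g x \<theta>0 *v (\<theta> - \<theta>0)) \<le> real CARD('p) * K * (norm (\<theta> - \<theta>0))\<^sup>2"
proof -
  define \<rho> where "\<rho> = norm (\<theta> - \<theta>0)"
  have sub: "cball \<theta>0 \<rho> \<subseteq> ball \<theta>0 r"
    using \<theta> by (auto simp: \<rho>_def dist_norm norm_minus_commute)
  have K: "K \<ge> 0" using bound[OF \<theta>] norm_ge_zero order_trans by blast
  let ?f = "\<lambda>\<theta>. g x \<theta> - G g x \<theta>0 *v \<theta>"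
  have "norm (?f \<theta> - ?f \<theta>0) \<le> (real CARD('p) * K * \<rho>) * norm (\<theta> - \<theta>0)"
  proof (rule differentiable_bound[of "cball \<theta>0 \<rho>" ?f "\<lambda>\<xi> h. (G g x \<xi> - G g x \<theta>0) *v h"])
    fix \<xi> assume \<xi>: "\<xi> \<in> cball \<theta>0 \<rho>"
    then have \<xi>': "\<xi> \<in> ball \<theta>0 r" using sub by blast
    have "(?f has_derivative (\<lambda>h. G g x \<xi> *v h - G g x \<theta>0 *v h)) (at \<xi>)"
      by (intro has_derivative_diff G_has_derivative diff \<xi>'
          bounded_linear_imp_has_derivative matrix_vector_mul_bounded_linear)
    then show "(?f has_derivative (\<lambda>h. (G g x \<xi> - G g x \<theta>0) *v h)) (at \<xi> within cball \<theta>0 \<rho>)"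
      unfolding matrix_vector_mult_diff_rdistrib by (rule has_derivative_at_withinI)
    have "norm (G g x \<xi> - G g x \<theta>0) \<le> real CARD('p) * K * norm (\<xi> - \<theta>0)"
      by (rule jacobian_lipschitz[OF \<xi>' diff2 bound])
    also have "\<dots> \<le> real CARD('p) * K * \<rho>"
      using \<xi> K by (intro mult_left_mono) (auto simp: dist_norm norm_minus_commute)
    finally have le: "norm (G g x \<xi> - G g x \<theta>0) \<le> real CARD('p) * K * \<rho>" .
    show "onorm (\<lambda>h. (G g x \<xi> - G g x \<theta>0) *v h) \<le> real CARD('p) * K * \<rho>"
    proof (rule onorm_bound)
      show "0 \<le> real CARD('p) * K * \<rho>" using K by (simp add: \<rho>_def)
      show "norm ((G g x \<xi> - G g x \<theta>0) *v h) \<le> real CARD('p) * K * \<rho> * norm h" for h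
        using norm_matrix_vector_mult_le[of "G g x \<xi> - G g x \<theta>0" h] le
        by (meson mult_right_mono norm_ge_zero order_trans)
    qed
  qed (auto simp: \<rho>_def dist_norm norm_minus_commute)
  then show ?thesis
    by (simp add: \<rho>_def power2_eq_square matrix_vector_mult_diff_distrib algebra_simps)
qed

section \<open>Expansion of the test statistic along a filter\<close>

interpretation matvec: bounded_bilinear "(*v) :: real^'n^'m \<Rightarrow> real^'n \<Rightarrow> real^'m"
  by (rule bounded_bilinear_matrix_vector_mult)

lemma multiplier_products_negligible:
  assumes small: "\<forall>\<^sub>F j in H. \<forall>i<N j. norm (u j i) \<le> m j * sqrt (real (N j))" and m: "(m \<longlongrightarrow> 0) H"
    and \<tau>: "Bfun (\<lambda>j. sqrt (real (N j)) *\<^sub>R \<tau> j) H" and "\<eta> > (0::real)"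
  shows "\<forall>\<^sub>F j in H. \<forall>i<N j. \<bar>\<tau> j \<bullet> u j i\<bar> < \<eta>"
proof -
  have "((\<lambda>j. norm (sqrt (real (N j)) *\<^sub>R \<tau> j) * m j) \<longlongrightarrow> 0) H"
    by (rule bounded_bilinear.Bfun_tendsto_zero[OF bounded_bilinear_mult Bfun_norm[OF \<tau>] m])
  then have "\<forall>\<^sub>F j in H. norm (sqrt (real (N j)) *\<^sub>R \<tau> j) * m j < \<eta>"
    using \<open>\<eta> > 0\<close> by (rule order_tendstoD(2))
  then show ?thesis
    using small
  proof eventually_elim
    case (elim j)
    show ?case
    proof (intro allI impI)
      fix i assume i: "i < N j"
      have "\<bar>\<tau> j \<bullet> u j i\<bar> \<le> norm (\<tau> j) * norm (u j i)" by (rule Cauchy_Schwarz_ineq2)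
      also have "\<dots> \<le> norm (\<tau> j) * (m j * sqrt (real (N j)))"
        using elim(2) i by (intro mult_left_mono) auto
      also have "\<dots> = norm (sqrt (real (N j)) *\<^sub>R \<tau> j) * m j" by simp
      finally show "\<bar>\<tau> j \<bullet> u j i\<bar> < \<eta>" using elim(1) by simp
    qed
  qed
qed

text \<open>The error bound of \<open>multiplier_remainder\<close> is \<open>m\<close> times factors that are bounded along the filter.\<close>

lemma multiplier_linearization:
  fixes u :: "'i \<Rightarrow> nat \<Rightarrow> real^'r"
  assumes pos: "\<forall>\<^sub>F j in H. N j > 0"
    and small: "\<forall>\<^sub>F j in H. \<forall>i<N j. norm (u j i) \<le> m j * sqrt (real (N j))" and m: "(m \<longlongrightarrow> 0) H"
    and M: "((\<lambda>j. cross_moment (N j) (u j) (u j)) \<longlongrightarrow> S) H"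
    and \<tau>: "Bfun (\<lambda>j. sqrt (real (N j)) *\<^sub>R \<tau> j) H"
    and eq: "\<forall>\<^sub>F j in H. (\<Sum>i<N j. (1 / (1 + \<tau> j \<bullet> u j i)) *\<^sub>R u j i) = 0"
  shows "((\<lambda>j. (\<Sum>i<N j. u j i) /\<^sub>R sqrt (real (N j)) - S *v (sqrt (real (N j)) *\<^sub>R \<tau> j)) \<longlongrightarrow> 0) H"
proof -
  define \<alpha> where "\<alpha> j = sqrt (real (N j)) *\<^sub>R \<tau> j" for j
  define M' where "M' j = cross_moment (N j) (u j) (u j)" for j
  have b\<alpha>: "Bfun \<alpha> H" using \<tau> by (simp add: \<alpha>_def[abs_def])
  have M'lim: "(M' \<longlongrightarrow> S) H" using M by (simp add: M'_def[abs_def])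
  have b\<alpha>2: "Bfun (\<lambda>j. norm (\<alpha> j) * norm (\<alpha> j)) H"
    by (intro bounded_bilinear.Bfun_prod[OF bounded_bilinear_mult] Bfun_norm b\<alpha>)
  have bM: "Bfun (\<lambda>j. real CARD('r) * norm (M' j)) H"
    by (intro bounded_bilinear.Bfun_prod[OF bounded_bilinear_mult] Bfun_const Bfun_norm tendsto_imp_Bfun[OF M'lim])
  have "((\<lambda>j. norm (\<alpha> j) * m j) \<longlongrightarrow> 0) H"
    by (rule bounded_bilinear.Bfun_tendsto_zero[OF bounded_bilinear_mult Bfun_norm[OF b\<alpha>] m])
  then have half: "\<forall>\<^sub>F j in H. norm (\<alpha> j) * m j < 1 / 2" by (rule order_tendstoD(2)) simp
  have "((\<lambda>j. (\<Sum>i<N j. u j i) /\<^sub>R sqrt (real (N j)) - M' j *v \<alpha> j) \<longlongrightarrow> 0) H"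
  proof (rule Lim_null_comparison)
    show "\<forall>\<^sub>F j in H. norm ((\<Sum>i<N j. u j i) /\<^sub>R sqrt (real (N j)) - M' j *v \<alpha> j)
        \<le> 2 * (m j * ((norm (\<alpha> j) * norm (\<alpha> j)) * (real CARD('r) * norm (M' j))))"
      using pos small half eq
    proof eventually_elim
      case (elim j)
      then show ?case
        using multiplier_remainder[of "N j" "u j" "m j" "\<alpha> j" "\<tau> j"]
        by (simp add: M'_def \<alpha>_def power2_eq_square mult_ac)
    qed
    have "((\<lambda>j. m j * ((norm (\<alpha> j) * norm (\<alpha> j)) * (real CARD('r) * norm (M' j)))) \<longlongrightarrow> 0) H"
      by (intro bounded_bilinear.tendsto_zero_Bfun[OF bounded_bilinear_mult m]
          bounded_bilinear.Bfun_prod[OF bounded_bilinear_mult] b\<alpha>2 bM)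
    then show "((\<lambda>j. 2 * (m j * ((norm (\<alpha> j) * norm (\<alpha> j)) * (real CARD('r) * norm (M' j))))) \<longlongrightarrow> 0) H"
      by (rule tendsto_mult_right_zero)
  qed
  moreover have "((\<lambda>j. (M' j - S) *v \<alpha> j) \<longlongrightarrow> 0) H"
    using M'lim b\<alpha> by (intro matvec.tendsto_zero_Bfun) (simp add: LIM_zero)
  ultimately have "((\<lambda>j. ((\<Sum>i<N j. u j i) /\<^sub>R sqrt (real (N j)) - M' j *v \<alpha> j) + (M' j - S) *v \<alpha> j) \<longlongrightarrow> 0 + 0) H"
    by (rule tendsto_add)
  then show ?thesis by (simp add: matrix_vector_mult_diff_rdistrib \<alpha>_def)
qed

text \<open>Expanding the squares gives three quadratic forms, whose matrices have the same limit \<open>S\<close>.\<close>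

lemma sum_square_differences_limit:
  fixes u v :: "'i \<Rightarrow> nat \<Rightarrow> real^'r"
  assumes pos: "\<forall>\<^sub>F j in H. N j > 0" and sym: "transpose S = S"
    and uu: "((\<lambda>j. cross_moment (N j) (u j) (u j)) \<longlongrightarrow> S) H"
    and uv: "((\<lambda>j. cross_moment (N j) (u j) (v j)) \<longlongrightarrow> S) H"
    and vv: "((\<lambda>j. cross_moment (N j) (v j) (v j)) \<longlongrightarrow> S) H"
    and \<alpha>: "Bfun (\<lambda>j. sqrt (real (N j)) *\<^sub>R \<tau> j) H"
    and \<beta>: "Bfun (\<lambda>j. sqrt (real (N j)) *\<^sub>R \<sigma> j) H"
  shows "((\<lambda>j. (\<Sum>i<N j. (\<tau> j \<bullet> u j i - \<sigma> j \<bullet> v j i)\<^sup>2)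
     - (sqrt (real (N j)) *\<^sub>R (\<tau> j - \<sigma> j)) \<bullet> (S *v (sqrt (real (N j)) *\<^sub>R (\<tau> j - \<sigma> j)))) \<longlongrightarrow> 0) H"
proof -
  define a where "a j = sqrt (real (N j)) *\<^sub>R \<tau> j" for j
  define b where "b j = sqrt (real (N j)) *\<^sub>R \<sigma> j" for j
  have ab: "Bfun a H" "Bfun b H" using \<alpha> \<beta> by (simp_all add: a_def[abs_def] b_def[abs_def])
  have lim: "((\<lambda>j. y j \<bullet> ((cross_moment (N j) (f j) (h j) - S) *v z j)) \<longlongrightarrow> 0) H"
    if "((\<lambda>j. cross_moment (N j) (f j) (h j)) \<longlongrightarrow> S) H" "Bfun y H" "Bfun z H"
    for f h :: "'i \<Rightarrow> nat \<Rightarrow> real^'r" and y z :: "'i \<Rightarrow> real^'r"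
    using that by (intro bounded_bilinear.Bfun_tendsto_zero[OF bounded_bilinear_inner]
        matvec.tendsto_zero_Bfun) (simp_all add: LIM_zero)
  let ?E = "\<lambda>j. a j \<bullet> ((cross_moment (N j) (u j) (u j) - S) *v a j)
    - 2 * (a j \<bullet> ((cross_moment (N j) (u j) (v j) - S) *v b j))
    + b j \<bullet> ((cross_moment (N j) (v j) (v j) - S) *v b j)"
  have "(?E \<longlongrightarrow> 0 - 2 * 0 + 0) H"
    by (intro tendsto_intros lim uu uv vv ab)
  then have "(?E \<longlongrightarrow> 0) H" by simp
  moreover have "\<forall>\<^sub>F j in H. ?E j = (\<Sum>i<N j. (\<tau> j \<bullet> u j i - \<sigma> j \<bullet> v j i)\<^sup>2)
     - (sqrt (real (N j)) *\<^sub>R (\<tau> j - \<sigma> j)) \<bullet> (S *v (sqrt (real (N j)) *\<^sub>R (\<tau> j - \<sigma> j)))"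
    using pos
  proof eventually_elim
    case (elim j)
    have scaled: "(sqrt (real (N j)) *\<^sub>R y) \<bullet> (cross_moment (N j) f h *v (sqrt (real (N j)) *\<^sub>R z))
       = (\<Sum>i<N j. (y \<bullet> f i) * (z \<bullet> h i))" for y z :: "real^'r" and f h
    proof -
      have "(sqrt (real (N j)) *\<^sub>R y) \<bullet> (cross_moment (N j) f h *v (sqrt (real (N j)) *\<^sub>R z))
         = (sqrt (real (N j)) * sqrt (real (N j))) * (y \<bullet> (cross_moment (N j) f h *v z))"
        by (simp add: matrix_vector_mult_scaleR)
      then show ?thesis using elim by (simp add: inner_cross_moment inner_commute)
    qed
    have square: "(y - z)\<^sup>2 = y * y - 2 * (y * z) + z * z" for y z :: real
      by (simp add: power2_eq_square algebra_simps)
    have 1: "(\<Sum>i<N j. (\<tau> j \<bullet> u j i - \<sigma> j \<bullet> v j i)\<^sup>2)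
      = a j \<bullet> (cross_moment (N j) (u j) (u j) *v a j) - 2 * (a j \<bullet> (cross_moment (N j) (u j) (v j) *v b j))
        + b j \<bullet> (cross_moment (N j) (v j) (v j) *v b j)"
      unfolding a_def b_def scaled
      by (simp only: square sum.distrib sum_subtractf sum_distrib_left)
    have 2: "sqrt (real (N j)) *\<^sub>R (\<tau> j - \<sigma> j) = a j - b j" by (simp add: a_def b_def scaleR_diff_right)
    have 3: "b j \<bullet> (S *v a j) = a j \<bullet> (S *v b j)"
      using inner_matrix_vector_symmetric[OF sym] by (metis inner_commute)
    show ?case
      unfolding 1 2 by (simp add: matrix_vector_mult_diff_rdistrib matrix_vector_mult_diff_distrib
          inner_diff_left inner_diff_right 3 algebra_simps)
  qed
  ultimately show ?thesis by (rule Lim_transform_eventually)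
qed

text \<open>Applied to the estimating functions at the null value: a multiplier of order \<open>1 / \<surd>n\<close> exists, and by the
  second conclusion it is the only one (\<open>el_multiplier_unique\<close>). Both hold because the empirical second
  moment is eventually bounded below by half of the lower bound of \<open>S\<close>.\<close>

lemma null_multiplier_bounded:
  fixes u :: "'i \<Rightarrow> nat \<Rightarrow> real^'r"
  assumes N: "filterlim N sequentially H" and S: "positive_definite S"
    and small: "\<forall>\<^sub>F j in H. \<forall>i<N j. norm (u j i) \<le> m j * sqrt (real (N j))" and m: "(m \<longlongrightarrow> 0) H"
    and M: "((\<lambda>j. cross_moment (N j) (u j) (u j)) \<longlongrightarrow> S) H"
    and score: "Bfun (\<lambda>j. (\<Sum>i<N j. u j i) /\<^sub>R sqrt (real (N j))) H"
  obtains L where "\<forall>\<^sub>F j in H. \<exists>\<tau>. norm (sqrt (real (N j)) *\<^sub>R \<tau>) \<le> L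
      \<and> (\<Sum>i<N j. (1 / (1 + \<tau> \<bullet> u j i)) *\<^sub>R u j i) = 0 \<and> (\<forall>i<N j. 1 + \<tau> \<bullet> u j i > 0)"
    and "\<forall>\<^sub>F j in H. \<forall>t. (\<Sum>i<N j. (t \<bullet> u j i)\<^sup>2) = 0 \<longrightarrow> t = 0"
proof -
  obtain c where c: "c > 0" "\<And>v. c * (norm v)\<^sup>2 \<le> v \<bullet> (S *v v)"
    using positive_definite_coercive[OF S] by blast
  obtain K where K: "K > 0" "\<forall>\<^sub>F j in H. norm ((\<Sum>i<N j. u j i) /\<^sub>R sqrt (real (N j))) \<le> K"
    using score by (rule BfunE)
  \<comment> \<open>Large enough for the quadratic term to dominate the linear one at radius \<open>L / \<surd>n\<close>.\<close>
  define L where "L = 8 * K / c + 1"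
  have L: "L > 0" "K < c / 2 * L / 4" using c K by (auto simp: L_def field_simps add_pos_pos)
  have pos: "\<forall>\<^sub>F j in H. N j > 0"
    using N by (rule eventually_compose_filterlim[OF eventually_gt_at_top])
  have "\<forall>\<^sub>F j in H. dist (cross_moment (N j) (u j) (u j)) S < c / 2"
    using M c by (intro tendstoD) auto
  then have coercive: "\<forall>\<^sub>F j in H. \<forall>t. c / 2 * (norm t)\<^sup>2 \<le> (\<Sum>i<N j. (t \<bullet> u j i)\<^sup>2) / real (N j)"
  proof eventually_elim
    case (elim j)
    let ?M = "cross_moment (N j) (u j) (u j)"
    show ?case
    proof
      fix t
      have "\<bar>t \<bullet> ((?M - S) *v t)\<bar> \<le> norm t * norm ((?M - S) *v t)" by (rule Cauchy_Schwarz_ineq2)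
      also have "\<dots> \<le> norm t * (norm (?M - S) * norm t)"
        by (intro mult_left_mono norm_matrix_vector_mult_le) auto
      also have "\<dots> \<le> norm t * (c / 2 * norm t)"
        using elim by (intro mult_left_mono mult_right_mono) (auto simp: dist_norm)
      finally have "\<bar>t \<bullet> ((?M - S) *v t)\<bar> \<le> c / 2 * (norm t)\<^sup>2" by (simp add: power2_eq_square mult_ac)
      moreover have "t \<bullet> (?M *v t) = t \<bullet> (S *v t) + t \<bullet> ((?M - S) *v t)"
        by (simp add: matrix_vector_mult_diff_rdistrib inner_diff_right)
      moreover have "t \<bullet> (?M *v t) = (\<Sum>i<N j. (t \<bullet> u j i)\<^sup>2) / real (N j)"
        by (simp add: inner_cross_moment power2_eq_square inner_commute)
      ultimately show "c / 2 * (norm t)\<^sup>2 \<le> (\<Sum>i<N j. (t \<bullet> u j i)\<^sup>2) / real (N j)"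
        using c(2)[of t] by linarith
    qed
  qed
  have "\<forall>\<^sub>F j in H. m j < 1 / (2 * L)" using m L by (intro order_tendstoD(2)) auto
  then have "\<forall>\<^sub>F j in H. \<exists>\<tau>. norm (sqrt (real (N j)) *\<^sub>R \<tau>) \<le> L
      \<and> (\<Sum>i<N j. (1 / (1 + \<tau> \<bullet> u j i)) *\<^sub>R u j i) = 0 \<and> (\<forall>i<N j. 1 + \<tau> \<bullet> u j i > 0)"
    using pos small K(2) coercive
  proof eventually_elim
    case (elim j)
    have sq: "sqrt (real (N j)) > 0" "sqrt (real (N j)) * sqrt (real (N j)) = real (N j)"
      using elim(2) by auto
    define \<delta> where "\<delta> = L / sqrt (real (N j))"
    have \<delta>: "\<delta> > 0" using L sq by (simp add: \<delta>_def)
    have small': "\<delta> * norm (u j i) \<le> 1 / 2" if "i < N j" for i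
    proof -
      have "\<delta> * norm (u j i) \<le> \<delta> * (m j * sqrt (real (N j)))"
        using elim(3) that \<delta> by (intro mult_left_mono) auto
      also have "\<dots> = L * m j" using sq by (simp add: \<delta>_def)
      also have "\<dots> \<le> 1 / 2" using elim(1) L by (simp add: field_simps)
      finally show ?thesis .
    qed
    have mean': "norm (\<Sum>i<N j. u j i) / real (N j) < c / 2 * \<delta> / 4"
    proof -
      have "norm (\<Sum>i<N j. u j i) / real (N j)
         = norm ((\<Sum>i<N j. u j i) /\<^sub>R sqrt (real (N j))) / sqrt (real (N j))"
        using sq by (simp add: divide_simps)
      also have "\<dots> \<le> K / sqrt (real (N j))" using elim(4) sq by (intro divide_right_mono) auto
      also have "\<dots> < (c / 2 * L / 4) / sqrt (real (N j))" using L sq by (intro divide_strict_right_mono) auto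
      finally show ?thesis by (simp add: \<delta>_def)
    qed
    obtain \<tau> where \<tau>: "norm \<tau> < \<delta>" "(\<Sum>i<N j. (1 / (1 + \<tau> \<bullet> u j i)) *\<^sub>R u j i) = 0"
        "\<And>i. i < N j \<Longrightarrow> 1 + \<tau> \<bullet> u j i \<ge> 1 / 2"
      by (rule multiplier_equation_solvable[OF elim(2) \<delta> small' spec[OF elim(5)] mean']) blast+
    have "norm (sqrt (real (N j)) *\<^sub>R \<tau>) \<le> sqrt (real (N j)) * \<delta>"
      using \<tau>(1) by (simp add: mult_left_mono)
    also have "\<dots> = L" using sq by (simp add: \<delta>_def)
    finally show ?case using \<tau> by (intro exI[of _ \<tau>]) force
  qed
  moreover have "\<forall>\<^sub>F j in H. \<forall>t. (\<Sum>i<N j. (t \<bullet> u j i)\<^sup>2) = 0 \<longrightarrow> t = 0"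
    using coercive
  proof eventually_elim
    case (elim j)
    show ?case
    proof (intro allI impI)
      fix t assume "(\<Sum>i<N j. (t \<bullet> u j i)\<^sup>2) = 0"
      then have "c / 2 * (norm t)\<^sup>2 \<le> 0" using elim[rule_format, of t] by simp
      then show "t = 0" using c(1) by (simp add: mult_le_0_iff)
    qed
  qed
  ultimately show thesis by (rule that)
qed

lemma S_stat_eq_sum:
  assumes "n > 0" and pos: "\<And>i. i < n \<Longrightarrow> 1 + t \<theta> \<bullet> g (x i) \<theta> > 0" "\<And>i. i < n \<Longrightarrow> 1 + t \<theta>0 \<bullet> g (x i) \<theta>0 > 0"
  shows "S_stat g \<phi> n x t \<theta> \<theta>0 = (\<Sum>i<n. 2 / deriv (deriv \<phi>) 1 * (1 / (1 + t \<theta>0 \<bullet> g (x i) \<theta>0)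
    * \<phi> ((1 + t \<theta>0 \<bullet> g (x i) \<theta>0) / (1 + t \<theta> \<bullet> g (x i) \<theta>))))"
proof -
  have "phi_term \<phi> (el_weight g n x \<theta> (t \<theta>) i) (el_weight g n x \<theta>0 (t \<theta>0) i)
     = 1 / real n * (1 / (1 + t \<theta>0 \<bullet> g (x i) \<theta>0)
        * \<phi> ((1 + t \<theta>0 \<bullet> g (x i) \<theta>0) / (1 + t \<theta> \<bullet> g (x i) \<theta>)))" if "i < n" for i
  proof -
    have "el_weight g n x \<theta> (t \<theta>) i / el_weight g n x \<theta>0 (t \<theta>0) i
       = (1 + t \<theta>0 \<bullet> g (x i) \<theta>0) / (1 + t \<theta> \<bullet> g (x i) \<theta>)"
      using pos[OF that] \<open>n > 0\<close> by (simp add: el_weight_def)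
    moreover have "el_weight g n x \<theta>0 (t \<theta>0) i \<noteq> 0"
      using pos[OF that] \<open>n > 0\<close> by (simp add: el_weight_def)
    ultimately show ?thesis by (simp add: phi_term_def el_weight_def)
  qed
  then have "phi_divergence \<phi> n (el_weight g n x \<theta> (t \<theta>)) (el_weight g n x \<theta>0 (t \<theta>0))
     = (\<Sum>i<n. 1 / real n * (1 / (1 + t \<theta>0 \<bullet> g (x i) \<theta>0)
        * \<phi> ((1 + t \<theta>0 \<bullet> g (x i) \<theta>0) / (1 + t \<theta> \<bullet> g (x i) \<theta>))))"
    unfolding phi_divergence_def by (intro sum.cong) auto
  then show ?thesis
    unfolding S_stat_def using \<open>n > 0\<close> by (simp add: sum_distrib_left)
qed

text \<open>Purely deterministic: \<open>j\<close> stands for a pair of a sample size and an outcome, and \<open>H\<close> for the filter of high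
  probability, restricted to an event on which the scaled estimator, its multiplier and the score at
  the null value are bounded. By the linearised multiplier equations at \<open>\<theta>E\<close> and at \<open>\<theta>0\<close>, the scaled difference
  \<open>w\<close> of the multipliers satisfies \<open>S w \<approx> B z\<close> with \<open>z\<close> the scaled error of the estimator. The statistic
  is close to \<open>Q\<close>, the sum of squared differences of the products, and \<open>Q\<close> is close to \<open>w \<bullet> S w\<close>.\<close>

theorem el_statistic_expansion:
  fixes g :: "real^'k \<Rightarrow> real^'p \<Rightarrow> real^'r" and N :: "'i \<Rightarrow> nat" and x :: "'i \<Rightarrow> nat \<Rightarrow> real^'k"
    and t :: "'i \<Rightarrow> real^'p \<Rightarrow> real^'r" and \<theta>E :: "'i \<Rightarrow> real^'p" and B :: "real^'p^'r"
  assumes phi: "\<phi> \<in> \<Phi>" and S: "positive_definite S" and r: "r > 0"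
    and diff: "\<And>y \<theta>. \<theta> \<in> ball \<theta>0 r \<Longrightarrow> g y differentiable (at \<theta>)"
    and diff2: "\<And>y \<theta>. \<theta> \<in> ball \<theta>0 r \<Longrightarrow> G g y differentiable (at \<theta>)"
    and K1: "\<And>y \<theta>. \<theta> \<in> ball \<theta>0 r \<Longrightarrow> norm (G g y \<theta>) \<le> K1 y"
    and K2: "\<And>y \<theta>. \<theta> \<in> ball \<theta>0 r \<Longrightarrow> norm (dG g y \<theta>) \<le> K2 y"
    and N: "filterlim N sequentially H" and theta0: "\<theta>0 \<in> \<Theta>"
    and tmult: "\<forall>\<^sub>F j in H. el_multiplier_function \<Theta> g (N j) (x j) (t j)"
    and tE: "\<forall>\<^sub>F j in H. el_multiplier g (N j) (x j) (\<theta>E j) (t j (\<theta>E j))"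
    and small: "\<forall>\<^sub>F j in H. \<forall>i<N j. \<forall>\<theta>\<in>ball \<theta>0 r. norm (g (x j i) \<theta>) \<le> m j * sqrt (real (N j))"
    and m: "(m \<longlongrightarrow> 0) H"
    and mean1: "((\<lambda>j. (\<Sum>i<N j. K1 (x j i)) / real (N j)) \<longlongrightarrow> k1) H"
    and mean2: "((\<lambda>j. (\<Sum>i<N j. K2 (x j i)) / real (N j)) \<longlongrightarrow> k2) H"
    and meanG: "((\<lambda>j. (1 / real (N j)) *\<^sub>R (\<Sum>i<N j. G g (x j i) \<theta>0)) \<longlongrightarrow> B) H"
    and moment: "((\<lambda>j. cross_moment (N j) (\<lambda>i. g (x j i) \<theta>0) (\<lambda>i. g (x j i) \<theta>0)) \<longlongrightarrow> S) H"
    and score: "Bfun (\<lambda>j. (\<Sum>i<N j. g (x j i) \<theta>0) /\<^sub>R sqrt (real (N j))) H"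
    and Z: "Bfun (\<lambda>j. sqrt (real (N j)) *\<^sub>R (\<theta>E j - \<theta>0)) H"
    and \<alpha>: "Bfun (\<lambda>j. sqrt (real (N j)) *\<^sub>R t j (\<theta>E j)) H"
  shows "((\<lambda>j. S_stat g \<phi> (N j) (x j) (t j) (\<theta>E j) \<theta>0
     - (matrix_inv S *v (B *v (sqrt (real (N j)) *\<^sub>R (\<theta>E j - \<theta>0))))
        \<bullet> (B *v (sqrt (real (N j)) *\<^sub>R (\<theta>E j - \<theta>0)))) \<longlongrightarrow> 0) H"
proof -
  define u where "u j i = g (x j i) (\<theta>E j)" for j i
  define v where "v j i = g (x j i) \<theta>0" for j i
  define z where "z j = sqrt (real (N j)) *\<^sub>R (\<theta>E j - \<theta>0)" for j
  have Z': "Bfun z H" using Z by (simp add: z_def[abs_def])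
  have pos: "\<forall>\<^sub>F j in H. N j > 0"
    using N by (rule eventually_compose_filterlim[OF eventually_gt_at_top])
  have inv_sqrt: "((\<lambda>j. inverse (sqrt (real (N j)))) \<longlongrightarrow> 0) H"
    by (rule tendsto_inverse_0_at_top[OF filterlim_compose[OF sqrt_at_top
          filterlim_compose[OF filterlim_real_sequentially N]]])
  have "((\<lambda>j. inverse (sqrt (real (N j))) * norm (z j)) \<longlongrightarrow> 0) H"
    by (rule bounded_bilinear.tendsto_zero_Bfun[OF bounded_bilinear_mult inv_sqrt Bfun_norm[OF Z']])
  then have "\<forall>\<^sub>F j in H. inverse (sqrt (real (N j))) * norm (z j) < r"
    using r by (rule order_tendstoD(2))
  then have in_ball: "\<forall>\<^sub>F j in H. \<theta>E j \<in> ball \<theta>0 r"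
    using pos
  proof eventually_elim
    case (elim j)
    have "inverse (sqrt (real (N j))) * norm (z j) = dist \<theta>0 (\<theta>E j)"
      using elim(2) by (simp add: z_def dist_norm norm_minus_commute flip: mult.assoc)
    then show ?case using elim(1) by simp
  qed
  have small_u: "\<forall>\<^sub>F j in H. \<forall>i<N j. norm (u j i) \<le> m j * sqrt (real (N j))"
    using small in_ball by eventually_elim (simp add: u_def)
  have small_v: "\<forall>\<^sub>F j in H. \<forall>i<N j. norm (v j i) \<le> m j * sqrt (real (N j))"
    using small by eventually_elim (use r in \<open>simp add: v_def\<close>)
  have vv: "((\<lambda>j. cross_moment (N j) (v j) (v j)) \<longlongrightarrow> S) H"
    using moment by (simp add: v_def[abs_def])
  \<comment> \<open>The Lipschitz constants \<open>K1\<close> have a first moment only. So in each product one factor is bounded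
    by the sample maximum, the other by \<open>K1\<close> times the error of the estimator, which is of order \<open>1 / \<surd>n\<close>.\<close>
  have perturb: "((\<lambda>j. cross_moment (N j) (u j) (w j) - cross_moment (N j) (v j) (v j)) \<longlongrightarrow> 0) H"
    if w: "\<And>j i. norm (w j i - v j i) \<le> norm (u j i - v j i)"
      and small_w: "\<forall>\<^sub>F j in H. \<forall>i<N j. norm (w j i) \<le> m j * sqrt (real (N j))" for w
  proof (rule Lim_null_comparison)
    show "\<forall>\<^sub>F j in H. norm (cross_moment (N j) (u j) (w j) - cross_moment (N j) (v j) (v j))
       \<le> 2 * (m j * (norm (z j) * ((\<Sum>i<N j. K1 (x j i)) / real (N j))))"
      using in_ball small_w small_v
    proof eventually_elim
      case (elim j)
      have le: "norm (u j i - v j i) \<le> K1 (x j i) * norm (\<theta>E j - \<theta>0)" for i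
        unfolding u_def v_def by (rule estimating_function_lipschitz[OF elim(1) diff K1])
      have "norm (cross_moment (N j) (u j) (w j) - cross_moment (N j) (v j) (v j))
          \<le> 2 * (m j * sqrt (real (N j))) * ((\<Sum>i<N j. K1 (x j i) * norm (\<theta>E j - \<theta>0)) / real (N j))"
        by (rule cross_moment_perturbation) (use le w elim in \<open>auto intro: order_trans[OF w]\<close>)
      then show ?case by (simp add: z_def sum_distrib_right[symmetric] mult_ac)
    qed
    have "((\<lambda>j. m j * (norm (z j) * ((\<Sum>i<N j. K1 (x j i)) / real (N j)))) \<longlongrightarrow> 0) H"
      by (intro bounded_bilinear.tendsto_zero_Bfun[OF bounded_bilinear_mult m]
          bounded_bilinear.Bfun_prod[OF bounded_bilinear_mult] Bfun_norm Z' tendsto_imp_Bfun[OF mean1])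
    then show "((\<lambda>j. 2 * (m j * (norm (z j) * ((\<Sum>i<N j. K1 (x j i)) / real (N j))))) \<longlongrightarrow> 0) H"
      by (rule tendsto_mult_right_zero)
  qed
  have uu: "((\<lambda>j. cross_moment (N j) (u j) (u j)) \<longlongrightarrow> S) H"
    using tendsto_add[OF perturb[of u] vv] small_u by simp
  have uv: "((\<lambda>j. cross_moment (N j) (u j) (v j)) \<longlongrightarrow> S) H"
    using tendsto_add[OF perturb[of v] vv] small_v by simp
  obtain L where L: "\<forall>\<^sub>F j in H. \<exists>\<tau>. norm (sqrt (real (N j)) *\<^sub>R \<tau>) \<le> L
      \<and> (\<Sum>i<N j. (1 / (1 + \<tau> \<bullet> v j i)) *\<^sub>R v j i) = 0 \<and> (\<forall>i<N j. 1 + \<tau> \<bullet> v j i > 0)"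
    and nondeg: "\<forall>\<^sub>F j in H. \<forall>s. (\<Sum>i<N j. (s \<bullet> v j i)\<^sup>2) = 0 \<longrightarrow> s = 0"
    by (rule null_multiplier_bounded[OF N S small_v m vv]) (use score in \<open>simp_all add: v_def[abs_def]\<close>)
  have null: "\<forall>\<^sub>F j in H. norm (sqrt (real (N j)) *\<^sub>R t j \<theta>0) \<le> L
      \<and> (\<Sum>i<N j. (1 / (1 + t j \<theta>0 \<bullet> v j i)) *\<^sub>R v j i) = 0"
    using L nondeg tmult pos
  proof eventually_elim
    case (elim j)
    then obtain \<tau> where \<tau>: "norm (sqrt (real (N j)) *\<^sub>R \<tau>) \<le> L"
        "(\<Sum>i<N j. (1 / (1 + \<tau> \<bullet> v j i)) *\<^sub>R v j i) = 0" "\<And>i. i < N j \<Longrightarrow> 1 + \<tau> \<bullet> v j i > 0"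
      by blast
    have mult: "el_multiplier g (N j) (x j) \<theta>0 \<tau>"
      using \<tau>(2,3) elim(4) unfolding v_def by (intro el_multiplierI)
    \<comment> \<open>\<open>t\<close> solves the equation since it is solvable, and its value is the small solution since solutions are unique.\<close>
    then have ex: "\<exists>\<tau>. el_multiplier g (N j) (x j) \<theta>0 \<tau>" by blast
    have "el_multiplier g (N j) (x j) \<theta>0 (t j \<theta>0)"
      using bspec[OF elim(3)[unfolded el_multiplier_function_def] theta0] unfolding if_P[OF ex] .
    then have "t j \<theta>0 = \<tau>"
      by (rule el_multiplier_unique[OF _ mult elim(4)]) (use elim(2) in \<open>simp add: v_def\<close>)
    then show ?case using \<tau>(1,2) by simp
  qed
  have \<beta>: "Bfun (\<lambda>j. sqrt (real (N j)) *\<^sub>R t j \<theta>0) H"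
    by (rule BfunI[where K=L]) (use null in eventually_elim, simp)
  have lin_u: "((\<lambda>j. (\<Sum>i<N j. u j i) /\<^sub>R sqrt (real (N j)) - S *v (sqrt (real (N j)) *\<^sub>R t j (\<theta>E j))) \<longlongrightarrow> 0) H"
  proof (rule multiplier_linearization[OF pos small_u m uu \<alpha>])
    show "\<forall>\<^sub>F j in H. (\<Sum>i<N j. (1 / (1 + t j (\<theta>E j) \<bullet> u j i)) *\<^sub>R u j i) = 0"
      using tE pos by eventually_elim (simp add: el_multiplier_def u_def)
  qed
  have lin_v: "((\<lambda>j. (\<Sum>i<N j. v j i) /\<^sub>R sqrt (real (N j)) - S *v (sqrt (real (N j)) *\<^sub>R t j \<theta>0)) \<longlongrightarrow> 0) H"
  proof (rule multiplier_linearization[OF pos small_v m vv \<beta>])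
    show "\<forall>\<^sub>F j in H. (\<Sum>i<N j. (1 / (1 + t j \<theta>0 \<bullet> v j i)) *\<^sub>R v j i) = 0"
      using null by eventually_elim simp
  qed
  define GN where "GN j = (1 / real (N j)) *\<^sub>R (\<Sum>i<N j. G g (x j i) \<theta>0)" for j
  let ?d = "\<lambda>j. (\<Sum>i<N j. u j i) /\<^sub>R sqrt (real (N j)) - (\<Sum>i<N j. v j i) /\<^sub>R sqrt (real (N j)) - GN j *v z j"
  let ?e = "\<lambda>j. inverse (sqrt (real (N j))) * ((norm (z j) * norm (z j)) * ((\<Sum>i<N j. K2 (x j i)) / real (N j)))"
  have taylor: "((\<lambda>j. ?d j) \<longlongrightarrow> 0) H"
  proof (rule Lim_null_comparison)
    show "\<forall>\<^sub>F j in H. norm (?d j)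
       \<le> real CARD('p) * ?e j"
      using in_ball pos
    proof eventually_elim
      case (elim j)
      have sq: "sqrt (real (N j)) > 0" "sqrt (real (N j)) * sqrt (real (N j)) = real (N j)"
        using elim(2) by auto
      let ?R = "\<lambda>i. u j i - v j i - G g (x j i) \<theta>0 *v (\<theta>E j - \<theta>0)"
      have le: "norm (?R i) \<le> real CARD('p) * K2 (x j i) * (norm (\<theta>E j - \<theta>0))\<^sup>2" for i
        unfolding u_def v_def by (rule estimating_function_taylor[OF elim(1) diff diff2 K2])
      have sumG: "(\<Sum>i<n. G g (x j i) \<theta>0) *v h = (\<Sum>i<n. G g (x j i) \<theta>0 *v h)" for h n
        by (rule matvec.sum_left)
      have "GN j *v z j = (\<Sum>i<N j. G g (x j i) \<theta>0 *v (\<theta>E j - \<theta>0)) /\<^sub>R sqrt (real (N j))"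
      proof -
        have "GN j *v z j = (sqrt (real (N j)) / real (N j)) *\<^sub>R (\<Sum>i<N j. G g (x j i) \<theta>0 *v (\<theta>E j - \<theta>0))"
          unfolding GN_def z_def by (simp add: matvec.scaleR_left matvec.scaleR_right sumG)
        also have "sqrt (real (N j)) / real (N j) = inverse (sqrt (real (N j)))"
          using sq by (simp add: field_simps)
        finally show ?thesis .
      qed
      then have "?d j
         = (\<Sum>i<N j. ?R i) /\<^sub>R sqrt (real (N j))"
        by (simp add: sum_subtractf scaleR_diff_right)
      then have "norm (?d j)
         = inverse (sqrt (real (N j))) * norm (\<Sum>i<N j. ?R i)"
        using sq by simp
      also have "\<dots> \<le> inverse (sqrt (real (N j))) * (\<Sum>i<N j. real CARD('p) * K2 (x j i) * (norm (\<theta>E j - \<theta>0))\<^sup>2)"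
        using sq le by (intro mult_left_mono sum_norm_le) auto
      also have "(\<Sum>i<N j. real CARD('p) * K2 (x j i) * (norm (\<theta>E j - \<theta>0))\<^sup>2)
         = real CARD('p) * (norm (\<theta>E j - \<theta>0))\<^sup>2 * (\<Sum>i<N j. K2 (x j i))"
        unfolding sum_distrib_left by (intro sum.cong) (simp_all add: mult_ac)
      also have "(norm (\<theta>E j - \<theta>0))\<^sup>2 = norm (z j) * norm (z j) / real (N j)"
      proof -
        have "norm (z j) = sqrt (real (N j)) * norm (\<theta>E j - \<theta>0)"
          unfolding z_def norm_scaleR by simp
        then have "norm (z j) * norm (z j)
            = (sqrt (real (N j)) * sqrt (real (N j))) * (norm (\<theta>E j - \<theta>0) * norm (\<theta>E j - \<theta>0))"
          by (simp only: mult_ac)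
        then show ?thesis using elim(2) unfolding sq(2) by (simp add: power2_eq_square)
      qed
      finally show ?case by (simp add: mult_ac)
    qed
    have "(?e \<longlongrightarrow> 0) H"
      by (intro bounded_bilinear.tendsto_zero_Bfun[OF bounded_bilinear_mult inv_sqrt]
          bounded_bilinear.Bfun_prod[OF bounded_bilinear_mult] Bfun_norm Z' tendsto_imp_Bfun[OF mean2])
    then show "((\<lambda>j. real CARD('p) * ?e j) \<longlongrightarrow> 0) H"
      by (rule tendsto_mult_right_zero)
  qed
  have GN: "((\<lambda>j. (GN j - B) *v z j) \<longlongrightarrow> 0) H"
    using meanG Z' by (intro matvec.tendsto_zero_Bfun) (simp_all add: LIM_zero GN_def[abs_def])
  define w where "w j = sqrt (real (N j)) *\<^sub>R (t j (\<theta>E j) - t j \<theta>0)" for j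
  define y where "y j = S *v w j" for j
  have yB: "((\<lambda>j. y j - B *v z j) \<longlongrightarrow> 0) H"
  proof -
    have "((\<lambda>j. (((\<Sum>i<N j. v j i) /\<^sub>R sqrt (real (N j)) - S *v (sqrt (real (N j)) *\<^sub>R t j \<theta>0))
        - ((\<Sum>i<N j. u j i) /\<^sub>R sqrt (real (N j)) - S *v (sqrt (real (N j)) *\<^sub>R t j (\<theta>E j))))
        + (?d j)
        + (GN j - B) *v z j) \<longlongrightarrow> (0 - 0) + 0 + 0) H"
      by (intro tendsto_add tendsto_diff lin_u lin_v taylor GN)
    then show ?thesis
      by (simp add: y_def w_def matvec.diff_left matvec.diff_right matvec.scaleR_right algebra_simps)
  qed
  have BZ: "Bfun (\<lambda>j. B *v z j) H" by (intro matvec.Bfun_prod Bfun_const Z')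
  have yb: "Bfun y H"
    using Bfun_add[OF tendsto_imp_Bfun[OF yB] BZ] by simp
  have w_eq: "w j = matrix_inv S *v y j" for j
    unfolding y_def by (simp add: matrix_inv_mult_vector(2)[OF positive_definite_invertible[OF S]])
  have wb: "Bfun w H"
    unfolding w_eq[abs_def] by (intro matvec.Bfun_prod Bfun_const yb)
  have quad: "((\<lambda>j. w j \<bullet> (S *v w j) - (matrix_inv S *v (B *v z j)) \<bullet> (B *v z j)) \<longlongrightarrow> 0) H"
  proof -
    have "((\<lambda>j. (matrix_inv S *v (y j - B *v z j)) \<bullet> y j + (matrix_inv S *v (B *v z j)) \<bullet> (y j - B *v z j)) \<longlongrightarrow> 0 + 0) H"
      by (intro tendsto_add bounded_bilinear.tendsto_zero_Bfun[OF bounded_bilinear_inner]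
          bounded_bilinear.Bfun_tendsto_zero[OF bounded_bilinear_inner] matvec.Bfun_tendsto_zero
          matvec.Bfun_prod Bfun_const yB yb BZ)
    then show ?thesis
      by (simp add: w_eq matrix_inv_mult_vector(1)[OF positive_definite_invertible[OF S]]
          matvec.diff_right inner_diff_left inner_diff_right)
  qed
  define Q where "Q j = (\<Sum>i<N j. (t j (\<theta>E j) \<bullet> u j i - t j \<theta>0 \<bullet> v j i)\<^sup>2)" for j
  have sym: "transpose S = S" using S by (simp add: positive_definite_def)
  have QS: "((\<lambda>j. Q j - w j \<bullet> (S *v w j)) \<longlongrightarrow> 0) H"
    using sum_square_differences_limit[OF pos sym uu uv vv \<alpha> \<beta>] unfolding Q_def w_def .
  have Qb: "Bfun Q H"
  proof -
    have "Bfun (\<lambda>j. (Q j - w j \<bullet> (S *v w j)) + w j \<bullet> (S *v w j)) H"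
      by (intro Bfun_add tendsto_imp_Bfun[OF QS] bounded_bilinear.Bfun_prod[OF bounded_bilinear_inner]
          matvec.Bfun_prod Bfun_const wb)
    then show ?thesis by simp
  qed
  have stat: "((\<lambda>j. S_stat g \<phi> (N j) (x j) (t j) (\<theta>E j) \<theta>0 - Q j) \<longlongrightarrow> 0) H"
  proof (rule tendstoI)
    fix \<epsilon> :: real assume \<epsilon>: "\<epsilon> > 0"
    obtain C where C: "C > 0" "\<forall>\<^sub>F j in H. norm (Q j) \<le> C" using Qb by (rule BfunE)
    define \<kappa> where "\<kappa> = \<epsilon> / (2 * C)"
    have \<kappa>: "\<kappa> > 0" "\<kappa> * C < \<epsilon>" using \<epsilon> C(1) by (auto simp: \<kappa>_def)
    obtain \<delta> where \<delta>: "\<delta> > 0" "\<And>a b. \<bar>a\<bar> < \<delta> \<Longrightarrow> \<bar>b\<bar> < \<delta> \<Longrightarrow>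
        \<bar>2 / deriv (deriv \<phi>) 1 * (1 / (1 + b) * \<phi> ((1 + b) / (1 + a))) - (a - b)\<^sup>2\<bar> \<le> \<kappa> * (a - b)\<^sup>2"
      by (rule \<Phi>_summand_expansion[OF phi \<kappa>(1)]) blast
    have "min \<delta> 1 > 0" using \<delta>(1) by simp
    note negl_u = multiplier_products_negligible[OF small_u m \<alpha> this]
      and negl_v = multiplier_products_negligible[OF small_v m \<beta> this]
    show "\<forall>\<^sub>F j in H. dist (S_stat g \<phi> (N j) (x j) (t j) (\<theta>E j) \<theta>0 - Q j) 0 < \<epsilon>"
      using negl_u negl_v pos C(2)
    proof eventually_elim
      case (elim j)
      let ?a = "\<lambda>i. t j (\<theta>E j) \<bullet> u j i" and ?b = "\<lambda>i. t j \<theta>0 \<bullet> v j i"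
      have ab: "\<bar>?a i\<bar> < \<delta>" "\<bar>?b i\<bar> < \<delta>" "1 + ?a i > 0" "1 + ?b i > 0" if "i < N j" for i
        using elim(1)[rule_format, OF that] elim(2)[rule_format, OF that] by auto
      have "S_stat g \<phi> (N j) (x j) (t j) (\<theta>E j) \<theta>0
         = (\<Sum>i<N j. 2 / deriv (deriv \<phi>) 1 * (1 / (1 + ?b i) * \<phi> ((1 + ?b i) / (1 + ?a i))))"
        using ab(3,4) elim(3) unfolding u_def v_def by (intro S_stat_eq_sum)
      then have "S_stat g \<phi> (N j) (x j) (t j) (\<theta>E j) \<theta>0 - Q j
         = (\<Sum>i<N j. 2 / deriv (deriv \<phi>) 1 * (1 / (1 + ?b i) * \<phi> ((1 + ?b i) / (1 + ?a i))) - (?a i - ?b i)\<^sup>2)"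
        unfolding Q_def by (simp only: sum_subtractf)
      also have "\<bar>\<dots>\<bar> \<le> (\<Sum>i<N j. \<kappa> * (?a i - ?b i)\<^sup>2)"
        using \<delta>(2) ab(1,2) by (intro order_trans[OF sum_abs] sum_mono) auto
      also have "\<dots> = \<kappa> * Q j" unfolding Q_def by (rule sum_distrib_left[symmetric])
      also have "\<dots> \<le> \<kappa> * C" using elim(4) \<kappa>(1) by (intro mult_left_mono) auto
      finally show ?case using \<kappa>(2) by simp
    qed
  qed
  have "((\<lambda>j. (S_stat g \<phi> (N j) (x j) (t j) (\<theta>E j) \<theta>0 - Q j) + (Q j - w j \<bullet> (S *v w j))
     + (w j \<bullet> (S *v w j) - (matrix_inv S *v (B *v z j)) \<bullet> (B *v z j))) \<longlongrightarrow> 0 + 0 + 0) H"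
    by (intro tendsto_add stat QS quad)
  then show ?thesis by (simp add: z_def)
qed

section \<open>Limit law of the test statistic\<close>

text \<open>Step functions made continuous are enough here, because their expectations characterise weak convergence
  of distributions on the line.\<close>

lemma (in prob_space) slutsky_cts_step:
  fixes S Q :: "nat \<Rightarrow> 'a \<Rightarrow> real"
  assumes [measurable]: "\<And>n. S n \<in> borel_measurable M" "\<And>n. Q n \<in> borel_measurable M"
    and D: "\<And>\<epsilon>. \<epsilon> > 0 \<Longrightarrow> (\<lambda>n. prob {\<omega>\<in>space M. \<bar>S n \<omega> - Q n \<omega>\<bar> \<ge> \<epsilon>}) \<longlonglongrightarrow> 0" and "a < b"
  shows "(\<lambda>n. (\<integral>\<omega>. cts_step a b (S n \<omega>) \<partial>M) - (\<integral>\<omega>. cts_step a b (Q n \<omega>) \<partial>M)) \<longlonglongrightarrow> 0"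
proof (rule tendstoI)
  fix \<eta> :: real assume \<eta>: "\<eta> > 0"
  have uc: "uniformly_continuous_on UNIV (cts_step a b)" using \<open>a < b\<close> by (rule cts_step_uniformly_continuous)
  have [measurable]: "cts_step a b \<in> borel_measurable borel"
    by (rule borel_measurable_continuous_onI[OF uniformly_continuous_imp_continuous[OF uc]])
  obtain \<delta> where \<delta>: "\<delta> > 0" "\<And>x y. dist y x < \<delta> \<Longrightarrow> dist (cts_step a b y) (cts_step a b x) < \<eta> / 2"
    using uc \<eta> unfolding uniformly_continuous_on_def by (metis UNIV_I half_gt_zero)
  have range: "0 \<le> cts_step a b x" "cts_step a b x \<le> 1" for x
    using \<open>a < b\<close> by (auto simp: cts_step_def field_simps)
  have int: "integrable M (\<lambda>\<omega>. cts_step a b (f \<omega>))" if [measurable]: "f \<in> borel_measurable M" for f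
    by (rule integrable_const_bound[where B=1]) (auto simp: range)
  have "\<forall>\<^sub>F n in sequentially. prob {\<omega>\<in>space M. \<bar>S n \<omega> - Q n \<omega>\<bar> \<ge> \<delta>} < \<eta> / 2"
    using D[OF \<delta>(1)] \<eta> by (intro order_tendstoD(2)) auto
  then show "\<forall>\<^sub>F n in sequentially. dist ((\<integral>\<omega>. cts_step a b (S n \<omega>) \<partial>M) - (\<integral>\<omega>. cts_step a b (Q n \<omega>) \<partial>M)) 0 < \<eta>"
  proof eventually_elim
    case (elim n)
    let ?E = "{\<omega>\<in>space M. \<bar>S n \<omega> - Q n \<omega>\<bar> \<ge> \<delta>}"
    have "(\<integral>\<omega>. cts_step a b (S n \<omega>) \<partial>M) - (\<integral>\<omega>. cts_step a b (Q n \<omega>) \<partial>M)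
       = (\<integral>\<omega>. cts_step a b (S n \<omega>) - cts_step a b (Q n \<omega>) \<partial>M)"
      by (rule Bochner_Integration.integral_diff[symmetric]) (rule int, measurable)+
    also have "\<bar>\<dots>\<bar> \<le> (\<integral>\<omega>. \<bar>cts_step a b (S n \<omega>) - cts_step a b (Q n \<omega>)\<bar> \<partial>M)"
      by (rule integral_abs_bound)
    also have "\<dots> \<le> (\<integral>\<omega>. \<eta> / 2 + indicator ?E \<omega> \<partial>M)"
    proof (rule integral_mono)
      show "integrable M (\<lambda>\<omega>. \<bar>cts_step a b (S n \<omega>) - cts_step a b (Q n \<omega>)\<bar>)"
        by (intro integrable_abs Bochner_Integration.integrable_diff int) measurable
      show "integrable M (\<lambda>\<omega>. \<eta> / 2 + indicator ?E \<omega>)"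
        by (intro Bochner_Integration.integrable_add integrable_const integrable_real_indicator)
           (auto simp: emeasure_eq_measure)
      fix \<omega> assume "\<omega> \<in> space M"
      show "\<bar>cts_step a b (S n \<omega>) - cts_step a b (Q n \<omega>)\<bar> \<le> \<eta> / 2 + indicator ?E \<omega>"
      proof (cases "\<omega> \<in> ?E")
        case True
        then show ?thesis using range[of "S n \<omega>"] range[of "Q n \<omega>"] \<eta> by (auto simp: abs_le_iff)
      next
        case False
        then show ?thesis
          using \<delta>(2)[of "S n \<omega>" "Q n \<omega>"] \<open>\<omega> \<in> space M\<close> by (auto simp: dist_real_def)
      qed
    qed
    also have "\<dots> = \<eta> / 2 + prob ?E"
      by (subst Bochner_Integration.integral_add)
         (auto simp: prob_space emeasure_eq_measure intro!: integrable_real_indicator)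
    also have "\<dots> < \<eta>" using elim by simp
    finally show ?case by simp
  qed
qed

lemma \<Phi>_measurable:
  assumes "\<phi> \<in> \<Phi>"
  shows "(\<lambda>u. indicator {0<..} u *\<^sub>R \<phi> u) \<in> borel_measurable borel"
proof (rule borel_measurable_continuous_on_indicator)
  show "continuous_on {0<..} \<phi>" using assms by (intro convex_on_continuous) (auto simp: \<Phi>_def)
qed simp

lemma el_multiplier_function_positive:
  assumes "el_multiplier_function \<Theta> g n x t" "\<theta> \<in> \<Theta>" "i < n"
  shows "1 + t \<theta> \<bullet> g (x i) \<theta> > 0"
proof (cases "\<exists>\<tau>. el_multiplier g n x \<theta> \<tau>")
  case True
  have "el_multiplier g n x \<theta> (t \<theta>)"
    using bspec[OF assms(1)[unfolded el_multiplier_function_def] assms(2)] unfolding if_P[OF True] .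
  then show ?thesis using assms(3) by (rule el_multiplier_positive)
next
  case False
  have "t \<theta> = 0"
    using bspec[OF assms(1)[unfolded el_multiplier_function_def] assms(2)] unfolding if_not_P[OF False] .
  then show ?thesis by simp
qed

text \<open>The values of \<open>\<phi>\<close> outside the positive reals are arbitrary, but the ratios of weights are always positive:
  a multiplier has positive denominators, and where none exists the weights are uniform.\<close>

lemma S_stat_measurable:
  fixes M :: "'a measure" and g :: "real^'k \<Rightarrow> real^'p \<Rightarrow> real^'r"
  assumes g_meas: "(\<lambda>(x, \<theta>). g x \<theta>) \<in> borel_measurable (borel \<Otimes>\<^sub>M restrict_space borel \<Theta>)"
    and X[measurable]: "\<And>i. X i \<in> borel_measurable M"
    and \<theta>[measurable]: "\<theta> \<in> borel_measurable M" and \<theta>_in: "\<And>\<omega>. \<omega> \<in> space M \<Longrightarrow> \<theta> \<omega> \<in> \<Theta>"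
    and \<theta>0: "\<theta>0 \<in> \<Theta>"
    and t[measurable]: "(\<lambda>\<omega>. t \<omega> (\<theta> \<omega>)) \<in> borel_measurable M" "(\<lambda>\<omega>. t \<omega> \<theta>0) \<in> borel_measurable M"
    and mult: "\<And>\<omega>. \<omega> \<in> space M \<Longrightarrow> el_multiplier_function \<Theta> g n (\<lambda>i. X i \<omega>) (t \<omega>)"
    and phi: "\<phi> \<in> \<Phi>" and "n > 0"
  shows "(\<lambda>\<omega>. S_stat g \<phi> n (\<lambda>i. X i \<omega>) (t \<omega>) (\<theta> \<omega>) \<theta>0) \<in> borel_measurable M"
proof -
  have [measurable]: "(\<lambda>\<omega>. g (X i \<omega>) (s \<omega>)) \<in> borel_measurable M"
    if [measurable]: "s \<in> borel_measurable M" and "\<And>\<omega>. \<omega> \<in> space M \<Longrightarrow> s \<omega> \<in> \<Theta>" for i s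
  proof -
    have "(\<lambda>\<omega>. (X i \<omega>, s \<omega>)) \<in> M \<rightarrow>\<^sub>M borel \<Otimes>\<^sub>M restrict_space borel \<Theta>"
      using that(2) by (intro measurable_Pair measurable_restrict_space2) auto
    from measurable_compose[OF this g_meas] show ?thesis by simp
  qed
  note [measurable] = this[OF \<theta> \<theta>_in] this[OF measurable_const \<theta>0]
  define \<psi> where "\<psi> = (\<lambda>u. indicator {0<..} u *\<^sub>R \<phi> u)"
  have [measurable]: "\<psi> \<in> borel_measurable borel" unfolding \<psi>_def by (rule \<Phi>_measurable[OF phi])
  let ?f = "\<lambda>\<omega>. \<Sum>i<n. 2 / deriv (deriv \<phi>) 1 * (1 / (1 + t \<omega> \<theta>0 \<bullet> g (X i \<omega>) \<theta>0)
    * \<psi> ((1 + t \<omega> \<theta>0 \<bullet> g (X i \<omega>) \<theta>0) / (1 + t \<omega> (\<theta> \<omega>) \<bullet> g (X i \<omega>) (\<theta> \<omega>))))"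
  have "?f \<in> borel_measurable M" by measurable
  moreover have "S_stat g \<phi> n (\<lambda>i. X i \<omega>) (t \<omega>) (\<theta> \<omega>) \<theta>0 = ?f \<omega>" if "\<omega> \<in> space M" for \<omega>
  proof -
    note pos = el_multiplier_function_positive[OF mult[OF that] \<theta>_in[OF that]]
      el_multiplier_function_positive[OF mult[OF that] \<theta>0]
    have "S_stat g \<phi> n (\<lambda>i. X i \<omega>) (t \<omega>) (\<theta> \<omega>) \<theta>0
      = (\<Sum>i<n. 2 / deriv (deriv \<phi>) 1 * (1 / (1 + t \<omega> \<theta>0 \<bullet> g (X i \<omega>) \<theta>0)
         * \<phi> ((1 + t \<omega> \<theta>0 \<bullet> g (X i \<omega>) \<theta>0) / (1 + t \<omega> (\<theta> \<omega>) \<bullet> g (X i \<omega>) (\<theta> \<omega>)))))"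
      by (rule S_stat_eq_sum[where g=g and x="\<lambda>i. X i \<omega>", OF \<open>n > 0\<close> pos])
    also have "\<dots> = ?f \<omega>"
      using pos by (intro sum.cong) (auto simp: \<psi>_def)
    finally show ?thesis .
  qed
  ultimately show ?thesis by (subst measurable_cong) auto
qed

text \<open>The entries are limits of difference quotients, which are measurable in \<open>x\<close>.\<close>

lemma jacobian_measurable:
  fixes g :: "real^'k \<Rightarrow> real^'p \<Rightarrow> real^'r"
  assumes g_meas: "(\<lambda>(x, \<theta>). g x \<theta>) \<in> borel_measurable (borel \<Otimes>\<^sub>M restrict_space borel \<Theta>)"
    and r: "r > 0" "ball \<theta>0 r \<subseteq> \<Theta>" and diff: "\<And>x. g x differentiable (at \<theta>0)"
  shows "(\<lambda>x. G g x \<theta>0 $ i $ j) \<in> borel_measurable borel"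
proof -
  have slice: "(\<lambda>x. g x \<theta>) \<in> borel_measurable borel" if "\<theta> \<in> ball \<theta>0 r" for \<theta>
  proof -
    have "(\<lambda>x. (x, \<theta>)) \<in> borel \<rightarrow>\<^sub>M borel \<Otimes>\<^sub>M restrict_space borel \<Theta>"
      using that r(2) by (intro measurable_Pair measurable_restrict_space2) auto
    from measurable_compose[OF this g_meas] show ?thesis by simp
  qed
  define h where "h k = r / (real k + 2)" for k
  have h: "h k \<noteq> 0" "\<bar>h k\<bar> < r" for k
  proof -
    have "r * 1 < r * (real k + 2)" using r(1) by (intro mult_strict_left_mono) auto
    then show "h k \<noteq> 0" "\<bar>h k\<bar> < r" using r(1) by (simp_all add: h_def field_simps)
  qed
  have h0: "h \<longlonglongrightarrow> 0" unfolding h_def by real_asymp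
  have in_ball: "\<theta>0 + h k *\<^sub>R axis j 1 \<in> ball \<theta>0 r" for k
    using h[of k] by (simp add: dist_norm)
  show ?thesis
  proof (rule borel_measurable_LIMSEQ_real)
    show "(\<lambda>x. (g x (\<theta>0 + h k *\<^sub>R axis j 1) $ i - g x \<theta>0 $ i) / h k) \<in> borel_measurable borel" for k
      unfolding cart_eq_inner_axis[of _ i]
      using slice[OF in_ball[of k]] slice[of \<theta>0] r(1) by simp
    fix x
    have "((\<lambda>s. g x (\<theta>0 + s *\<^sub>R axis j 1)) has_derivative (\<lambda>s. G g x \<theta>0 *v (s *\<^sub>R axis j 1))) (at 0)"
    proof (rule has_derivative_compose[of "\<lambda>s. \<theta>0 + s *\<^sub>R axis j 1" "\<lambda>s. s *\<^sub>R axis j 1" 0 UNIV "g x"])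
      show "((\<lambda>s. \<theta>0 + s *\<^sub>R axis j 1) has_derivative (\<lambda>s. s *\<^sub>R axis j 1)) (at 0)"
        by (auto intro!: derivative_eq_intros)
      show "(g x has_derivative (*v) (G g x \<theta>0)) (at (\<theta>0 + 0 *\<^sub>R axis j 1))"
        using G_has_derivative[where g=g and x=x, OF diff] by simp
    qed
    then have "((\<lambda>s. g x (\<theta>0 + s *\<^sub>R axis j 1) $ i) has_derivative (\<lambda>s. (G g x \<theta>0 *v (s *\<^sub>R axis j 1)) $ i)) (at 0)"
      by (rule bounded_linear.has_derivative[OF bounded_linear_vec_nth])
    moreover have "(G g x \<theta>0 *v (s *\<^sub>R axis j 1)) $ i = G g x \<theta>0 $ i $ j * s" for s
      by (simp add: matrix_vector_mult_scaleR matrix_vector_mult_basis column_def)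
    ultimately have "((\<lambda>s. g x (\<theta>0 + s *\<^sub>R axis j 1) $ i) has_field_derivative G g x \<theta>0 $ i $ j) (at 0)"
      by (simp add: has_field_derivative_def)
    then have "((\<lambda>s. (g x (\<theta>0 + s *\<^sub>R axis j 1) $ i - g x \<theta>0 $ i) / s) \<longlongrightarrow> G g x \<theta>0 $ i $ j) (at 0)"
      by (simp add: has_field_derivative_iff)
    then show "(\<lambda>k. (g x (\<theta>0 + h k *\<^sub>R axis j 1) $ i - g x \<theta>0 $ i) / h k) \<longlonglongrightarrow> G g x \<theta>0 $ i $ j"
      by (rule filterlim_compose) (use h h0 in \<open>simp add: filterlim_at\<close>)
  qed
qed

text \<open>The same fact as an explicit bound \<open>m\<close> that vanishes along the filter, for use in products of
  bounded and vanishing functions.\<close>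

lemma (in iid_sample) sample_maximum_scaled:
  fixes h :: "'b \<Rightarrow> real"
  assumes int: "integrable F h" and nonneg: "\<And>x. h x \<ge> 0"
  obtains m where "(m \<longlongrightarrow> 0) (high_probability M)"
    "\<forall>\<^sub>F (n, \<omega>) in high_probability M. \<forall>i<n. root 3 (h (X i \<omega>)) \<le> m (n, \<omega>) * sqrt (real n)"
proof -
  define m where "m = (\<lambda>(n, \<omega>). Max (insert 0 ((\<lambda>i. root 3 (h (X i \<omega>))) ` {..<n})) / sqrt (real n))"
  have pos: "\<forall>\<^sub>F (n, \<omega>) in high_probability M. n > 0"
    using eventually_compose_filterlim[OF eventually_gt_at_top[of 0] filterlim_fst_high_probability]
    by (simp add: case_prod_beta')
  have m_nonneg: "m (n, \<omega>) \<ge> 0" for n \<omega> by (simp add: m_def)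
  have "(m \<longlongrightarrow> 0) (high_probability M)"
  proof (rule tendstoI)
    fix \<epsilon> :: real assume \<epsilon>: "\<epsilon> > 0"
    show "\<forall>\<^sub>F j in high_probability M. dist (m j) 0 < \<epsilon>"
      using sample_maximum_negligible[OF int nonneg zero_less_power[OF \<epsilon>, of 3]] pos
    proof eventually_elim
      case (elim j)
      obtain n \<omega> where j: "j = (n, \<omega>)" by (cases j)
      have n: "n > 0" using elim(2) by (simp add: j)
      have "root 3 (h (X i \<omega>)) < \<epsilon> * sqrt (real n)" if "i < n" for i
      proof -
        have "root 3 (h (X i \<omega>)) < root 3 ((\<epsilon> * sqrt (real n)) ^ 3)"
          using elim(1) that by (simp add: j power_mult_distrib del: real_root_power_cancel)
        then show ?thesis using \<epsilon> by (simp add: real_root_power_cancel)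
      qed
      then have "Max (insert 0 ((\<lambda>i. root 3 (h (X i \<omega>))) ` {..<n})) < \<epsilon> * sqrt (real n)"
        using \<epsilon> n by (subst Max_less_iff) auto
      then have "m j < \<epsilon>" using n by (simp add: m_def j field_simps)
      then show ?case using m_nonneg[of n \<omega>] by (simp add: j)
    qed
  qed
  moreover have "\<forall>\<^sub>F (n, \<omega>) in high_probability M. \<forall>i<n. root 3 (h (X i \<omega>)) \<le> m (n, \<omega>) * sqrt (real n)"
    using pos
  proof eventually_elim
    case (elim j)
    obtain n \<omega> where j: "j = (n, \<omega>)" by (cases j)
    have "root 3 (h (X i \<omega>)) \<le> Max (insert 0 ((\<lambda>i. root 3 (h (X i \<omega>))) ` {..<n}))" if "i < n" for i
      using that by (intro Max_ge) auto
    then show ?case using elim by (simp add: j m_def)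
  qed
  ultimately show thesis by (rule that)
qed

lemma (in iid_sample) sample_mean_matrix:
  fixes h :: "'b \<Rightarrow> real^'n^'m"
  assumes "\<And>i j. integrable F (\<lambda>x. h x $ i $ j)"
  shows "((\<lambda>(n, \<omega>). (1 / real n) *\<^sub>R (\<Sum>i<n. h (X i \<omega>))) \<longlongrightarrow> (\<chi> i j. \<integral>x. h x $ i $ j \<partial>F)) (high_probability M)"
proof (intro vec_tendstoI)
  fix i j
  show "((\<lambda>p. (case p of (n, \<omega>) \<Rightarrow> (1 / real n) *\<^sub>R (\<Sum>i<n. h (X i \<omega>))) $ i $ j)
     \<longlongrightarrow> (\<chi> i j. \<integral>x. h x $ i $ j \<partial>F) $ i $ j) (high_probability M)"
    using weak_law_of_large_numbers[OF assms[of i j]] by (simp add: case_prod_beta')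
qed

lemma Bfun_fst_snd:
  fixes f :: "'a \<Rightarrow> 'b::real_normed_vector \<times> 'c::real_normed_vector"
  assumes "Bfun f H"
  shows "Bfun (\<lambda>j. fst (f j)) H" "Bfun (\<lambda>j. snd (f j)) H"
proof -
  obtain K where K: "\<forall>\<^sub>F j in H. norm (f j) \<le> K" using assms by (rule BfunE)
  have le: "norm (fst p) \<le> norm p" "norm (snd p) \<le> norm p" for p :: "'b \<times> 'c"
    using norm_fst_le[of "fst p" "snd p"] norm_snd_le[of "snd p" "fst p"] by simp_all
  show "Bfun (\<lambda>j. fst (f j)) H"
    by (rule BfunI[where K=K]) (use K in eventually_elim, rule order_trans[OF le(1)])
  show "Bfun (\<lambda>j. snd (f j)) H"
    by (rule BfunI[where K=K]) (use K in eventually_elim, rule order_trans[OF le(2)])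
qed

theorem theorem3:
  fixes M :: "'a measure"
    and X :: "nat \<Rightarrow> 'a \<Rightarrow> real^'k"
    and F :: "(real^'k) measure"
    and \<Theta> :: "(real^'p) set"
    and g :: "real^'k \<Rightarrow> real^'p \<Rightarrow> real^'r"
    and \<theta>\<^sub>0 :: "real^'p"
    and t :: "nat \<Rightarrow> 'a \<Rightarrow> real^'p \<Rightarrow> real^'r"
    and \<theta>E :: "nat \<Rightarrow> 'a \<Rightarrow> real^'p"
    and N\<^sub>V :: "(real^'p) measure"
    and N\<^sub>R :: "(real^'r) measure"
    and \<phi> :: "real \<Rightarrow> real"
  assumes prob: "prob_space M"
    and indep: "prob_space.indep_vars M (\<lambda>_. borel) X UNIV"
    and ident: "\<And>i. distr M borel (X i) = F"
    and dims: "CARD('p) \<le> CARD('r)"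
    and g_meas: "(\<lambda>(x, \<theta>). g x \<theta>) \<in> borel_measurable (borel \<Otimes>\<^sub>M restrict_space borel \<Theta>)"
    and g_indep: "functionally_independent \<Theta> g"
    and theta0: "\<theta>\<^sub>0 \<in> \<Theta>"
    and null: "integrable F (\<lambda>x. g x \<theta>\<^sub>0)" "(\<integral>x. g x \<theta>\<^sub>0 \<partial>F) = 0"
    and cond_i: "positive_definite (S11 F g \<theta>\<^sub>0)" "rank (S12 F g \<theta>\<^sub>0) = CARD('p)"
    and cond_ii: "\<exists>U K. open U \<and> \<theta>\<^sub>0 \<in> U \<and> U \<subseteq> \<Theta> \<and> integrable F K \<and>
        (\<forall>x. \<forall>\<theta>\<in>U. norm (g x \<theta>) ^ 3 \<le> K x)"
    and cond_iii: "\<exists>U K. open U \<and> \<theta>\<^sub>0 \<in> U \<and> U \<subseteq> \<Theta> \<and> integrable F K \<and>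
        (\<forall>x. (\<forall>\<theta>\<in>U. g x differentiable (at \<theta>)) \<and> continuous_on U (G g x) \<and>
             (\<forall>\<theta>\<in>U. norm (G g x \<theta>) \<le> K x))"
    and cond_iv: "\<exists>U K. open U \<and> \<theta>\<^sub>0 \<in> U \<and> U \<subseteq> \<Theta> \<and> integrable F K \<and>
        (\<forall>x. (\<forall>\<theta>\<in>U. G g x differentiable (at \<theta>)) \<and> continuous_on U (dG g x) \<and>
             (\<forall>\<theta>\<in>U. norm (dG g x \<theta>) \<le> K x))"
    and t_mult: "\<And>n \<omega>. \<omega> \<in> space M \<Longrightarrow> el_multiplier_function \<Theta> g n (\<lambda>i. X i \<omega>) (t n \<omega>)"
    and t_meas: "\<And>n \<theta>. \<theta> \<in> \<Theta> \<Longrightarrow> (\<lambda>\<omega>. t n \<omega> \<theta>) \<in> borel_measurable M"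
    and est_Theta: "\<And>n \<omega>. \<omega> \<in> space M \<Longrightarrow> \<theta>E n \<omega> \<in> \<Theta>"
    and est_max: "\<exists>A. (\<forall>n. A n \<in> sets M) \<and> (\<lambda>n. measure M (A n)) \<longlonglongrightarrow> 1 \<and>
        (\<forall>n. \<forall>\<omega>\<in>A n. el_maximizer \<Theta> g n (\<lambda>i. X i \<omega>) (t n \<omega>) (\<theta>E n \<omega>))"
    and lim_V: "centred_normal N\<^sub>V (V F g \<theta>\<^sub>0)"
    and lim_R: "centred_normal N\<^sub>R (R F g \<theta>\<^sub>0)"
    and est_lim: "converges_in_law M
        (\<lambda>n \<omega>. (sqrt (real n) *\<^sub>R (\<theta>E n \<omega> - \<theta>\<^sub>0), sqrt (real n) *\<^sub>R t n \<omega> (\<theta>E n \<omega>)))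
        (N\<^sub>V \<Otimes>\<^sub>M N\<^sub>R)"
    and phi: "\<phi> \<in> \<Phi>"
  shows "(\<forall>n. (\<lambda>\<omega>. S_stat g \<phi> n (\<lambda>i. X i \<omega>) (t n \<omega>) (\<theta>E n \<omega>) \<theta>\<^sub>0) \<in> borel_measurable M) \<and>
    weak_conv_m
      (\<lambda>n. distr M borel (\<lambda>\<omega>. S_stat g \<phi> n (\<lambda>i. X i \<omega>) (t n \<omega>) (\<theta>E n \<omega>) \<theta>\<^sub>0))
      (chi_square CARD('p))"
proof -
  interpret iid_sample M X F
    using prob indep ident by (simp add: iid_sample_def iid_sample_axioms_def)
  note [measurable] = sample_measurable
  obtain U1 K0 where U1: "open U1" "\<theta>\<^sub>0 \<in> U1" "U1 \<subseteq> \<Theta>" and intK0: "integrable F K0"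
    and K0: "\<And>x \<theta>. \<theta> \<in> U1 \<Longrightarrow> norm (g x \<theta>) ^ 3 \<le> K0 x"
    using cond_ii by auto
  obtain U2 K1 where U2: "open U2" "\<theta>\<^sub>0 \<in> U2" "U2 \<subseteq> \<Theta>" and intK1: "integrable F K1"
    and K1: "\<And>x \<theta>. \<theta> \<in> U2 \<Longrightarrow> g x differentiable (at \<theta>)" "\<And>x \<theta>. \<theta> \<in> U2 \<Longrightarrow> norm (G g x \<theta>) \<le> K1 x"
    using cond_iii by auto
  obtain U3 K2 where U3: "open U3" "\<theta>\<^sub>0 \<in> U3" "U3 \<subseteq> \<Theta>" and intK2: "integrable F K2"
    and K2: "\<And>x \<theta>. \<theta> \<in> U3 \<Longrightarrow> G g x differentiable (at \<theta>)" "\<And>x \<theta>. \<theta> \<in> U3 \<Longrightarrow> norm (dG g x \<theta>) \<le> K2 x"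
    using cond_iv by auto
  have "open (U1 \<inter> U2 \<inter> U3)" "\<theta>\<^sub>0 \<in> U1 \<inter> U2 \<inter> U3" using U1 U2 U3 by auto
  then obtain r where r: "r > 0" "ball \<theta>\<^sub>0 r \<subseteq> U1 \<inter> U2 \<inter> U3"
    by (meson open_contains_ball)
  have ball: "\<theta> \<in> U1" "\<theta> \<in> U2" "\<theta> \<in> U3" "\<theta> \<in> \<Theta>" if "\<theta> \<in> ball \<theta>\<^sub>0 r" for \<theta>
    using r(2) U1(3) that by auto
  have center: "\<theta>\<^sub>0 \<in> ball \<theta>\<^sub>0 r" using r(1) by simp

  define Y where "Y n \<omega> = (sqrt (real n) *\<^sub>R (\<theta>E n \<omega> - \<theta>\<^sub>0), sqrt (real n) *\<^sub>R t n \<omega> (\<theta>E n \<omega>))" for n \<omega>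
  have est: "converges_in_law M Y (N\<^sub>V \<Otimes>\<^sub>M N\<^sub>R)" using est_lim by (simp add: Y_def[abs_def])
  then have Y_meas: "Y n \<in> borel_measurable M" for n by (simp add: converges_in_law_def)
  have z_meas[measurable]: "(\<lambda>\<omega>. sqrt (real n) *\<^sub>R (\<theta>E n \<omega> - \<theta>\<^sub>0)) \<in> borel_measurable M"
    and s_meas[measurable]: "(\<lambda>\<omega>. sqrt (real n) *\<^sub>R t n \<omega> (\<theta>E n \<omega>)) \<in> borel_measurable M" for n
    using measurable_compose[OF Y_meas[of n], of fst borel] measurable_compose[OF Y_meas[of n], of snd borel]
    by (simp_all add: Y_def borel_prod[symmetric])
  define S where "S n \<omega> = S_stat g \<phi> n (\<lambda>i. X i \<omega>) (t n \<omega>) (\<theta>E n \<omega>) \<theta>\<^sub>0" for n \<omega>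
  have S_meas[measurable]: "S n \<in> borel_measurable M" for n
  proof (cases "n = 0")
    case True
    then show ?thesis by (simp add: S_def[abs_def] S_stat_def)
  next
    case False
    then have n: "sqrt (real n) > 0" by simp
    have "(\<lambda>\<omega>. \<theta>\<^sub>0 + (sqrt (real n) *\<^sub>R (\<theta>E n \<omega> - \<theta>\<^sub>0)) /\<^sub>R sqrt (real n)) \<in> borel_measurable M"
      by measurable
    then have \<theta>E: "\<theta>E n \<in> borel_measurable M" using n by simp
    have "(\<lambda>\<omega>. (sqrt (real n) *\<^sub>R t n \<omega> (\<theta>E n \<omega>)) /\<^sub>R sqrt (real n)) \<in> borel_measurable M"
      by measurable
    then have tE: "(\<lambda>\<omega>. t n \<omega> (\<theta>E n \<omega>)) \<in> borel_measurable M" using n by simp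
    show ?thesis
      unfolding S_def[abs_def]
      by (rule S_stat_measurable[OF g_meas sample_measurable \<theta>E est_Theta theta0 tE t_meas[OF theta0] t_mult phi])
         (use False in simp_all)
  qed

  interpret F: prob_space F by (rule prob_space_F)
  have g0[measurable]: "(\<lambda>x. g x \<theta>\<^sub>0) \<in> borel_measurable F" using null(1) by simp
  have g0i[measurable]: "(\<lambda>x. g x \<theta>\<^sub>0 $ i) \<in> borel_measurable F" for i
    unfolding cart_eq_inner_axis by measurable
  have K0_nonneg: "K0 x \<ge> 0" for x
    using K0[OF U1(2), of x] zero_le_power[OF norm_ge_zero] order_trans by blast
  have prod_bound: "\<bar>g x \<theta>\<^sub>0 $ i * g x \<theta>\<^sub>0 $ j\<bar> \<le> 1 + K0 x" for x i j
  proof -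
    have "\<bar>g x \<theta>\<^sub>0 $ i * g x \<theta>\<^sub>0 $ j\<bar> \<le> norm (g x \<theta>\<^sub>0) * norm (g x \<theta>\<^sub>0)"
      unfolding abs_mult by (intro mult_mono component_le_norm_cart) auto
    \<comment> \<open>This turns the third moment condition into integrability of the products.\<close>
    also have "\<dots> \<le> 1 + norm (g x \<theta>\<^sub>0) ^ 3"
    proof (cases "norm (g x \<theta>\<^sub>0) \<le> 1")
      case True
      then have "norm (g x \<theta>\<^sub>0) * norm (g x \<theta>\<^sub>0) \<le> 1 * 1" by (intro mult_mono) auto
      then show ?thesis using zero_le_power[OF norm_ge_zero, of "g x \<theta>\<^sub>0" 3] by linarith
    next
      case False
      then have "norm (g x \<theta>\<^sub>0) ^ 2 \<le> norm (g x \<theta>\<^sub>0) ^ 3" by (intro power_increasing) auto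
      then show ?thesis by (simp add: power2_eq_square)
    qed
    also have "\<dots> \<le> 1 + K0 x" using K0[OF U1(2), of x] by simp
    finally show ?thesis .
  qed
  have int_prod: "integrable F (\<lambda>x. g x \<theta>\<^sub>0 $ i * g x \<theta>\<^sub>0 $ j)" for i j
  proof (rule Bochner_Integration.integrable_bound)
    show "integrable F (\<lambda>x. 1 + K0 x)" using intK0 by simp
    show "AE x in F. norm (g x \<theta>\<^sub>0 $ i * g x \<theta>\<^sub>0 $ j) \<le> norm (1 + K0 x)"
      using prod_bound K0_nonneg by (intro AE_I2) (smt (verit) real_norm_def)
  qed measurable
  have mean0: "(\<integral>x. g x \<theta>\<^sub>0 $ i \<partial>F) = 0" for i
    using integral_bounded_linear[OF bounded_linear_vec_nth[of i] null(1)] null(2) by simp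
  have GF: "(\<lambda>x. G g x \<theta>\<^sub>0 $ i $ j) \<in> borel_measurable F" for i j
  proof -
    have "(\<lambda>x. G g x \<theta>\<^sub>0 $ i $ j) \<in> borel_measurable borel"
      by (rule jacobian_measurable[OF g_meas r(1)]) (use ball center K1(1) in auto)
    then show ?thesis using measurable_cong_sets[OF sets_F refl] by blast
  qed
  have int_G: "integrable F (\<lambda>x. G g x \<theta>\<^sub>0 $ i $ j)" for i j
  proof (rule Bochner_Integration.integrable_bound[OF intK1 GF])
    show "AE x in F. norm (G g x \<theta>\<^sub>0 $ i $ j) \<le> norm (K1 x)"
    proof (rule AE_I2)
      fix x
      have "norm (G g x \<theta>\<^sub>0 $ i $ j) \<le> norm (G g x \<theta>\<^sub>0 $ i)" by (rule Finite_Cartesian_Product.norm_nth_le)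
      also have "\<dots> \<le> norm (G g x \<theta>\<^sub>0)" by (rule Finite_Cartesian_Product.norm_nth_le)
      also have "\<dots> \<le> K1 x" by (rule K1(2)[OF U2(2)])
      finally show "norm (G g x \<theta>\<^sub>0 $ i $ j) \<le> norm (K1 x)" by simp
    qed
  qed

  let ?S11 = "S11 F g \<theta>\<^sub>0" and ?S12 = "S12 F g \<theta>\<^sub>0"
  define W where "W = transpose ?S12 ** matrix_inv ?S11 ** ?S12"
  have W: "positive_definite W" unfolding W_def by (rule positive_definite_congruence(1)[OF cond_i])
  have form: "z \<bullet> (W *v z) = (matrix_inv ?S11 *v (?S12 *v z)) \<bullet> (?S12 *v z)" for z
    unfolding W_def by (rule positive_definite_congruence(2)[OF cond_i])
  define q where "q z = z \<bullet> (W *v z)" for z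
  have q_cont: "continuous_on UNIV q"
    unfolding q_def by (intro continuous_intros linear_continuous_on) (auto intro: matrix_vector_mul_bounded_linear)
  have [measurable]: "q \<in> borel_measurable borel" by (rule borel_measurable_continuous_onI[OF q_cont])
  define Q where "Q n \<omega> = q (fst (Y n \<omega>))" for n \<omega>
  have Q_meas[measurable]: "Q n \<in> borel_measurable M" for n
    using z_meas[of n] unfolding Q_def Y_def fst_conv by measurable

  have NV: "prob_space N\<^sub>V" "sets N\<^sub>V = sets borel" and NR: "prob_space N\<^sub>R" "sets N\<^sub>R = sets borel"
    using lim_V lim_R by (auto simp: centred_normal_def)
  interpret NV: prob_space N\<^sub>V by fact
  interpret NR: prob_space N\<^sub>R by fact
  interpret NN: pair_prob_space N\<^sub>V N\<^sub>R ..
  have NN: "prob_space (N\<^sub>V \<Otimes>\<^sub>M N\<^sub>R)" "sets (N\<^sub>V \<Otimes>\<^sub>M N\<^sub>R) = sets borel"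
    using NN.prob_space_axioms sets_pair_measure_cong[OF NV(2) NR(2)] unfolding borel_prod by blast+

  define sc where "sc n \<omega> = (\<Sum>i<n. g (X i \<omega>) \<theta>\<^sub>0) /\<^sub>R sqrt (real n)" for n \<omega>
  have sc: "bounded_in_probability M sc"
    unfolding sc_def using int_prod mean0
    by (intro sample_sum_bounded_in_probability) (simp_all add: power2_eq_square)
  have bounded: "bounded_in_probability M (\<lambda>n \<omega>. (sc n \<omega>, Y n \<omega>))"
    by (rule bounded_in_probability_Pair[OF sc converges_in_law_bounded_in_probability[OF est NN]])
  obtain m where m: "(m \<longlongrightarrow> 0) (high_probability M)"
    "\<forall>\<^sub>F (n, \<omega>) in high_probability M. \<forall>i<n. root 3 (K0 (X i \<omega>)) \<le> m (n, \<omega>) * sqrt (real n)"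
    using sample_maximum_scaled[OF intK0 K0_nonneg] by blast
  have diff_small: "(\<lambda>n. prob {\<omega>\<in>space M. \<bar>S n \<omega> - Q n \<omega>\<bar> \<ge> \<epsilon>}) \<longlonglongrightarrow> 0" if "\<epsilon> > 0" for \<epsilon>
  proof (rule tendsto_in_probability_of_bounded[OF _ bounded _ that])
    fix H :: "(nat \<times> 'a) filter"
    assume H: "H \<le> high_probability M" and b: "Bfun (\<lambda>(n, \<omega>). (sc n \<omega>, Y n \<omega>)) H"
    have b': "Bfun (\<lambda>j. sc (fst j) (snd j)) H" "Bfun (\<lambda>j. fst (Y (fst j) (snd j))) H"
        "Bfun (\<lambda>j. snd (Y (fst j) (snd j))) H"
      using Bfun_fst_snd[OF b] Bfun_fst_snd[OF Bfun_fst_snd(2)[OF b]] by (simp_all add: case_prod_beta')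
    note lim = tendsto_mono[OF H]
    have "((\<lambda>j. S_stat g \<phi> (fst j) (\<lambda>i. X i (snd j)) (t (fst j) (snd j)) (\<theta>E (fst j) (snd j)) \<theta>\<^sub>0
       - (matrix_inv ?S11 *v (?S12 *v (sqrt (real (fst j)) *\<^sub>R (\<theta>E (fst j) (snd j) - \<theta>\<^sub>0))))
          \<bullet> (?S12 *v (sqrt (real (fst j)) *\<^sub>R (\<theta>E (fst j) (snd j) - \<theta>\<^sub>0)))) \<longlongrightarrow> 0) H"
    proof (rule el_statistic_expansion[where r=r and \<Theta>=\<Theta> and m=m and ?K1.0=K1 and ?K2.0=K2 and \<phi>=\<phi>])
      show "filterlim fst sequentially H"
        by (rule filterlim_mono[OF filterlim_fst_high_probability order_refl H])
      have "\<forall>\<^sub>F j in high_probability M. el_multiplier_function \<Theta> g (fst j) (\<lambda>i. X i (snd j)) (t (fst j) (snd j))"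
        using high_probability_space by eventually_elim (auto intro: t_mult)
      then show "\<forall>\<^sub>F j in H. el_multiplier_function \<Theta> g (fst j) (\<lambda>i. X i (snd j)) (t (fst j) (snd j))"
        by (rule filter_leD[OF H])
      obtain A where A: "\<And>n. A n \<in> sets M" "(\<lambda>n. measure M (A n)) \<longlonglongrightarrow> 1"
        "\<And>n \<omega>. \<omega> \<in> A n \<Longrightarrow> el_maximizer \<Theta> g n (\<lambda>i. X i \<omega>) (t n \<omega>) (\<theta>E n \<omega>)"
        using est_max by auto
      have "el_multiplier g n (\<lambda>i. X i \<omega>) (\<theta>E n \<omega>) (t n \<omega> (\<theta>E n \<omega>))" if "\<omega> \<in> A n" for n \<omega>
        using A(3)[OF that] by (simp add: el_maximizer_def is_arg_max_def)
      then have "\<forall>\<^sub>F j in high_probability M. el_multiplier g (fst j) (\<lambda>i. X i (snd j))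
          (\<theta>E (fst j) (snd j)) (t (fst j) (snd j) (\<theta>E (fst j) (snd j)))"
        unfolding eventually_high_probability using A(1,2) by (intro exI[of _ A]) auto
      then show "\<forall>\<^sub>F j in H. el_multiplier g (fst j) (\<lambda>i. X i (snd j))
          (\<theta>E (fst j) (snd j)) (t (fst j) (snd j) (\<theta>E (fst j) (snd j)))"
        by (rule filter_leD[OF H])
      show "(m \<longlongrightarrow> 0) H" by (rule lim[OF m(1)])
      have "\<forall>\<^sub>F j in high_probability M. \<forall>i<fst j. \<forall>\<theta>\<in>ball \<theta>\<^sub>0 r.
          norm (g (X i (snd j)) \<theta>) \<le> m j * sqrt (real (fst j))"
        using m(2)
      proof eventually_elim
        case (elim j)
        show ?case
        proof (intro allI impI ballI)
          fix i \<theta> assume i: "i < fst j" and \<theta>: "\<theta> \<in> ball \<theta>\<^sub>0 r"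
          have "norm (g (X i (snd j)) \<theta>) = root 3 (norm (g (X i (snd j)) \<theta>) ^ 3)"
            by (simp add: real_root_power_cancel)
          also have "\<dots> \<le> root 3 (K0 (X i (snd j)))"
            using K0[OF ball(1)[OF \<theta>]] by (intro real_root_le_mono) auto
          also have "\<dots> \<le> m j * sqrt (real (fst j))" using elim i by (auto simp: case_prod_beta')
          finally show "norm (g (X i (snd j)) \<theta>) \<le> m j * sqrt (real (fst j))" .
        qed
      qed
      then show "\<forall>\<^sub>F j in H. \<forall>i<fst j. \<forall>\<theta>\<in>ball \<theta>\<^sub>0 r. norm (g (X i (snd j)) \<theta>) \<le> m j * sqrt (real (fst j))"
        by (rule filter_leD[OF H])
      show "((\<lambda>j. (\<Sum>i<fst j. K1 (X i (snd j))) / real (fst j)) \<longlongrightarrow> (\<integral>x. K1 x \<partial>F)) H"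
        using lim[OF weak_law_of_large_numbers[OF intK1]] by (simp add: case_prod_beta')
      show "((\<lambda>j. (\<Sum>i<fst j. K2 (X i (snd j))) / real (fst j)) \<longlongrightarrow> (\<integral>x. K2 x \<partial>F)) H"
        using lim[OF weak_law_of_large_numbers[OF intK2]] by (simp add: case_prod_beta')
      show "((\<lambda>j. (1 / real (fst j)) *\<^sub>R (\<Sum>i<fst j. G g (X i (snd j)) \<theta>\<^sub>0)) \<longlongrightarrow> ?S12) H"
        using lim[OF sample_mean_matrix[of "\<lambda>x. G g x \<theta>\<^sub>0", OF int_G]] by (simp add: case_prod_beta' S12_def)
      show "((\<lambda>j. cross_moment (fst j) (\<lambda>i. g (X i (snd j)) \<theta>\<^sub>0) (\<lambda>i. g (X i (snd j)) \<theta>\<^sub>0)) \<longlongrightarrow> ?S11) H"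
        using lim[OF sample_mean_matrix[of "\<lambda>x. outer (g x \<theta>\<^sub>0) (g x \<theta>\<^sub>0)"]] int_prod
        by (simp add: case_prod_beta' S11_def cross_moment_def outer_def)
      show "Bfun (\<lambda>j. (\<Sum>i<fst j. g (X i (snd j)) \<theta>\<^sub>0) /\<^sub>R sqrt (real (fst j))) H"
        using b'(1) by (simp add: sc_def)
      show "Bfun (\<lambda>j. sqrt (real (fst j)) *\<^sub>R (\<theta>E (fst j) (snd j) - \<theta>\<^sub>0)) H"
        using b'(2) by (simp add: Y_def)
      show "Bfun (\<lambda>j. sqrt (real (fst j)) *\<^sub>R t (fst j) (snd j) (\<theta>E (fst j) (snd j))) H"
        using b'(3) by (simp add: Y_def)
    qed (use phi cond_i r(1) theta0 ball K1 K2 in auto)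
    then show "((\<lambda>(n, \<omega>). S n \<omega> - Q n \<omega>) \<longlongrightarrow> 0) H"
      by (simp add: case_prod_beta' S_def Q_def q_def form Y_def)
  qed measurable

  have limit: "(\<lambda>n. \<integral>\<omega>. cts_step a b (S n \<omega>) \<partial>M) \<longlonglongrightarrow> (\<integral>y. cts_step a b y \<partial>chi_square CARD('p))"
    if "a < b" for a b
  proof -
    have uc: "continuous_on UNIV (cts_step a b)"
      using cts_step_uniformly_continuous[OF \<open>a < b\<close>] by (rule uniformly_continuous_imp_continuous)
    have [measurable]: "cts_step a b \<in> borel_measurable borel" by (rule borel_measurable_continuous_onI[OF uc])
    let ?f = "\<lambda>y :: (real^'p) \<times> (real^'r). cts_step a b (q (fst y))"
    have range: "\<bar>cts_step a b x\<bar> \<le> 1" for x using \<open>a < b\<close> by (auto simp: cts_step_def field_simps)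
    have "continuous_on UNIV ?f"
      by (intro continuous_on_compose2[OF uc] continuous_on_compose2[OF q_cont] continuous_on_fst continuous_on_id) auto
    moreover have "bounded (range ?f)" by (rule boundedI[where B=1]) (auto simp: range)
    ultimately have "(\<lambda>n. \<integral>\<omega>. ?f (Y n \<omega>) \<partial>M) \<longlonglongrightarrow> (\<integral>y. ?f y \<partial>(N\<^sub>V \<Otimes>\<^sub>M N\<^sub>R))"
      using est unfolding converges_in_law_def by blast
    also have "(\<integral>y. ?f y \<partial>(N\<^sub>V \<Otimes>\<^sub>M N\<^sub>R)) = (\<integral>z. (\<integral>s. ?f (z, s) \<partial>N\<^sub>R) \<partial>N\<^sub>V)"
    proof (rule NN.integral_fst'[symmetric], rule NN.integrable_const_bound[where B=1])
      have "?f \<in> borel_measurable (borel \<Otimes>\<^sub>M borel)" by measurable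
      then show "?f \<in> borel_measurable (N\<^sub>V \<Otimes>\<^sub>M N\<^sub>R)"
        using measurable_cong_sets[OF sets_pair_measure_cong[OF NV(2) NR(2)] refl] by blast
    qed (simp add: range)
    also have "\<dots> = (\<integral>z. cts_step a b (z \<bullet> (W *v z)) \<partial>N\<^sub>V)" by (simp add: NR.prob_space q_def)
    also have "\<dots> = (\<integral>y. cts_step a b y \<partial>chi_square CARD('p))"
      by (rule quadratic_form_chi_square[OF _ W \<open>a < b\<close>]) (use lim_V in \<open>simp add: V_def W_def\<close>)
    finally have "(\<lambda>n. \<integral>\<omega>. cts_step a b (Q n \<omega>) \<partial>M) \<longlonglongrightarrow> (\<integral>y. cts_step a b y \<partial>chi_square CARD('p))"
      by (simp add: Q_def)
    from tendsto_add[OF slutsky_cts_step[OF S_meas Q_meas diff_small \<open>a < b\<close>] this]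
    show ?thesis by simp
  qed
  have "weak_conv_m (\<lambda>n. distr M borel (S n)) (chi_square CARD('p))"
  proof (rule integral_cts_step_conv_imp_weak_conv)
    show "real_distribution (distr M borel (S n))" for n by (rule real_distribution_distr) measurable
    show "real_distribution (chi_square CARD('p))" by (rule chi_square_prob_space)
    fix a b :: real assume "a < b"
    have [measurable]: "cts_step a b \<in> borel_measurable borel"
      using cts_step_uniformly_continuous[OF \<open>a < b\<close>]
      by (intro borel_measurable_continuous_onI uniformly_continuous_imp_continuous)
    have "(\<integral>y. cts_step a b y \<partial>distr M borel (S n)) = (\<integral>\<omega>. cts_step a b (S n \<omega>) \<partial>M)" for n
      by (rule integral_distr) measurable
    then show "(\<lambda>n. integral\<^sup>L (distr M borel (S n)) (cts_step a b)) \<longlonglongrightarrow> integral\<^sup>L (chi_square CARD('p)) (cts_step a b)"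
      using limit[OF \<open>a < b\<close>] by simp
  qed
  then show ?thesis using S_meas unfolding S_def[abs_def] by blast
qed

end
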